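(* Let $(t_1,j_1),\dots,(t_n,j_n)$ be pairwise distinct pairs with $t_a\in\mathbb Z$, $u_0<t_a<u_N$, and $j_a\in\mathbb Z+\frac12$. In the setting described in the context, $$ \mathrm{Prob}\big(j_a\in L(t_a)\ \text{for all } a=1,\dots,n\big)=\det\big[K((t_a,j_a),(t_b,j_b))\big]_{a,b=1}^n, $$ where $$ K((t_1,j_1),(t_2,j_2))=\frac{1}{(2\pi i)^2}\oint_{|z|=\rho_1}\oint_{|w|=\rho_2}\frac{\Phi_-(z,t_1)\,\Phi_+(w,t_2)}{\Phi_+(z,t_1)\,\Phi_-(w,t_2)}\,\frac{z^{-j_1-\frac12}\,w^{j_2-\frac12}}{z-w}\,dz\,dw . $$ Both circles are positively oriented, with radii chosen as follows: - $\rho_1<R(t_1)$ and $\rho_2>R^*(t_2)$; - $\rho_2<\rho_1$ if $t_1\ge t_2$, and $\rho_1<\rho_2$ if $t_1<t_2$. Such radii always exist, and the integral does not depend on the choice.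
   Context: Fix an integer $N\ge1$ and integers $u_0<v_1<u_1<\dots<u_{N-1}<v_N<u_N$. For each integer $t$ with $u_0<t<u_N$ fix $q_t\in(0,1)$. For a half-integer $m\in(\mathbb Z+\frac12)\cap(u_0,u_N)$ write $m\in D^+$ if $v_i<m<u_i$ for some $i$, and $m\in D^-$ if $u_{i-1}<m<v_i$ for some $i$. For partitions, $\lambda\succ\mu$ (equivalently $\mu\prec\lambda$) means $\lambda_1\ge\mu_1\ge\lambda_2\ge\cdots$. A configuration is a sequence of partitions $(\lambda(t))_{t\in\mathbb Z}$ such that: - $\lambda(t)=\emptyset$ for $t\le u_0$ and $t\ge u_N$; - for each half-integer $m\in(u_0,u_N)$: if $m\in D^-$ then $\lambda(m-\frac12)\prec\lambda(m+\frac12)$, and if $m\in D^+$ then $\lambda(m-\frac12)\succ\lambda(m+\frac12)$. A configuration has probability proportional to $\prod_{u_0<t<u_N}q_t^{|\lambda(t)|}$. For each $t$ let $L(t)=\{\lambda(t)_k-k+\frac12: k\ge1\}\subset\mathbb Z+\frac12$. Put $x^+_m=\prod_{t\in\mathbb Z,\,u_0<t<m}q_t$ and $x^-_m=(x^+_m)^{-1}$ for half-integers $m$. Define $$ \Phi_+(z,t)=\prod_{m\in D^+,\,m>t}(1-zx^+_m),\qquad \Phi_-(z,t)=\prod_{m\in D^-,\,m<t}(1-x^-_m/z), $$ $$ R(t)=\min_{m\in D^+,\,m>t}1/x^+_m\ (=+\infty\text{ if empty}),\qquad R^*(t)=\max_{m\in D^-,\,m<t}x^-_m\ (=0\text{ if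 empty}). $$ *)

theory Defs
  imports "HOL-Complex_Analysis.Complex_Analysis"
begin

definition HalfInts :: "real set" where
  "HalfInts = {x. x - 1/2 \<in> \<int>}"

definition model_ok :: "nat \<Rightarrow> (nat \<Rightarrow> int) \<Rightarrow> (nat \<Rightarrow> int) \<Rightarrow> (int \<Rightarrow> real) \<Rightarrow> bool" where
  "model_ok N u v q \<longleftrightarrow> N \<ge> 1 \<and>
     (\<forall>i\<in>{1..N}. u (i - 1) < v i \<and> v i < u i) \<and>
     (\<forall>t. u 0 < t \<and> t < u N \<longrightarrow> 0 < q t \<and> q t < 1)"

definition Dplus :: "nat \<Rightarrow> (nat \<Rightarrow> int) \<Rightarrow> (nat \<Rightarrow> int) \<Rightarrow> real set" where
  "Dplus N u v = {m. m \<in> HalfInts \<and> (\<exists>i\<in>{1..N}. real_of_int (v i) < m \<and> m < real_of_int (u i))}"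

definition Dminus :: "nat \<Rightarrow> (nat \<Rightarrow> int) \<Rightarrow> (nat \<Rightarrow> int) \<Rightarrow> real set" where
  "Dminus N u v = {m. m \<in> HalfInts \<and> (\<exists>i\<in>{1..N}. real_of_int (u (i - 1)) < m \<and> m < real_of_int (v i))}"

text \<open>Partitions: \<open>la k\<close> is the k-th part for k \<ge> 1 (index 0 is unused and normalised to 0).\<close>
definition is_partition :: "(nat \<Rightarrow> nat) \<Rightarrow> bool" where
  "is_partition la \<longleftrightarrow> la 0 = 0 \<and> (\<forall>k\<ge>1. la (Suc k) \<le> la k) \<and> finite {k. la k \<noteq> 0}"

definition psize :: "(nat \<Rightarrow> nat) \<Rightarrow> nat" where
  "psize la = (\<Sum>k\<in>{k. la k \<noteq> 0}. la k)"

definition interlace :: "(nat \<Rightarrow> nat) \<Rightarrow> (nat \<Rightarrow> nat) \<Rightarrow> bool" where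
  "interlace la mu \<longleftrightarrow> (\<forall>k\<ge>1. mu k \<le> la k \<and> la (Suc k) \<le> mu k)"

definition empty_partition :: "nat \<Rightarrow> nat" where
  "empty_partition = (\<lambda>k. 0)"

definition is_config :: "nat \<Rightarrow> (nat \<Rightarrow> int) \<Rightarrow> (nat \<Rightarrow> int) \<Rightarrow> (int \<Rightarrow> nat \<Rightarrow> nat) \<Rightarrow> bool" where
  "is_config N u v lam \<longleftrightarrow>
     (\<forall>t. is_partition (lam t)) \<and>
     (\<forall>t. t \<le> u 0 \<or> t \<ge> u N \<longrightarrow> lam t = empty_partition) \<and>
     (\<forall>t::int. u 0 \<le> t \<and> t < u N \<longrightarrow>
        (real_of_int t + 1/2 \<in> Dminus N u v \<longrightarrow> interlace (lam (t + 1)) (lam t)) \<and>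
        (real_of_int t + 1/2 \<in> Dplus N u v \<longrightarrow> interlace (lam t) (lam (t + 1))))"

definition configs :: "nat \<Rightarrow> (nat \<Rightarrow> int) \<Rightarrow> (nat \<Rightarrow> int) \<Rightarrow> (int \<Rightarrow> nat \<Rightarrow> nat) set" where
  "configs N u v = {lam. is_config N u v lam}"

definition weight :: "nat \<Rightarrow> (nat \<Rightarrow> int) \<Rightarrow> (int \<Rightarrow> real) \<Rightarrow> (int \<Rightarrow> nat \<Rightarrow> nat) \<Rightarrow> real" where
  "weight N u q lam = (\<Prod>t\<in>{u 0<..<u N}. q t ^ psize (lam t))"

definition config_prob :: "nat \<Rightarrow> (nat \<Rightarrow> int) \<Rightarrow> (nat \<Rightarrow> int) \<Rightarrow> (int \<Rightarrow> real)
    \<Rightarrow> ((int \<Rightarrow> nat \<Rightarrow> nat) \<Rightarrow> bool) \<Rightarrow> real" where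
  "config_prob N u v q E =
     infsum (weight N u q) {lam \<in> configs N u v. E lam} / infsum (weight N u q) (configs N u v)"

definition Lset :: "(nat \<Rightarrow> nat) \<Rightarrow> real set" where
  "Lset la = {real (la k) - real k + 1/2 | k. k \<ge> 1}"

definition xplus :: "(nat \<Rightarrow> int) \<Rightarrow> (int \<Rightarrow> real) \<Rightarrow> real \<Rightarrow> real" where
  "xplus u q m = (\<Prod>t\<in>{t::int. u 0 < t \<and> real_of_int t < m}. q t)"

definition xminus :: "(nat \<Rightarrow> int) \<Rightarrow> (int \<Rightarrow> real) \<Rightarrow> real \<Rightarrow> real" where
  "xminus u q m = inverse (xplus u q m)"

definition Phi_plus :: "nat \<Rightarrow> (nat \<Rightarrow> int) \<Rightarrow> (nat \<Rightarrow> int) \<Rightarrow> (int \<Rightarrow> real) \<Rightarrow> complex \<Rightarrow> int \<Rightarrow> complex" where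
  "Phi_plus N u v q z t =
     (\<Prod>m\<in>{m \<in> Dplus N u v. m > real_of_int t}. 1 - z * complex_of_real (xplus u q m))"

definition Phi_minus :: "nat \<Rightarrow> (nat \<Rightarrow> int) \<Rightarrow> (nat \<Rightarrow> int) \<Rightarrow> (int \<Rightarrow> real) \<Rightarrow> complex \<Rightarrow> int \<Rightarrow> complex" where
  "Phi_minus N u v q z t =
     (\<Prod>m\<in>{m \<in> Dminus N u v. m < real_of_int t}. 1 - complex_of_real (xminus u q m) / z)"

definition Rrad :: "nat \<Rightarrow> (nat \<Rightarrow> int) \<Rightarrow> (nat \<Rightarrow> int) \<Rightarrow> (int \<Rightarrow> real) \<Rightarrow> int \<Rightarrow> ereal" where
  "Rrad N u v q t =
     (if {m \<in> Dplus N u v. m > real_of_int t} = {} then \<infinity>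
      else ereal (Min ((\<lambda>m. 1 / xplus u q m) ` {m \<in> Dplus N u v. m > real_of_int t})))"

definition Rstar :: "nat \<Rightarrow> (nat \<Rightarrow> int) \<Rightarrow> (nat \<Rightarrow> int) \<Rightarrow> (int \<Rightarrow> real) \<Rightarrow> int \<Rightarrow> real" where
  "Rstar N u v q t =
     (if {m \<in> Dminus N u v. m < real_of_int t} = {} then 0
      else Max (xminus u q ` {m \<in> Dminus N u v. m < real_of_int t}))"

definition radii_ok :: "nat \<Rightarrow> (nat \<Rightarrow> int) \<Rightarrow> (nat \<Rightarrow> int) \<Rightarrow> (int \<Rightarrow> real) \<Rightarrow> int \<Rightarrow> int \<Rightarrow> real \<Rightarrow> real \<Rightarrow> bool" where
  "radii_ok N u v q t1 t2 rho1 rho2 \<longleftrightarrow>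
     0 < rho1 \<and> 0 < rho2 \<and>
     ereal rho1 < Rrad N u v q t1 \<and> rho2 > Rstar N u v q t2 \<and>
     (t1 \<ge> t2 \<longrightarrow> rho2 < rho1) \<and> (t1 < t2 \<longrightarrow> rho1 < rho2)"

definition Kern :: "nat \<Rightarrow> (nat \<Rightarrow> int) \<Rightarrow> (nat \<Rightarrow> int) \<Rightarrow> (int \<Rightarrow> real) \<Rightarrow> real \<Rightarrow> real
    \<Rightarrow> int \<Rightarrow> real \<Rightarrow> int \<Rightarrow> real \<Rightarrow> complex" where
  "Kern N u v q rho1 rho2 t1 j1 t2 j2 =
     1 / (2 * of_real pi * \<i>) ^ 2 *
     contour_integral (circlepath 0 rho1) (\<lambda>z.
       contour_integral (circlepath 0 rho2) (\<lambda>w.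
         (Phi_minus N u v q z t1 * Phi_plus N u v q w t2) /
         (Phi_plus N u v q z t1 * Phi_minus N u v q w t2) *
         (z powr complex_of_real (- j1 - 1/2) * w powr complex_of_real (j2 - 1/2)) / (z - w)))"

end

theory Submission
  imports Defs "Jordan_Normal_Form.Determinant"
begin

text \<open>Only the first \<open>M\<close> parts of the partitions matter once \<open>M\<close> is at least the number of steps, so a
  configuration is a family of \<open>M\<close> non-intersecting lattice paths. By Lindstroem--Gessel--Viennot the sum
  over configurations, with a factor \<open>1 + s\<close> for every prescribed point that is occupied, is an
  \<open>M \<times> M\<close> determinant of a product of one-step transfer operators. By the argument of Eynard and Mehta it
  equals the partition function times the \<open>n \<times> n\<close> determinant of \<open>1 + s K\<close>, provided the linear systems
  for the Gram matrix can be solved on the columns of the prescribed points. They can, explicitly: one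
  transfer step maps the Laurent coefficients of \<open>\<Phi>\<^sub>- / \<Phi>\<^sub>+\<close> at one time to those at the next time,
  so the solutions are built from these coefficients and those of \<open>\<Phi>\<^sub>+ / \<Phi>\<^sub>-\<close>. The resulting \<open>K\<close> is
  what the double contour integral evaluates to, and the probability that all points are occupied is
  the coefficient of the top power of \<open>s\<close>.\<close>

section \<open>Determinants\<close>

text \<open>The Gram systems are explicitly solvable because the symbols
  \<open>\<Phi>\<^sub>- / \<Phi>\<^sub>+\<close> at consecutive times differ by one factor.
  Convolving, over all shifts \<open>c\<close>, the coefficients of the symbol with those of its
  reciprocal at the time of a marked point gives a finitely supported sequence, which the steps
  carry to a unit vector. The solution arises by cutting this convolution at \<open>c = M\<close>:
  the shifts \<open>c < M\<close> contribute nothing at positions from \<open>M\<close> on at the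
  first reversed time, the shifts \<open>c >= M\<close> contribute nothing at positions below
  \<open>M\<close> at the last one. These are the two boundary conditions of the
  \<open>M\<close>-dimensional system. The obstacle is that positions are unbounded, so steps are
  infinite sums. Path sums are formed with positions below a cutoff \<open>L\<close> and controlled
  by geometric bounds uniform in \<open>L\<close>; in reversed time the rates
  \<open>x\<^sub>m\<^sup>+\<close> increase strictly, so the output of each step is admissible for
  the next one. Factors \<open>1 + s\<close> are used instead of indicators because they differ from
  1 only at the \<open>n\<close> marked points, which makes the perturbation one of rank at most
  \<open>n\<close>, whatever \<open>M\<close> is.\<close>

definition dt :: "nat \<Rightarrow> (nat \<Rightarrow> nat \<Rightarrow> 'a::comm_ring_1) \<Rightarrow> 'a" where
  "dt n f = Determinant.det (mat n n (\<lambda>(i, j). f i j))"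

lemma permutes_less_iff: "p permutes {0..<n} \<Longrightarrow> p i < n \<longleftrightarrow> i < (n::nat)"
  using permutes_in_image[of p "{0..<n}" i] by simp

lemma dt_eq_sum:
  "dt n f = (\<Sum>p | p permutes {0..<n}. of_int (sign p) * (\<Prod>i = 0..<n. f i (p i)))"
proof -
  have "dt n f = (\<Sum>p | p permutes {0..<n}. of_int (sign p) *
          (\<Prod>i = 0..<n. mat n n (\<lambda>(i, j). f i j) $$ (i, p i)))"
    unfolding dt_def by (subst det_def'[of _ n]) auto
  also have "\<dots> = (\<Sum>p | p permutes {0..<n}. of_int (sign p) * (\<Prod>i = 0..<n. f i (p i)))"
    by (intro sum.cong refl arg_cong2[where f = "(*)"] prod.cong) (auto simp: permutes_less_iff)
  finally show ?thesis .
qed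

lemma dt_cong: "(\<And>i j. i < n \<Longrightarrow> j < n \<Longrightarrow> f i j = g i j) \<Longrightarrow> dt n f = dt n g"
  unfolding dt_def by (rule arg_cong[where f = Determinant.det]) (auto intro!: eq_matI)

lemma dt_permute_rows:
  "p permutes {0..<n} \<Longrightarrow> dt n (\<lambda>i j. f (p i) j) = of_int (sign p) * dt n f"
proof -
  assume p: "p permutes {0..<n}"
  have "dt n (\<lambda>i j. f (p i) j)
      = Determinant.det (mat n n (\<lambda>(i, j). mat n n (\<lambda>(i, j). f i j) $$ (p i, j)))"
    unfolding dt_def
    by (rule arg_cong[where f = Determinant.det]) (auto intro!: eq_matI simp: permutes_less_iff[OF p])
  also have "\<dots> = of_int (sign p) * dt n f"
    unfolding dt_def by (rule det_permute_rows[OF _ p]) simp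
  finally show ?thesis .
qed

lemma dt_identical_rows:
  assumes "i < n" "i' < n" "i \<noteq> i'" "\<And>j. j < n \<Longrightarrow> f i j = f i' j"
  shows "dt n f = 0"
  unfolding dt_def
  by (rule det_identical_rows[of _ n i i']) (use assms in \<open>auto intro!: eq_vecI\<close>)

lemma dt_zero_row:
  assumes "i < n" "\<And>j. j < n \<Longrightarrow> f i j = 0"
  shows "dt n f = 0"
  unfolding dt_eq_sum
proof (rule sum.neutral, safe)
  fix p assume p: "p permutes {0..<n}"
  have "(\<Prod>i = 0..<n. f i (p i)) = 0"
    using assms permutes_less_iff[OF p, of i] by (intro prod_zero bexI[of _ i]) simp_all
  then show "of_int (sign p) * (\<Prod>i = 0..<n. f i (p i)) = 0" by simp
qed

lemma dt_transpose: "dt n (\<lambda>i j. f j i) = dt n f"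
proof -
  have "mat n n (\<lambda>(i, j). f j i) = transpose_mat (mat n n (\<lambda>(i, j). f i j))"
    by (auto intro!: eq_matI)
  then show ?thesis
    unfolding dt_def using det_transpose[of "mat n n (\<lambda>(i, j). f i j)" n] by simp
qed

lemma dt_upper_triangular:
  assumes "\<And>i j. j < i \<Longrightarrow> i < n \<Longrightarrow> f i j = 0" "\<And>i. i < n \<Longrightarrow> f i i = 1"
  shows "dt n f = 1"
proof -
  have "dt n f = prod_list (diag_mat (mat n n (\<lambda>(i, j). f i j)))"
    unfolding dt_def by (rule det_upper_triangular[of _ n]) (use assms in auto)
  also have "\<dots> = prod_list (map (\<lambda>i. 1) [0..<n])"
    unfolding diag_mat_def by (rule arg_cong[where f = prod_list]) (use assms in auto)
  finally show ?thesis by (simp add: map_replicate_const)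
qed

lemma dt_mult: "dt n f * dt n g = dt n (\<lambda>i k. \<Sum>j<n. f i j * g j k)"
proof -
  have "mat n n (\<lambda>(i, j). f i j) * mat n n (\<lambda>(i, j). g i j)
      = mat n n (\<lambda>(i, k). \<Sum>j<n. f i j * g j k)"
    by (auto intro!: eq_matI sum.cong simp: scalar_prod_def atLeast0LessThan)
  then show ?thesis
    unfolding dt_def using det_mult[of "mat n n (\<lambda>(i, j). f i j)" n "mat n n (\<lambda>(i, j). g i j)"]
    by simp
qed

lemma dt_scale: "dt n (\<lambda>i j. x i * y j * f i j) = (\<Prod>i<n. x i) * (\<Prod>i<n. y i) * dt n f"
proof -
  have "(\<Prod>i = 0..<n. x i * y (p i) * f i (p i))
      = (\<Prod>i<n. x i) * (\<Prod>i<n. y i) * (\<Prod>i = 0..<n. f i (p i))" if p: "p permutes {0..<n}" for p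
  proof -
    have "(\<Prod>i = 0..<n. y (p i)) = (\<Prod>i = 0..<n. y i)"
      using prod.permute[OF p, of y] by (simp add: o_def)
    then show ?thesis by (simp add: prod.distrib atLeast0LessThan)
  qed
  then show ?thesis
    unfolding dt_eq_sum by (simp add: sum_distrib_left mult_ac)
qed

text \<open>Multiplying \<open>C\<close> by the unipotent \<open>U\<close> from the left or from the
  right clears the upper right block both times, but leaves \<open>1 + XM * BM\<close> in one
  diagonal corner or \<open>1 + BM * XM\<close> in the other. This shrinks a determinant over paths
  to one over marked points.\<close>

lemma dt_sylvester:
  fixes X B :: "nat \<Rightarrow> nat \<Rightarrow> 'a::idom"
  shows "dt m (\<lambda>i k. (if i = k then 1 else 0) + (\<Sum>b<n. X i b * B b k))
       = dt n (\<lambda>a b. (if a = b then 1 else 0) + (\<Sum>k<m. B a k * X k b))"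
proof -
  define XM where "XM = mat m n (\<lambda>(i, b). X i b)"
  define BM where "BM = mat n m (\<lambda>(b, k). B b k)"
  have [simp]: "XM \<in> carrier_mat m n" "BM \<in> carrier_mat n m" by (auto simp: XM_def BM_def)
  have [simp]: "XM * BM \<in> carrier_mat m m" "BM * XM \<in> carrier_mat n n"
    by (simp_all add: mult_carrier_mat[of _ m n] mult_carrier_mat[of _ n m])
  define C where "C = four_block_mat (1\<^sub>m m) (- XM) BM (1\<^sub>m n)"
  define U where "U = four_block_mat (1\<^sub>m m) XM (0\<^sub>m n m) (1\<^sub>m n)"
  have C: "C \<in> carrier_mat (m + n) (m + n)" and U: "U \<in> carrier_mat (m + n) (m + n)"
    by (auto simp: C_def U_def)
  have blocks: "1\<^sub>m m * - XM = - XM" "XM * 1\<^sub>m n = XM" "1\<^sub>m m * XM = XM" "- XM * 1\<^sub>m n = - XM"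
    "- XM + XM = 0\<^sub>m m n" "0\<^sub>m n m * - XM = 0\<^sub>m n n"
    "- XM * 0\<^sub>m n m = 0\<^sub>m m m" "1\<^sub>m n * BM = BM" "BM * 1\<^sub>m m = BM"
    by (rule left_mult_one_mat[of _ m n] left_mult_one_mat[of _ n m] right_mult_one_mat[of _ m n]
        right_mult_one_mat[of _ n m] left_mult_zero_mat[of _ m n] right_mult_zero_mat[of _ m n]
        uminus_l_inv_mat[of _ m n], simp)+
  have blocks': "XM + - XM = 0\<^sub>m m n"
    using blocks(5) comm_add_mat[of XM m n "- XM"] by simp
  have comm: "BM * XM + 1\<^sub>m n = 1\<^sub>m n + BM * XM"
    by (rule comm_add_mat[of _ n n]) (simp_all)
  have UC: "U * C = four_block_mat (1\<^sub>m m + XM * BM) (0\<^sub>m m n) BM (1\<^sub>m n)"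
    unfolding U_def C_def
    by (subst mult_four_block_mat[of _ m m _ n _ n _ _ m _ n]) (simp_all add: blocks)
  have CU: "C * U = four_block_mat (1\<^sub>m m) (0\<^sub>m m n) BM (1\<^sub>m n + BM * XM)"
    unfolding U_def C_def
    by (subst mult_four_block_mat[of _ m m _ n _ n _ _ m _ n])
       (simp_all add: blocks blocks' comm)
  have "Determinant.det (U * C) = Determinant.det (C * U)"
    by (simp add: det_mult[OF U C] det_mult[OF C U])
  moreover have "Determinant.det (U * C) = Determinant.det (1\<^sub>m m + XM * BM)"
    unfolding UC by (subst det_four_block_mat_upper_right_zero[of _ m _ n]) auto
  moreover have "Determinant.det (C * U) = Determinant.det (1\<^sub>m n + BM * XM)"
    unfolding CU by (subst det_four_block_mat_upper_right_zero[of _ m _ n]) auto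
  moreover have "1\<^sub>m m + XM * BM = mat m m (\<lambda>(i, k). (if i = k then 1 else 0) + (\<Sum>b<n. X i b * B b k))"
    by (auto intro!: eq_matI sum.cong simp: XM_def BM_def scalar_prod_def atLeast0LessThan)
  moreover have "1\<^sub>m n + BM * XM = mat n n (\<lambda>(i, k). (if i = k then 1 else 0) + (\<Sum>b<m. B i b * X b k))"
    by (auto intro!: eq_matI sum.cong simp: XM_def BM_def scalar_prod_def atLeast0LessThan)
  ultimately show ?thesis unfolding dt_def by simp
qed

section \<open>Increasing tuples and the Cauchy-Binet formula\<close>

definition incr_tuples :: "nat \<Rightarrow> nat set \<Rightarrow> (nat \<Rightarrow> nat) set" where
  "incr_tuples M X = {P \<in> {..<M} \<rightarrow>\<^sub>E X. strict_mono_on {..<M} P}"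

lemma strict_mono_on_lessThan_nth:
  fixes P :: "nat \<Rightarrow> nat"
  assumes "strict_mono_on {..<M} P" "i < M"
  shows "P i = sorted_list_of_set (P ` {..<M}) ! i"
proof -
  have "sorted_wrt (<) (map P [0..<M])"
    using assms(1) by (auto simp: sorted_wrt_iff_nth_less strict_mono_on_def)
  moreover have "set (map P [0..<M]) = P ` {..<M}"
    by (auto simp: atLeast0LessThan)
  ultimately have "sorted_list_of_set (P ` {..<M}) = map P [0..<M]"
    by (metis List.finite_set sorted_list_of_set.idem_if_sorted_distinct strict_sorted_iff)
  then show ?thesis using assms(2) by simp
qed

lemma strict_mono_on_lessThan_unique:
  fixes P Q :: "nat \<Rightarrow> nat"
  assumes "strict_mono_on {..<M} P" "strict_mono_on {..<M} Q" "P ` {..<M} = Q ` {..<M}" "i < M"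
  shows "P i = Q i"
  using strict_mono_on_lessThan_nth assms by metis

lemma finite_incr_tuples: "finite X \<Longrightarrow> finite (incr_tuples M X)"
  unfolding incr_tuples_def by (rule finite_subset[of _ "{..<M} \<rightarrow>\<^sub>E X"]) (auto intro: finite_PiE)

text \<open>An injective map is, in a unique way, a permutation followed by the increasing
  enumeration of its image. Extensional function spaces make maps equal as soon as they agree below
  \<open>M\<close>.\<close>

lemma bij_betw_incr_tuples_permutations:
  "bij_betw (\<lambda>(P, \<sigma>). restrict (P \<circ> \<sigma>) {..<M})
     (incr_tuples M X \<times> {\<sigma>. \<sigma> permutes {..<M}}) {s \<in> {..<M} \<rightarrow>\<^sub>E X. inj_on s {..<M}}"
proof (rule bij_betw_imageI)
  show "inj_on (\<lambda>(P, \<sigma>). restrict (P \<circ> \<sigma>) {..<M}) (incr_tuples M X \<times> {\<sigma>. \<sigma> permutes {..<M}})"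
  proof (rule inj_onI, clarsimp)
    fix P \<sigma> Q \<tau>
    assume P: "P \<in> incr_tuples M X" and Q: "Q \<in> incr_tuples M X"
      and s: "\<sigma> permutes {..<M}" and t: "\<tau> permutes {..<M}"
      and eq: "restrict (P \<circ> \<sigma>) {..<M} = restrict (Q \<circ> \<tau>) {..<M}"
    have e: "P (\<sigma> i) = Q (\<tau> i)" if "i < M" for i
      using fun_cong[OF eq, of i] that by simp
    have "P ` {..<M} = P ` \<sigma> ` {..<M}" using permutes_image[OF s] by simp
    also have "\<dots> = Q ` \<tau> ` {..<M}" using e by (force simp: image_image)
    also have "\<dots> = Q ` {..<M}" using permutes_image[OF t] by simp
    finally have "P i = Q i" if "i < M" for i
      using strict_mono_on_lessThan_unique[of M P Q i] P Q that by (auto simp: incr_tuples_def)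
    then have PQ: "P = Q"
      using P Q by (intro ext) (metis (no_types, lifting) PiE_arb incr_tuples_def lessThan_iff mem_Collect_eq)
    have "inj_on P {..<M}" using P by (auto simp: incr_tuples_def strict_mono_on_imp_inj_on)
    moreover have "\<sigma> i < M" "\<tau> i < M" if "i < M" for i
      using that permutes_in_image[OF s, of i] permutes_in_image[OF t, of i] by auto
    ultimately have "\<sigma> i = \<tau> i" if "i < M" for i
      using e[OF that] PQ that by (auto simp: inj_on_def)
    moreover have "\<sigma> i = \<tau> i" if "\<not> i < M" for i
      using s t that by (auto simp: permutes_def)
    ultimately show "P = Q \<and> \<sigma> = \<tau>" using PQ by blast
  qed
next
  show "(\<lambda>(P, \<sigma>). restrict (P \<circ> \<sigma>) {..<M}) ` (incr_tuples M X \<times> {\<sigma>. \<sigma> permutes {..<M}})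
      = {s \<in> {..<M} \<rightarrow>\<^sub>E X. inj_on s {..<M}}"
  proof (intro equalityI subsetI)
    fix s assume "s \<in> (\<lambda>(P, \<sigma>). restrict (P \<circ> \<sigma>) {..<M}) ` (incr_tuples M X \<times> {\<sigma>. \<sigma> permutes {..<M}})"
    then obtain P \<sigma> where P: "P \<in> incr_tuples M X" and \<sigma>: "\<sigma> permutes {..<M}"
      and s: "s = restrict (P \<circ> \<sigma>) {..<M}" by auto
    have "inj_on P {..<M}" using P by (simp add: incr_tuples_def strict_mono_on_imp_inj_on)
    then have "inj_on (P \<circ> \<sigma>) {..<M}"
      by (intro comp_inj_on permutes_inj_on[OF \<sigma>]) (simp add: permutes_image[OF \<sigma>])
    moreover have "\<sigma> i < M" if "i < M" for i
      using that permutes_in_image[OF \<sigma>, of i] by auto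
    ultimately show "s \<in> {s \<in> {..<M} \<rightarrow>\<^sub>E X. inj_on s {..<M}}"
      using P by (auto simp: s incr_tuples_def PiE_def Pi_def)
  next
    fix s assume "s \<in> {s \<in> {..<M} \<rightarrow>\<^sub>E X. inj_on s {..<M}}"
    then have s: "s \<in> {..<M} \<rightarrow>\<^sub>E X" and inj: "inj_on s {..<M}" by auto
    define Y where "Y = s ` {..<M}"
    have Y: "finite Y" "card Y = M" using inj by (auto simp: Y_def card_image)
    define P where "P = restrict (\<lambda>i. sorted_list_of_set Y ! i) {..<M}"
    have bij: "bij_betw P {..<M} Y"
    proof -
      have "bij_betw (\<lambda>i. sorted_list_of_set Y ! i) {..<M} Y"
        using Y bij_betw_nth[of "sorted_list_of_set Y" "{..<M}" Y] by auto
      then show ?thesis using bij_betw_cong[of "{..<M}" P "\<lambda>i. sorted_list_of_set Y ! i" Y]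
        by (auto simp: P_def)
    qed
    have "strict_mono_on {..<M} P"
      using Y sorted_wrt_nth_less[OF strict_sorted_list_of_set[of Y]]
      by (auto simp: strict_mono_on_def P_def)
    moreover have "P \<in> {..<M} \<rightarrow>\<^sub>E X"
    proof (rule PiE_I)
      fix i assume "i \<in> {..<M}"
      then have "P i \<in> Y" using bij_betw_imp_surj_on[OF bij] by (metis imageI)
      then obtain k where "k \<in> {..<M}" "P i = s k" unfolding Y_def by blast
      then show "P i \<in> X" using PiE_mem[OF s, of k] by metis
    qed (simp add: P_def)
    ultimately have P: "P \<in> incr_tuples M X" by (simp add: incr_tuples_def)
    define \<sigma> where "\<sigma> i = (if i < M then inv_into {..<M} P (s i) else i)" for i
    have "bij_betw (inv_into {..<M} P \<circ> s) {..<M} {..<M}"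
      using bij_betw_trans[OF _ bij_betw_inv_into[OF bij], of s "{..<M}"] inj
      by (simp add: Y_def bij_betw_def)
    then have "bij_betw \<sigma> {..<M} {..<M}"
      using bij_betw_cong[of "{..<M}" \<sigma> "inv_into {..<M} P \<circ> s"] by (auto simp: \<sigma>_def)
    then have \<sigma>: "\<sigma> permutes {..<M}"
      by (intro bij_imp_permutes) (auto simp: \<sigma>_def)
    have "s i = restrict (P \<circ> \<sigma>) {..<M} i" for i
    proof (cases "i < M")
      case True
      then have "s i \<in> P ` {..<M}" using bij by (auto simp: bij_betw_def Y_def)
      then show ?thesis using True by (simp add: \<sigma>_def f_inv_into_f)
    next
      case False
      then show ?thesis using s by (auto simp: PiE_def extensional_def)
    qed
    then have "s = (\<lambda>(P, \<sigma>). restrict (P \<circ> \<sigma>) {..<M}) (P, \<sigma>)" by (simp add: fun_eq_iff)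
    moreover have "(P, \<sigma>) \<in> incr_tuples M X \<times> {\<sigma>. \<sigma> permutes {..<M}}" using P \<sigma> by simp
    ultimately show "s \<in> (\<lambda>(P, \<sigma>). restrict (P \<circ> \<sigma>) {..<M}) ` (incr_tuples M X \<times> {\<sigma>. \<sigma> permutes {..<M}})"
      by (rule image_eqI)
  qed
qed

text \<open>Expanding every row of the product leaves a choice \<open>s\<close> of summands. A
  repeated choice gives two equal rows; the injective choices are grouped by their sorted tuple, and
  the permutations in a group reassemble the first determinant.\<close>

lemma cauchy_binet:
  assumes X: "finite X"
  shows "dt M (\<lambda>i k. \<Sum>p\<in>X. A i p * B p k)
       = (\<Sum>P\<in>incr_tuples M X. dt M (\<lambda>i j. A i (P j)) * dt M (\<lambda>j k. B (P j) k))"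
proof -
  let ?PE = "{..<M} \<rightarrow>\<^sub>E X"
  let ?F = "\<lambda>s. (\<Prod>i<M. A i (s i)) * dt M (\<lambda>i k. B (s i) k)"
  have "dt M (\<lambda>i k. \<Sum>p\<in>X. A i p * B p k)
      = (\<Sum>\<pi> | \<pi> permutes {..<M}. of_int (sign \<pi>) * (\<Prod>i<M. \<Sum>p\<in>X. A i p * B p (\<pi> i)))"
    by (simp add: dt_eq_sum atLeast0LessThan)
  also have "\<dots> = (\<Sum>\<pi> | \<pi> permutes {..<M}. \<Sum>s\<in>?PE.
      (\<Prod>i<M. A i (s i)) * (of_int (sign \<pi>) * (\<Prod>i<M. B (s i) (\<pi> i))))"
    by (simp add: prod_sum_PiE X prod.distrib sum_distrib_left mult_ac)
  also have "\<dots> = (\<Sum>s\<in>?PE. ?F s)"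
    by (subst sum.swap) (simp add: dt_eq_sum atLeast0LessThan sum_distrib_left)
  also have "\<dots> = (\<Sum>s\<in>{s\<in>?PE. inj_on s {..<M}}. ?F s)"
  proof (rule sum.mono_neutral_right)
    show "finite ?PE" using X by (auto intro: finite_PiE)
    show "\<forall>s\<in>?PE - {s \<in> ?PE. inj_on s {..<M}}. ?F s = 0"
    proof
      fix s assume "s \<in> ?PE - {s \<in> ?PE. inj_on s {..<M}}"
      then obtain i j where "i < M" "j < M" "i \<noteq> j" "s i = s j"
        by (auto simp: inj_on_def)
      then have "dt M (\<lambda>i k. B (s i) k) = 0"
        by (intro dt_identical_rows[of i M j]) auto
      then show "?F s = 0" by simp
    qed
  qed auto
  also have "\<dots> = (\<Sum>(P, \<sigma>)\<in>incr_tuples M X \<times> {\<sigma>. \<sigma> permutes {..<M}}. ?F (restrict (P \<circ> \<sigma>) {..<M}))"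
    by (subst sum.reindex_bij_betw[OF bij_betw_incr_tuples_permutations, symmetric])
       (simp add: case_prod_unfold)
  also have "\<dots> = (\<Sum>(P, \<sigma>)\<in>incr_tuples M X \<times> {\<sigma>. \<sigma> permutes {..<M}}.
      (\<Prod>i<M. A i (P (\<sigma> i))) * (of_int (sign \<sigma>) * dt M (\<lambda>j k. B (P j) k)))"
  proof (rule sum.cong[OF refl], clarify)
    fix P \<sigma> assume "P \<in> incr_tuples M X" and \<sigma>: "\<sigma> permutes {..<M}"
    have "dt M (\<lambda>i. B (restrict (P \<circ> \<sigma>) {..<M} i)) = dt M (\<lambda>i k. B (P (\<sigma> i)) k)"
      by (rule dt_cong) simp
    also have "\<dots> = of_int (sign \<sigma>) * dt M (\<lambda>j k. B (P j) k)"
      using dt_permute_rows[of \<sigma> M "\<lambda>j k. B (P j) k"] \<sigma> by (simp add: atLeast0LessThan)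
    finally show "?F (restrict (P \<circ> \<sigma>) {..<M})
      = (\<Prod>i<M. A i (P (\<sigma> i))) * (of_int (sign \<sigma>) * dt M (\<lambda>j k. B (P j) k))" by simp
  qed
  also have "\<dots> = (\<Sum>P\<in>incr_tuples M X. dt M (\<lambda>i j. A i (P j)) * dt M (\<lambda>j k. B (P j) k))"
    unfolding sum.cartesian_product[symmetric]
  proof (rule sum.cong[OF refl])
    fix P
    show "(\<Sum>\<sigma> | \<sigma> permutes {..<M}. (\<Prod>i<M. A i (P (\<sigma> i))) * (of_int (sign \<sigma>) * dt M (\<lambda>j k. B (P j) k)))
        = dt M (\<lambda>i j. A i (P j)) * dt M (\<lambda>j k. B (P j) k)"
      unfolding dt_eq_sum[of M "\<lambda>i j. A i (P j)"] sum_distrib_right atLeast0LessThan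
      by (simp add: mult_ac)
  qed
  finally show ?thesis .
qed

section \<open>Interlacing as a determinant of indicators\<close>

definition interlaced :: "nat \<Rightarrow> (nat \<Rightarrow> nat) \<Rightarrow> (nat \<Rightarrow> nat) \<Rightarrow> bool" where
  "interlaced M P Q \<longleftrightarrow> (\<forall>j<M. P j \<le> Q j) \<and> (\<forall>j. Suc j < M \<longrightarrow> Q j < P (Suc j))"

text \<open>Row \<open>j\<close> is the indicator of \<open>k >= r j\<close>, with
  \<open>r j\<close> the number of \<open>Q\<close>-positions below \<open>P j\<close>. A nonzero
  determinant excludes zero rows and equal rows, so \<open>r\<close> is a strictly increasing
  self-map of \<open>{..<M}\<close>, hence the identity, which is interlacing. As no sign is left
  over, sums of products of such determinants count interlacing chains.\<close>

lemma dt_interlaced: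
  assumes P: "strict_mono_on {..<M} P" and Q: "strict_mono_on {..<M} Q"
  shows "dt M (\<lambda>j k. if P j \<le> Q k then 1 else 0) = of_bool (interlaced M P Q)"
proof -
  have Pm: "P i < P j" if "i < j" "j < M" for i j using P that by (auto simp: strict_mono_on_def)
  have Qm: "Q i < Q j" if "i < j" "j < M" for i j using Q that by (auto simp: strict_mono_on_def)
  let ?f = "\<lambda>j k. if P j \<le> Q k then 1 else 0 :: 'a"
  show ?thesis
  proof (cases "interlaced M P Q")
    case True
    have "dt M ?f = 1"
    proof (rule dt_upper_triangular)
      fix i j assume "j < i" "i < M"
      have "Q j < P (Suc j)" using True \<open>j < i\<close> \<open>i < M\<close> by (simp add: interlaced_def)
      also have "P (Suc j) \<le> P i" using Pm[of "Suc j" i] \<open>j < i\<close> \<open>i < M\<close> by (cases "Suc j = i") auto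
      finally show "?f i j = 0" by simp
    qed (use True in \<open>auto simp: interlaced_def\<close>)
    then show ?thesis using True by simp
  next
    case False
    have "dt M ?f = 0"
    proof (rule ccontr)
      assume nz: "dt M ?f \<noteq> 0"
      define r where "r j = card {k. k < M \<and> Q k < P j}" for j
      have Mr: "{k. k < M \<and> Q k < P j} = {..<r j}" for j
      proof -
        have down: "l \<in> {k. k < M \<and> Q k < P j}" if "k \<in> {k. k < M \<and> Q k < P j}" "l \<le> k" for k l
          using that Qm[of l k] by (cases "l = k") auto
        define K where "K = {k. k < M \<and> Q k < P j}"
        have "finite K" by (auto simp: K_def)
        have "K = {..<card K}"
        proof (cases "K = {}")
          case False
          have "K = {..Max K}"
            using down Max_in[OF \<open>finite K\<close> False] Max_ge[OF \<open>finite K\<close>] unfolding K_def by blast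
          then show ?thesis by (metis card_atMost lessThan_Suc_atMost)
        qed simp
        then show ?thesis unfolding K_def r_def .
      qed
      have iff: "P j \<le> Q k \<longleftrightarrow> r j \<le> k" if "k < M" for j k
      proof -
        have "k \<in> {k. k < M \<and> Q k < P j} \<longleftrightarrow> k < r j" unfolding Mr by simp
        then show ?thesis using that by auto
      qed
      have rM: "r j < M" if "j < M" for j
      proof (rule ccontr)
        assume "\<not> r j < M"
        then have "dt M ?f = 0" using iff that by (intro dt_zero_row[of j]) auto
        with nz show False by simp
      qed
      have "strict_mono_on {..<M} r"
      proof (rule strict_mono_onI)
        fix i j assume ij: "i \<in> {..<M}" "j \<in> {..<M}" "i < j"
        have "r i \<le> r j" unfolding r_def
          by (rule card_mono) (use Pm[of i j] ij in auto)
        moreover have "r i \<noteq> r j"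
        proof
          assume "r i = r j"
          then have "dt M ?f = 0" using iff ij by (intro dt_identical_rows[of i M j]) auto
          with nz show False by simp
        qed
        ultimately show "r i < r j" by simp
      qed
      moreover have "r ` {..<M} = {..<M}"
        using rM strict_mono_on_imp_inj_on[OF calculation]
        by (intro endo_inj_surj) auto
      ultimately have rid: "r j = j" if "j < M" for j
        using strict_mono_on_lessThan_unique[of M r "\<lambda>x. x" j] that by (auto simp: strict_mono_on_def)
      have "interlaced M P Q"
        unfolding interlaced_def using iff rid by (metis Suc_lessD lessI linorder_not_le order.refl)
      with False show False by simp
    qed
    then show ?thesis using False by simp
  qed
qed

section \<open>Transfer operators\<close>

text \<open>Among the indices moved by a permutation other than the identity, one with minimal
  \<tau> is sent to an index of no smaller \<tau>, where the entry vanishes. Ties in \<tau> are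
  allowed.\<close>

lemma dt_unipotent:
  fixes \<tau> :: "nat \<Rightarrow> 'b::linorder"
  assumes "\<And>a b. a < n \<Longrightarrow> b < n \<Longrightarrow> \<tau> a \<le> \<tau> b \<Longrightarrow> H a b = 0"
  shows "dt n (\<lambda>a b. (if a = b then 1 else 0) + H a b) = 1"
proof -
  let ?f = "\<lambda>a b. (if a = b then 1 else 0) + H a b"
  have "of_int (sign p) * (\<Prod>i = 0..<n. ?f i (p i)) = of_bool (p = id)" if p: "p permutes {0..<n}" for p
  proof (cases "p = id")
    case True
    then show ?thesis using assms by (simp add: prod.neutral)
  next
    case False
    define N where "N = {i \<in> {0..<n}. p i \<noteq> i}"
    have "N \<noteq> {}" using False p unfolding N_def permutes_def by (auto simp: fun_eq_iff)
    moreover have "finite N" by (simp add: N_def)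
    ultimately obtain a where a: "a \<in> N" "\<And>b. b \<in> N \<Longrightarrow> \<tau> a \<le> \<tau> b"
      by (metis arg_min_if_finite(1) arg_min_least)
    have "p a \<in> N"
      using a(1) permutes_less_iff[OF p] permutes_inj[OF p] by (auto simp: N_def inj_def)
    then have "?f a (p a) = 0"
      using a assms by (auto simp: N_def)
    then have "(\<Prod>i = 0..<n. ?f i (p i)) = 0"
      using a(1) by (intro prod_zero bexI[of _ a]) (auto simp: N_def)
    then show ?thesis using False by simp
  qed
  then have "dt n ?f = (\<Sum>p | p permutes {0..<n}. of_bool (p = id))"
    unfolding dt_eq_sum by (intro sum.cong) auto
  also have "\<dots> = (\<Sum>p\<in>{id :: nat \<Rightarrow> nat}. 1)"
    by (rule sum.mono_neutral_cong_right) (auto simp: finite_permutations permutes_id)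
  finally show ?thesis by simp
qed

section \<open>Transfer products over finitely many positions and path families\<close>

fun prop_fin :: "(nat \<Rightarrow> nat \<Rightarrow> nat \<Rightarrow> 'a::comm_ring_1) \<Rightarrow> (nat \<Rightarrow> nat \<Rightarrow> 'a) \<Rightarrow> nat set
    \<Rightarrow> (nat \<Rightarrow> 'a) \<Rightarrow> nat \<Rightarrow> nat \<Rightarrow> 'a" where
  "prop_fin T g X v 0 = v"
| "prop_fin T g X v (Suc n) = (\<lambda>p. g (Suc n) p * (\<Sum>p'\<in>X. T (Suc n) p p' * prop_fin T g X v n p'))"

definition unit_vec_at :: "nat \<Rightarrow> nat \<Rightarrow> 'a::zero_neq_one" where
  "unit_vec_at k = (\<lambda>p. of_bool (p = k))"

text \<open>\<open>P\<close> is the tuple after the step and \<open>Q\<close> the one before it. The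
  factors \<open>g\<close> sit at the new positions, so the starting tuple carries no mark.\<close>

definition step_weight :: "nat \<Rightarrow> (nat \<Rightarrow> nat \<Rightarrow> nat \<Rightarrow> 'a::comm_ring_1) \<Rightarrow> (nat \<Rightarrow> nat \<Rightarrow> 'a)
    \<Rightarrow> nat \<Rightarrow> (nat \<Rightarrow> nat) \<Rightarrow> (nat \<Rightarrow> nat) \<Rightarrow> 'a" where
  "step_weight M T g i P Q = (\<Prod>j<M. g i (P j)) * dt M (\<lambda>j k. T i (P j) (Q k))"

lemma sum_PiE_insert:
  assumes "finite A" "finite B" "x \<notin> A"
  shows "(\<Sum>c\<in>insert x A \<rightarrow>\<^sub>E B. F c) = (\<Sum>y\<in>B. \<Sum>c\<in>A \<rightarrow>\<^sub>E B. F (c(x := y)))"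
proof -
  have "(\<Sum>c\<in>insert x A \<rightarrow>\<^sub>E B. F c) = (\<Sum>(y, c)\<in>B \<times> (A \<rightarrow>\<^sub>E B). F (c(x := y)))"
    unfolding PiE_insert_eq
    by (subst sum.reindex[OF inj_combinator[OF assms(3)]]) (simp add: case_prod_unfold o_def)
  then show ?thesis by (simp add: sum.cartesian_product)
qed

lemma dt_scale_rows: "dt n (\<lambda>i j. x i * f i j) = (\<Prod>i<n. x i) * dt n f"
  using dt_scale[of n x "\<lambda>_. 1" f] by simp

text \<open>The determinant of the transported unit vectors is the sum over all families of
  non-intersecting paths (Lindstroem--Gessel--Viennot), by iterating the Cauchy--Binet formula.\<close>

lemma dt_prop_fin_eq_sum_chains:
  assumes X: "finite X" and Q: "Q \<in> incr_tuples M X" and "P \<in> incr_tuples M X"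
  shows "dt M (\<lambda>j k. prop_fin T g X (unit_vec_at (Q k)) (Suc n) (P j))
       = (\<Sum>c\<in>{1..n} \<rightarrow>\<^sub>E incr_tuples M X. \<Prod>i<Suc n.
            step_weight M T g (Suc i) ((c(0 := Q, Suc n := P)) (Suc i)) ((c(0 := Q, Suc n := P)) i))"
  using assms(3)
proof (induction n arbitrary: P)
  case 0
  have "(\<Sum>p'\<in>X. T (Suc 0) p p' * unit_vec_at (Q k) p') = T (Suc 0) p (Q k)" if "k < M" for k p
  proof -
    have "Q k \<in> X" using Q that by (auto simp: incr_tuples_def)
    then show ?thesis using X by (simp add: unit_vec_at_def of_bool_def if_distrib cong: if_cong)
  qed
  then have "dt M (\<lambda>j k. prop_fin T g X (unit_vec_at (Q k)) (Suc 0) (P j))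
      = dt M (\<lambda>j k. g (Suc 0) (P j) * T (Suc 0) (P j) (Q k))"
    by (intro dt_cong) simp
  then show ?case by (simp add: step_weight_def dt_scale_rows)
next
  case (Suc n)
  note prop_fin.simps(2)[simp del]
  let ?SI = "incr_tuples M X"
  let ?ch = "\<lambda>c n P. c(0 := Q, n := P)"
  let ?w = "\<lambda>c i. step_weight M T g (Suc i) (c (Suc i)) (c i)"
  have "dt M (\<lambda>j k. prop_fin T g X (unit_vec_at (Q k)) (Suc (Suc n)) (P j))
      = (\<Prod>j<M. g (Suc (Suc n)) (P j)) *
        dt M (\<lambda>j k. \<Sum>p\<in>X. T (Suc (Suc n)) (P j) p * prop_fin T g X (unit_vec_at (Q k)) (Suc n) p)"
    by (simp add: prop_fin.simps(2)[of _ _ _ _ "Suc n"] dt_scale_rows)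
  also have "\<dots> = (\<Sum>R\<in>?SI. step_weight M T g (Suc (Suc n)) P R *
        dt M (\<lambda>j k. prop_fin T g X (unit_vec_at (Q k)) (Suc n) (R j)))"
    by (subst cauchy_binet[OF X]) (simp add: step_weight_def sum_distrib_left mult_ac)
  also have "\<dots> = (\<Sum>R\<in>?SI. \<Sum>c\<in>{1..n} \<rightarrow>\<^sub>E ?SI.
        step_weight M T g (Suc (Suc n)) P R * (\<Prod>i<Suc n. ?w (?ch c (Suc n) R) i))"
    by (intro sum.cong refl) (simp only: Suc.IH sum_distrib_left)
  also have "\<dots> = (\<Sum>R\<in>?SI. \<Sum>c\<in>{1..n} \<rightarrow>\<^sub>E ?SI.
        (\<Prod>i<Suc (Suc n). ?w (?ch (c(Suc n := R)) (Suc (Suc n)) P) i))"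
  proof (intro sum.cong refl)
    fix R c
    have "(\<Prod>i<Suc n. ?w (?ch c (Suc n) R) i) = (\<Prod>i<Suc n. ?w (?ch (c(Suc n := R)) (Suc (Suc n)) P) i)"
      by (rule prod.cong) auto
    then show "step_weight M T g (Suc (Suc n)) P R * (\<Prod>i<Suc n. ?w (?ch c (Suc n) R) i)
        = (\<Prod>i<Suc (Suc n). ?w (?ch (c(Suc n := R)) (Suc (Suc n)) P) i)"
      by (subst prod.lessThan_Suc[of _ "Suc n"]) (simp add: mult_ac del: prod.lessThan_Suc)
  qed
  also have "\<dots> = (\<Sum>c\<in>{1..Suc n} \<rightarrow>\<^sub>E ?SI. (\<Prod>i<Suc (Suc n). ?w (?ch c (Suc (Suc n)) P) i))"
  proof -
    have "{1..Suc n} = insert (Suc n) {1..n}" by auto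
    then show ?thesis by (simp only:) (subst sum_PiE_insert, auto simp: finite_incr_tuples X)
  qed
  finally show ?case .
qed

section \<open>Sequences of geometric growth below a given rate\<close>

definition fast :: "real \<Rightarrow> (nat \<Rightarrow> complex) \<Rightarrow> bool" where
  "fast \<rho> v \<longleftrightarrow> (\<exists>C x. 0 < x \<and> x < \<rho> \<and> (\<forall>p. norm (v p) \<le> C * x ^ p))"

lemma fastI: "0 < x \<Longrightarrow> x < \<rho> \<Longrightarrow> (\<And>p. norm (v p) \<le> C * x ^ p) \<Longrightarrow> fast \<rho> v"
  unfolding fast_def by blast

lemma fast_bound_nonneg: "(\<And>p. norm (v p) \<le> C * (x::real) ^ p) \<Longrightarrow> C \<ge> 0"
  by (metis mult.right_neutral norm_ge_zero order_trans power_0)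

lemma fast_add:
  assumes "fast \<rho> u" "fast \<rho> v"
  shows "fast \<rho> (\<lambda>p. u p + v p)"
proof -
  obtain C x where u: "0 < x" "x < \<rho>" "\<And>p. norm (u p) \<le> C * x ^ p" using assms(1) by (auto simp: fast_def)
  obtain D y where v: "0 < y" "y < \<rho>" "\<And>p. norm (v p) \<le> D * y ^ p" using assms(2) by (auto simp: fast_def)
  have "C \<ge> 0" "D \<ge> 0" using fast_bound_nonneg u(3) v(3) by blast+
  show ?thesis
  proof (rule fastI)
    show "0 < max x y" "max x y < \<rho>" using u v by auto
    fix p
    have "norm (u p + v p) \<le> C * x ^ p + D * y ^ p"
      using norm_triangle_ineq[of "u p" "v p"] u(3)[of p] v(3)[of p] by linarith
    also have "\<dots> \<le> C * max x y ^ p + D * max x y ^ p"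
      using \<open>C \<ge> 0\<close> \<open>D \<ge> 0\<close> u v by (intro add_mono mult_left_mono power_mono) auto
    finally show "norm (u p + v p) \<le> (C + D) * max x y ^ p" by (simp add: algebra_simps)
  qed
qed

lemma fast_mult_bounded:
  assumes "fast \<rho> v" "\<And>p. norm (c p) \<le> K"
  shows "fast \<rho> (\<lambda>p. c p * v p)"
proof -
  obtain C x where v: "0 < x" "x < \<rho>" "\<And>p. norm (v p) \<le> C * x ^ p" using assms(1) by (auto simp: fast_def)
  have "K \<ge> 0" using assms(2) norm_ge_zero order_trans by blast
  have "norm (c p * v p) \<le> (K * C) * x ^ p" for p
    using mult_mono[OF assms(2) v(3) \<open>K \<ge> 0\<close> norm_ge_zero, of p] by (simp add: norm_mult mult_ac)
  then show ?thesis using v by (intro fastI)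
qed

lemma fast_scale: "fast \<rho> v \<Longrightarrow> fast \<rho> (\<lambda>p. c * v p)"
  by (rule fast_mult_bounded[where c = "\<lambda>_. c"]) auto

lemma fast_finite_support:
  assumes "0 < \<rho>" "\<And>p. p \<ge> K \<Longrightarrow> v p = 0"
  shows "fast \<rho> v"
proof (rule fastI)
  show "0 < \<rho> / 2" "\<rho> / 2 < \<rho>" using assms by auto
  define y where "y = \<rho> / 2"
  fix p
  have y: "y > 0" using assms by (simp add: y_def)
  have nn: "norm (v i) / y ^ i \<ge> 0" for i using y by simp
  have "norm (v p) / y ^ p \<le> (\<Sum>i<K. norm (v i) / y ^ i)"
  proof (cases "p < K")
    case True
    then show ?thesis using nn by (intro member_le_sum) auto
  next
    case False
    then show ?thesis using assms(2)[of p] nn by (simp add: sum_nonneg)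
  qed
  then show "norm (v p) \<le> (\<Sum>i<K. norm (v i) / y ^ i) * (\<rho> / 2) ^ p"
    using y unfolding y_def[symmetric] by (simp add: pos_divide_le_eq)
qed

lemma fast_zero: "0 < \<rho> \<Longrightarrow> fast \<rho> (\<lambda>p. 0)"
  by (rule fast_finite_support[of _ 0]) auto

lemma fast_sum: "0 < \<rho> \<Longrightarrow> (\<And>i. i \<in> A \<Longrightarrow> fast \<rho> (v i)) \<Longrightarrow> fast \<rho> (\<lambda>p. \<Sum>i\<in>A. v i p)"
  by (induction A rule: infinite_finite_induct) (auto intro: fast_zero fast_add)

text \<open>Time runs backwards: step \<open>n\<close> leads from time \<open>u\<^sub>N - n + 1\<close> to time \<open>u\<^sub>N - n\<close> across a half-integer \<open>m\<close>,
  with \<open>r n = x\<^sub>m\<^sup>+\<close> and \<open>up n\<close> iff \<open>m \<in> D\<^sup>-\<close>. A natural number \<open>p\<close> stands for the position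
  \<open>p - M + 1/2\<close>. Conjugating by the powers of \<open>x\<^sub>m\<^sup>+\<close> turns the weights \<open>q\<^sub>t\<close> into weights of steps.\<close>

locale transfer =
  fixes r :: "nat \<Rightarrow> real" and up :: "nat \<Rightarrow> bool"
  assumes r_pos: "r n > 0" and r_less: "r n < r (Suc n)"
begin

text \<open>For \<open>up n\<close> a row has infinitely many entries, of size
  \<open>r n ^ p / r n ^ p'\<close>; a step is therefore applied to sequences whose growth rate is
  strictly below \<open>r n\<close>.\<close>

definition T :: "nat \<Rightarrow> nat \<Rightarrow> nat \<Rightarrow> complex" where
  "T n p p' = (if (if up n then p \<le> p' else p' \<le> p) then of_real (r n ^ p / r n ^ p') else 0)"

definition step :: "nat \<Rightarrow> (nat \<Rightarrow> complex) \<Rightarrow> nat \<Rightarrow> complex" where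
  "step n v p = (\<Sum>p'. T n p p' * v p')"

fun evolve :: "nat \<Rightarrow> nat \<Rightarrow> (nat \<Rightarrow> complex) \<Rightarrow> nat \<Rightarrow> complex" where
  "evolve n 0 v = v"
| "evolve n (Suc k) v = step (n + Suc k) (evolve n k v)"

fun prop_inf :: "(nat \<Rightarrow> nat \<Rightarrow> complex) \<Rightarrow> (nat \<Rightarrow> complex) \<Rightarrow> nat \<Rightarrow> nat \<Rightarrow> complex" where
  "prop_inf g v 0 = v"
| "prop_inf g v (Suc n) = (\<lambda>p. g (Suc n) p * step (Suc n) (prop_inf g v n) p)"

lemma norm_T_le: "norm (T n p p') \<le> r n ^ p / r n ^ p'"
  using r_pos[of n] by (simp add: T_def norm_divide norm_power)

lemma norm_T_mult_le:
  assumes "norm (v p') \<le> C * x ^ p'"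
  shows "norm (T n p p' * v p') \<le> (r n ^ p * C) * (x / r n) ^ p'"
proof -
  have "norm (T n p p' * v p') \<le> (r n ^ p / r n ^ p') * (C * x ^ p')"
    unfolding norm_mult using r_pos[of n] by (intro mult_mono norm_T_le assms) auto
  then show ?thesis by (simp add: power_divide mult_ac)
qed

lemma summable_geometric_ratio: "0 < x \<Longrightarrow> x < r n \<Longrightarrow> summable (\<lambda>p'. K * (x / r n) ^ p')"
  using r_pos[of n] by (intro summable_mult summable_geometric) simp

lemma summable_step:
  assumes "fast (r n) v"
  shows "summable (\<lambda>p'. norm (T n p p' * v p'))"
proof -
  obtain C x where v: "0 < x" "x < r n" "\<And>p. norm (v p) \<le> C * x ^ p" using assms by (auto simp: fast_def)
  have "norm (norm (T n p p' * v p')) \<le> (r n ^ p * C) * (x / r n) ^ p'" for p'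
    using norm_T_mult_le[of v p' C x n p] v(3) by simp
  then show ?thesis
    by (rule summable_comparison_test'[OF summable_geometric_ratio[OF v(1,2)]])
qed

lemma step_add:
  assumes "fast (r n) u" "fast (r n) v"
  shows "step n (\<lambda>p. u p + v p) = (\<lambda>p. step n u p + step n v p)"
  using assms unfolding step_def
  by (intro ext) (simp only: distrib_left suminf_add summable_norm_cancel[OF summable_step])

lemma step_scale:
  assumes "fast (r n) v"
  shows "step n (\<lambda>p. c * v p) = (\<lambda>p. c * step n v p)"
proof
  fix p
  have "(\<Sum>p'. c * (T n p p' * v p')) = c * (\<Sum>p'. T n p p' * v p')"
    by (rule suminf_mult) (rule summable_norm_cancel[OF summable_step[OF assms]])
  then show "step n (\<lambda>p. c * v p) p = c * step n v p" by (simp add: step_def mult_ac)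
qed

lemma step_zero: "step n (\<lambda>p. 0) = (\<lambda>p. 0)"
  by (intro ext) (simp add: step_def)

lemma step_sum:
  assumes "\<And>i. i \<in> A \<Longrightarrow> fast (r n) (v i)"
  shows "step n (\<lambda>p. \<Sum>i\<in>A. c i * v i p) = (\<lambda>p. \<Sum>i\<in>A. c i * step n (v i) p)"
  using assms
proof (induction A rule: infinite_finite_induct)
  case (insert i A)
  then show ?case
    by (simp add: step_add step_scale fast_scale fast_sum r_pos)
qed (auto simp: step_zero)

lemma step_bound:
  assumes "0 < x" "x < r n" "\<And>p. norm (v p) \<le> C * x ^ p"
  shows "norm (step n v p) \<le> (C / (1 - x / r n)) * r n ^ p"
proof -
  have "norm (step n v p) \<le> (\<Sum>p'. (r n ^ p * C) * (x / r n) ^ p')"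
    unfolding step_def
    by (rule norm_suminf_le) (use assms in \<open>auto intro: summable_geometric_ratio norm_T_mult_le\<close>)
  also have "\<dots> = (C / (1 - x / r n)) * r n ^ p"
    using assms r_pos[of n] by (subst suminf_mult) (auto intro!: summable_geometric simp: suminf_geometric)
  finally show ?thesis .
qed

text \<open>The output of step \<open>n\<close> grows at most at the rate \<open>r n\<close>, which
  lies strictly below \<open>r (Suc n)\<close>. The strict growth of \<open>r\<close> is what allows
  steps to be iterated.\<close>

lemma fast_step: "fast (r n) v \<Longrightarrow> fast (r (Suc n)) (step n v)"
  unfolding fast_def[of "r n"] using step_bound r_pos r_less by (meson fastI)

lemma fast_evolve: "fast (r (Suc n)) v \<Longrightarrow> fast (r (Suc (n + k))) (evolve n k v)"
  by (induction k) (auto intro: fast_step)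

lemma evolve_add:
  "fast (r (Suc n)) u \<Longrightarrow> fast (r (Suc n)) v \<Longrightarrow>
     evolve n k (\<lambda>p. u p + v p) = (\<lambda>p. evolve n k u p + evolve n k v p)"
proof (induction k)
  case (Suc k)
  then show ?case
    using step_add[of "n + Suc k" "evolve n k u" "evolve n k v"] fast_evolve[of n u k] fast_evolve[of n v k]
    by simp
qed simp

lemma evolve_sum:
  assumes "\<And>i. i \<in> A \<Longrightarrow> fast (r (Suc n)) (v i)"
  shows "evolve n k (\<lambda>p. \<Sum>i\<in>A. c i * v i p) = (\<lambda>p. \<Sum>i\<in>A. c i * evolve n k (v i) p)"
proof (induction k)
  case (Suc k)
  have "fast (r (n + Suc k)) (evolve n k (v i))" if "i \<in> A" for i
    using fast_evolve[OF assms[OF that], of k] by simp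
  then show ?case using Suc by (simp add: step_sum)
qed simp

lemma evolve_evolve: "evolve (n + j) k (evolve n j v) = evolve n (j + k) v"
  by (induction k) (auto simp: add.assoc)

lemma fast_unit: "fast (r n) (unit_vec_at k)"
  by (rule fast_finite_support[of _ "Suc k"]) (auto simp: r_pos unit_vec_at_def)

text \<open>A bound uniform in the cutoff \<open>L\<close> is carried along with the limit, because
  it is the dominating sequence for Tannery's theorem at the next step.\<close>

lemma prop_fin_tendsto:
  assumes v: "fast (r 1) v" and g: "\<And>n p. norm (g n p) \<le> K"
  shows "\<exists>C x. 0 < x \<and> x < r (Suc n) \<and> (\<forall>L p. norm (prop_fin T g {..<L} v n p) \<le> C * x ^ p) \<and>
           (\<forall>p. (\<lambda>L. prop_fin T g {..<L} v n p) \<longlonglongrightarrow> prop_inf g v n p)"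
proof (induction n)
  case 0
  then show ?case using v by (auto simp: fast_def)
next
  case (Suc n)
  then obtain C x where x: "0 < x" "x < r (Suc n)"
    and bd: "\<And>L p. norm (prop_fin T g {..<L} v n p) \<le> C * x ^ p"
    and lim: "\<And>p. (\<lambda>L. prop_fin T g {..<L} v n p) \<longlonglongrightarrow> prop_inf g v n p" by blast
  let ?m = "Suc n"
  let ?F = "\<lambda>p p' L. if p' < L then T ?m p p' * prop_fin T g {..<L} v n p' else 0"
  have K: "K \<ge> 0" using g norm_ge_zero order_trans by blast
  have C: "C \<ge> 0" by (rule fast_bound_nonneg[OF bd])
  have eq: "(\<Sum>p'<L. T ?m p p' * prop_fin T g {..<L} v n p') = (\<Sum>p'. ?F p p' L)" for p L
    by (subst suminf_finite[of "{..<L}"]) auto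
  have Fb: "norm (?F p p' L) \<le> (r ?m ^ p * C) * (x / r ?m) ^ p'" for p p' L
    using norm_T_mult_le[of "prop_fin T g {..<L} v n" p' C x ?m p, OF bd] x C r_pos[of ?m]
    by (auto intro: less_imp_le)
  have "norm (prop_fin T g {..<L} v ?m p) \<le> (K * (C / (1 - x / r ?m))) * r ?m ^ p" for L p
  proof -
    have "norm (\<Sum>p'. ?F p p' L) \<le> (\<Sum>p'. (r ?m ^ p * C) * (x / r ?m) ^ p')"
      by (rule norm_suminf_le) (use x Fb in \<open>auto intro: summable_geometric_ratio\<close>)
    also have "\<dots> = (C / (1 - x / r ?m)) * r ?m ^ p"
      using x r_pos[of ?m] by (subst suminf_mult) (auto intro!: summable_geometric simp: suminf_geometric)
    finally have "norm (g ?m p) * norm (\<Sum>p'. ?F p p' L) \<le> K * ((C / (1 - x / r ?m)) * r ?m ^ p)"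
      by (rule mult_mono[OF g _ K norm_ge_zero])
    then show ?thesis by (simp only: prop_fin.simps norm_mult eq mult.assoc)
  qed
  moreover have "(\<lambda>L. prop_fin T g {..<L} v ?m p) \<longlonglongrightarrow> prop_inf g v ?m p" for p
  proof -
    have "(\<lambda>L. \<Sum>p'. ?F p p' L) \<longlonglongrightarrow> (\<Sum>p'. T ?m p p' * prop_inf g v n p')"
    proof (rule conjunct2[OF conjunct2[OF tannerys_theorem]])
      fix p'
      have "(\<lambda>L. T ?m p p' * prop_fin T g {..<L} v n p') \<longlonglongrightarrow> T ?m p p' * prop_inf g v n p'"
        by (intro tendsto_intros lim)
      moreover have "\<forall>\<^sub>F L in sequentially. T ?m p p' * prop_fin T g {..<L} v n p' = ?F p p' L"
        using eventually_gt_at_top[of p'] by eventually_elim simp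
      ultimately show "(\<lambda>L. ?F p p' L) \<longlonglongrightarrow> T ?m p p' * prop_inf g v n p'"
        by (rule Lim_transform_eventually)
      show "\<forall>\<^sub>F (k, L) in sequentially \<times>\<^sub>F sequentially. norm (?F p k L) \<le> (r ?m ^ p * C) * (x / r ?m) ^ k"
        by (intro always_eventually allI) (simp only: case_prod_beta Fb)
    qed (use x summable_geometric_ratio in auto)
    then show ?thesis by (simp add: step_def eq tendsto_mult_left)
  qed
  ultimately show ?case using r_pos r_less by blast
qed

text \<open>A step inverts the multiplication of Laurent series by \<open>1 - 1/(r z)\<close> or \<open>1 - r z\<close>. The truncation to
  natural positions does no harm because \<open>A\<close> vanishes just below the shifted origin.\<close>

lemma step_shifted:
  fixes A A' :: "int \<Rightarrow> complex"
  assumes rec: "\<And>l. A' l = (if up n then A l - A (l + 1) / of_real (r n) else A l - of_real (r n) * A (l - 1))"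
    and low: "\<not> up n \<Longrightarrow> A (- 1 - c) = 0"
    and fast: "up n \<Longrightarrow> fast (r n) (\<lambda>p. A (int p - c))"
  shows "step n (\<lambda>p. A' (int p - c)) = (\<lambda>p. A (int p - c))"
proof
  fix p
  have r: "of_real (r n) \<noteq> (0::complex)" using r_pos[of n] by simp
  let ?r = "of_real (r n) :: complex"
  show "step n (\<lambda>p. A' (int p - c)) p = A (int p - c)"
  proof (cases "up n")
    case True
    \<comment> \<open>Dividing by powers of \<open>r n\<close> makes the series telescope, and
      \<open>fast\<close> says precisely that the end term \<open>f\<close> tends to 0.\<close>
    define f where "f k = A (int (k + p) - c) / ?r ^ k" for k
    obtain C x where x: "0 < x" "x < r n" "\<And>p. norm (A (int p - c)) \<le> C * x ^ p"
      using fast[OF True] by (auto simp: fast_def)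
    have "norm (f k) \<le> (C * x ^ p) * (x / r n) ^ k" for k
      using x(3)[of "k + p"] r_pos[of n]
      by (simp add: f_def norm_divide norm_power power_add power_divide divide_right_mono mult_ac)
    moreover have "(\<lambda>k. (C * x ^ p) * (x / r n) ^ k) \<longlonglongrightarrow> (C * x ^ p) * 0"
      using x by (intro tendsto_intros LIMSEQ_power_zero) auto
    ultimately have "f \<longlonglongrightarrow> 0"
      by (auto intro: Lim_null_comparison[where g = "\<lambda>k. (C * x ^ p) * (x / r n) ^ k"])
    then have "(\<lambda>k. f k - f (Suc k)) sums (f 0 - 0)"
      by (rule telescope_sums')
    moreover have "T n p (k + p) * A' (int (k + p) - c) = f k - f (Suc k)" for k
      using r True by (simp add: T_def f_def rec power_add field_simps)
    ultimately have "(\<lambda>k. T n p (k + p) * A' (int (k + p) - c)) sums A (int p - c)"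
      by (simp add: f_def)
    then have "(\<lambda>k. T n p k * A' (int k - c)) sums A (int p - c)"
      by (subst (asm) sums_zero_iff_shift) (use True in \<open>auto simp: T_def\<close>)
    then show ?thesis by (simp add: step_def sums_iff)
  next
    case False
    have "step n (\<lambda>p. A' (int p - c)) p = (\<Sum>p'\<le>p. ?r ^ p / ?r ^ p' * A' (int p' - c))"
      unfolding step_def by (subst suminf_finite[of "{..p}"]) (auto simp: T_def False)
    also have "\<dots> = A (int p - c)"
    proof (induction p)
      case 0
      have "- 1 - c = - c - 1" by simp
      then have "A (- c - 1) = 0" using low[OF False] by metis
      then show ?case using False by (simp add: rec)
    next
      case (Suc p)
      have "(\<Sum>p'\<le>p. ?r ^ Suc p / ?r ^ p' * A' (int p' - c))
          = ?r * (\<Sum>p'\<le>p. ?r ^ p / ?r ^ p' * A' (int p' - c))"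
        unfolding sum_distrib_left by (intro sum.cong refl) simp
      then have "(\<Sum>p'\<le>p. ?r ^ Suc p / ?r ^ p' * A' (int p' - c)) = ?r * A (int p - c)"
        by (simp only: Suc)
      moreover have "A' (int (Suc p) - c) = A (int (Suc p) - c) - ?r * A (int p - c)"
        using False by (simp add: rec algebra_simps)
      ultimately show ?case using r by (simp del: of_nat_Suc)
    qed
    finally show ?thesis .
  qed
qed

text \<open>The Eynard--Mehta argument: inserting the factors \<open>1 + s\<close> at the points \<open>(\<tau> a, p a)\<close> is a
  perturbation of finite rank of the Gram matrix, and \<open>\<psi> b 0\<close> solves the linear system that inverts
  the Gram matrix on the column of the point \<open>b\<close>.\<close>

lemma eynard_mehta:
  fixes S M N :: nat and \<tau> p :: "nat \<Rightarrow> nat" and s :: complex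
    and \<psi> \<phi> :: "nat \<Rightarrow> nat \<Rightarrow> nat \<Rightarrow> complex"
  assumes \<tau>: "\<And>a. a < N \<Longrightarrow> 0 < \<tau> a \<and> \<tau> a \<le> S"
    and \<psi>0: "\<And>b x. b < N \<Longrightarrow> x \<ge> M \<Longrightarrow> \<psi> b 0 x = 0"
    and \<psi>: "\<And>b m. b < N \<Longrightarrow> m \<le> \<tau> b \<Longrightarrow> evolve 0 m (\<psi> b 0) = \<psi> b m"
    and \<psi>\<phi>: "\<And>b x. b < N \<Longrightarrow> \<psi> b (\<tau> b) x = unit_vec_at (p b) x - \<phi> b (\<tau> b) x"
    and \<phi>_fast: "\<And>b. b < N \<Longrightarrow> fast (r (Suc (\<tau> b))) (\<phi> b (\<tau> b))"
    and \<phi>: "\<And>b k. b < N \<Longrightarrow> \<tau> b + k \<le> S \<Longrightarrow> evolve (\<tau> b) k (\<phi> b (\<tau> b)) = \<phi> b (\<tau> b + k)"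
    and \<phi>S: "\<And>b x. b < N \<Longrightarrow> x < M \<Longrightarrow> \<phi> b S x = 0"
  defines "g \<equiv> \<lambda>m x. 1 + s * (\<Sum>a<N. of_bool (\<tau> a = m \<and> p a = x))"
  shows "dt M (\<lambda>i k. prop_inf g (unit_vec_at k) S i)
       = dt M (\<lambda>i k. evolve 0 S (unit_vec_at k) i) *
         dt N (\<lambda>a b. (if a = b then 1 else 0) + s *
           (if \<tau> a \<le> \<tau> b then \<psi> b (\<tau> a) (p a) else - \<phi> b (\<tau> a) (p a)))"
proof -
  \<comment> \<open>\<open>\<beta> a k\<close> is the amplitude that reaches the point
    \<open>a\<close> from the start \<open>k\<close> before the factor of that point acts;
    \<open>B\<close> is the same without marks. \<open>A\<close> and \<open>H\<close> carry a unit
    source from a point to the end and to a later point.\<close>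
  define \<beta> where "\<beta> a k = step (\<tau> a) (prop_inf g (unit_vec_at k) (\<tau> a - 1)) (p a)" for a k
  define G where "G i k = evolve 0 S (unit_vec_at k) i" for i k
  define A where "A i b = evolve (\<tau> b) (S - \<tau> b) (unit_vec_at (p b)) i" for i b
  define H where "H a b = (if \<tau> b < \<tau> a then evolve (\<tau> b) (\<tau> a - \<tau> b) (unit_vec_at (p b)) (p a) else 0)" for a b
  define B where "B a k = evolve 0 (\<tau> a) (unit_vec_at k) (p a)" for a k
  have fastE: "fast (r (Suc (n + k))) (evolve n k (unit_vec_at j))" for n k j
    by (intro fast_evolve fast_unit)
  let ?C = "\<lambda>m. {b. b < N \<and> \<tau> b \<le> m}"
  \<comment> \<open>Superposition: each marked point passed so far emits a unit vector of strength
    \<open>s * \<beta> b k\<close>, which then evolves freely.\<close>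
  have expand0: "prop_inf g (unit_vec_at k) m = (\<lambda>x. evolve 0 m (unit_vec_at k) x +
      (\<Sum>b\<in>?C m. (s * \<beta> b k) * evolve (\<tau> b) (m - \<tau> b) (unit_vec_at (p b)) x))" for k m
  proof (induction m)
    case 0
    have C0: "?C 0 = {}" using \<tau> by fastforce
    show ?case unfolding C0 by simp
  next
    case (Suc m)
    let ?w = "\<lambda>b. evolve (\<tau> b) (m - \<tau> b) (unit_vec_at (p b))"
    have w: "fast (r (Suc m)) (?w b)" if "b \<in> ?C m" for b
      using fastE[of "\<tau> b" "m - \<tau> b"] that by simp
    have w': "step (Suc m) (?w b) = evolve (\<tau> b) (Suc m - \<tau> b) (unit_vec_at (p b))" if "b \<in> ?C m" for b
      using that by (simp add: Suc_diff_le)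
    have st: "step (Suc m) (prop_inf g (unit_vec_at k) m) = (\<lambda>x. evolve 0 (Suc m) (unit_vec_at k) x +
        (\<Sum>b\<in>?C m. (s * \<beta> b k) * evolve (\<tau> b) (Suc m - \<tau> b) (unit_vec_at (p b)) x))" (is "?st = ?rhs")
    proof -
      have "?st = (\<lambda>x. step (Suc m) (evolve 0 m (unit_vec_at k)) x
              + step (Suc m) (\<lambda>x. \<Sum>b\<in>?C m. (s * \<beta> b k) * ?w b x) x)"
        unfolding Suc.IH
        by (rule step_add) (use fastE[of 0 m] w in \<open>auto intro!: fast_sum fast_scale r_pos\<close>)
      also have "step (Suc m) (\<lambda>x. \<Sum>b\<in>?C m. (s * \<beta> b k) * ?w b x)
          = (\<lambda>x. \<Sum>b\<in>?C m. (s * \<beta> b k) * step (Suc m) (?w b) x)"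
        by (rule step_sum[OF w])
      finally show ?thesis by (simp add: w')
    qed
    show ?case
    proof
      fix x
      have C': "?C (Suc m) = ?C m \<union> {b. b < N \<and> \<tau> b = Suc m}" by auto
      have "prop_inf g (unit_vec_at k) (Suc m) x = ?st x +
          s * (\<Sum>b<N. of_bool (\<tau> b = Suc m \<and> p b = x) * ?st x)"
        by (simp add: g_def algebra_simps sum_distrib_left sum_distrib_right)
      also have "(\<Sum>b<N. of_bool (\<tau> b = Suc m \<and> p b = x) * ?st x)
          = (\<Sum>b\<in>{b. b < N \<and> \<tau> b = Suc m}. of_bool (x = p b) * \<beta> b k)"
        by (rule sum.mono_neutral_cong_right) (auto simp: \<beta>_def)
      also have "s * \<dots> = (\<Sum>b\<in>{b. b < N \<and> \<tau> b = Suc m}.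
          (s * \<beta> b k) * evolve (\<tau> b) (Suc m - \<tau> b) (unit_vec_at (p b)) x)"
        unfolding sum_distrib_left by (rule sum.cong) (auto simp: unit_vec_at_def)
      finally show "prop_inf g (unit_vec_at k) (Suc m) x = evolve 0 (Suc m) (unit_vec_at k) x +
          (\<Sum>b\<in>?C (Suc m). (s * \<beta> b k) * evolve (\<tau> b) (Suc m - \<tau> b) (unit_vec_at (p b)) x)"
        unfolding C' st by (subst sum.union_disjoint) auto
    qed
  qed
  have expG: "prop_inf g (unit_vec_at k) S i = G i k + (\<Sum>b<N. s * A i b * \<beta> b k)" for i k
  proof -
    have "?C S = {..<N}" using \<tau> by auto
    then show ?thesis unfolding expand0 G_def A_def by (simp add: mult_ac)
  qed
  \<comment> \<open>Self-consistency of the amplitudes: only sources at strictly earlier steps reach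
    the point \<open>a\<close>.\<close>
  have exp\<beta>: "\<beta> a k = B a k + s * (\<Sum>b<N. H a b * \<beta> b k)" if "a < N" for a k
  proof -
    define m where "m = \<tau> a - 1"
    have m: "\<tau> a = Suc m" using \<tau>[OF that] by (simp add: m_def)
    let ?w = "\<lambda>b. evolve (\<tau> b) (m - \<tau> b) (unit_vec_at (p b))"
    have w: "fast (r (Suc m)) (?w b)" if "b \<in> ?C m" for b
      using fastE[of "\<tau> b" "m - \<tau> b"] that by simp
    have "step (Suc m) (prop_inf g (unit_vec_at k) m) = (\<lambda>x. step (Suc m) (evolve 0 m (unit_vec_at k)) x
              + step (Suc m) (\<lambda>x. \<Sum>b\<in>?C m. (s * \<beta> b k) * ?w b x) x)"
      unfolding expand0
      by (rule step_add) (use fastE[of 0 m] w in \<open>auto intro!: fast_sum fast_scale r_pos\<close>)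
    also have "step (Suc m) (\<lambda>x. \<Sum>b\<in>?C m. (s * \<beta> b k) * ?w b x)
          = (\<lambda>x. \<Sum>b\<in>?C m. (s * \<beta> b k) * step (Suc m) (?w b) x)"
      by (rule step_sum[OF w])
    finally have "\<beta> a k = B a k + (\<Sum>b\<in>?C m. (s * \<beta> b k) * step (Suc m) (?w b) (p a))"
      by (simp add: \<beta>_def B_def m)
    also have "(\<Sum>b\<in>?C m. (s * \<beta> b k) * step (Suc m) (?w b) (p a)) = (\<Sum>b<N. s * (H a b * \<beta> b k))"
      by (rule sum.mono_neutral_cong_left) (auto simp: H_def m Suc_diff_le less_Suc_eq_le)
    finally show ?thesis by (simp add: sum_distrib_left)
  qed
  \<comment> \<open>Since \<open>\<psi> b 0\<close> vanishes from \<open>M\<close> on, its evolution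
    is a combination of the first \<open>M\<close> starts, the only ones that the Gram matrix
    sees.\<close>
  have decomp: "evolve 0 m (\<psi> b 0) x = (\<Sum>j<M. \<psi> b 0 j * evolve 0 m (unit_vec_at j) x)" if "b < N" for b m x
  proof -
    have "\<psi> b 0 = (\<lambda>x. \<Sum>j<M. \<psi> b 0 j * unit_vec_at j x)"
    proof
      fix x
      show "\<psi> b 0 x = (\<Sum>j<M. \<psi> b 0 j * unit_vec_at j x)"
        using \<psi>0[OF that, of x] by (simp add: unit_vec_at_def of_bool_def if_distrib cong: if_cong)
    qed
    then have "evolve 0 m (\<psi> b 0) = evolve 0 m (\<lambda>x. \<Sum>j<M. \<psi> b 0 j * unit_vec_at j x)" by simp
    also have "\<dots> = (\<lambda>x. \<Sum>j<M. \<psi> b 0 j * evolve 0 m (unit_vec_at j) x)"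
      by (rule evolve_sum) (rule fast_unit)
    finally show ?thesis by simp
  qed
  \<comment> \<open>At its own time \<open>\<psi>\<close> is the unit vector minus
    \<open>\<phi>\<close>; from there on both parts evolve separately by linearity.\<close>
  have split: "evolve (\<tau> b) k (\<psi> b (\<tau> b)) x = evolve (\<tau> b) k (unit_vec_at (p b)) x - \<phi> b (\<tau> b + k) x"
    if b: "b < N" "\<tau> b + k \<le> S" for b k x
  proof -
    have "fast (r (Suc (\<tau> b))) (\<psi> b (\<tau> b))"
      using fast_add[OF fast_unit fast_scale[OF \<phi>_fast[OF b(1)], of "- 1"], of "p b"]
      by (simp add: \<psi>\<phi>[OF b(1), abs_def])
    then have "evolve (\<tau> b) k (\<lambda>x. \<psi> b (\<tau> b) x + \<phi> b (\<tau> b) x)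
        = (\<lambda>x. evolve (\<tau> b) k (\<psi> b (\<tau> b)) x + evolve (\<tau> b) k (\<phi> b (\<tau> b)) x)"
      by (rule evolve_add[OF _ \<phi>_fast[OF b(1)]])
    moreover have "(\<lambda>x. \<psi> b (\<tau> b) x + \<phi> b (\<tau> b) x) = unit_vec_at (p b)"
      by (simp add: \<psi>\<phi>[OF b(1)])
    ultimately have "evolve (\<tau> b) k (unit_vec_at (p b)) x
        = evolve (\<tau> b) k (\<psi> b (\<tau> b)) x + evolve (\<tau> b) k (\<phi> b (\<tau> b)) x"
      by simp
    then show ?thesis using \<phi>[OF b] by simp
  qed
  \<comment> \<open>At the end \<open>\<phi>\<close> is gone below \<open>M\<close>, so
    \<open>\<psi> b 0\<close> solves the Gram system whose right-hand side is the column of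
    \<open>A\<close> for the point \<open>b\<close>.\<close>
  have GX: "A i b = (\<Sum>j<M. G i j * \<psi> b 0 j)" if "b < N" "i < M" for i b
  proof -
    have "(\<Sum>j<M. G i j * \<psi> b 0 j) = evolve 0 S (\<psi> b 0) i"
      by (simp add: decomp[OF that(1)] G_def mult_ac)
    also have "\<dots> = evolve (\<tau> b) (S - \<tau> b) (evolve 0 (\<tau> b) (\<psi> b 0)) i"
      using evolve_evolve[of 0 "\<tau> b" "S - \<tau> b"] \<tau>[OF that(1)] by simp
    also have "\<dots> = A i b"
      using \<psi>[OF that(1), of "\<tau> b"] split[OF that(1), of "S - \<tau> b"] \<tau>[OF that(1)] \<phi>S[OF that]
      by (simp add: A_def)
    finally show ?thesis by simp
  qed
  let ?K = "\<lambda>a b. if \<tau> a \<le> \<tau> b then \<psi> b (\<tau> a) (p a) else - \<phi> b (\<tau> a) (p a)"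
  have BX: "(\<Sum>k<M. B a k * \<psi> b 0 k) - H a b = ?K a b" if ab: "a < N" "b < N" for a b
  proof -
    have e: "(\<Sum>k<M. B a k * \<psi> b 0 k) = evolve 0 (\<tau> a) (\<psi> b 0) (p a)"
      by (simp add: decomp[OF ab(2)] B_def mult_ac)
    show ?thesis
    proof (cases "\<tau> a \<le> \<tau> b")
      case True
      then show ?thesis using \<psi>[OF ab(2) True] by (simp add: e H_def)
    next
      case False
      have "evolve 0 (\<tau> a) (\<psi> b 0) = evolve (\<tau> b) (\<tau> a - \<tau> b) (evolve 0 (\<tau> b) (\<psi> b 0))"
        using evolve_evolve[of 0 "\<tau> b" "\<tau> a - \<tau> b"] False by simp
      then show ?thesis
        using \<psi>[OF ab(2), of "\<tau> b"] split[OF ab(2), of "\<tau> a - \<tau> b"] \<tau>[OF ab(1)] False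
        by (simp add: e H_def)
    qed
  qed
  \<comment> \<open>By \<open>GX\<close> the perturbation of \<open>G\<close> is itself
    \<open>G\<close> times a matrix of rank at most \<open>N\<close>, so \<open>G\<close> splits off
    without being inverted.\<close>
  have "dt M (\<lambda>i k. prop_inf g (unit_vec_at k) S i)
      = dt M (\<lambda>i k. \<Sum>j<M. G i j * ((if j = k then 1 else 0) + (\<Sum>b<N. (s * \<psi> b 0 j) * \<beta> b k)))"
  proof (rule dt_cong)
    fix i k assume ik: "i < M" "k < M"
    have "(\<Sum>j<M. G i j * ((if j = k then 1 else 0) + (\<Sum>b<N. (s * \<psi> b 0 j) * \<beta> b k)))
        = G i k + (\<Sum>j<M. \<Sum>b<N. G i j * (s * \<psi> b 0 j * \<beta> b k))"
    proof -
      have "(\<Sum>j<M. G i j * ((if j = k then 1 else 0) + (\<Sum>b<N. (s * \<psi> b 0 j) * \<beta> b k)))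
          = (\<Sum>j<M. (if j = k then G i j else 0) + (\<Sum>b<N. G i j * (s * \<psi> b 0 j * \<beta> b k)))"
        by (rule sum.cong) (auto simp: distrib_left sum_distrib_left)
      then show ?thesis using ik by (simp add: sum.distrib)
    qed
    also have "(\<Sum>j<M. \<Sum>b<N. G i j * (s * \<psi> b 0 j * \<beta> b k)) = (\<Sum>b<N. s * A i b * \<beta> b k)"
      by (subst sum.swap) (simp add: GX ik sum_distrib_left sum_distrib_right mult_ac)
    finally show "prop_inf g (unit_vec_at k) S i
        = (\<Sum>j<M. G i j * ((if j = k then 1 else 0) + (\<Sum>b<N. (s * \<psi> b 0 j) * \<beta> b k)))"
      by (simp add: expG)
  qed
  also have "\<dots> = dt M G * dt N (\<lambda>a b. (if a = b then 1 else 0) + (\<Sum>k<M. \<beta> a k * (s * \<psi> b 0 k)))"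
    by (simp add: dt_mult[symmetric] dt_sylvester)
  \<comment> \<open>Multiplication by \<open>1 - s * H\<close> does not change the determinant, and
    by \<open>exp\<beta>\<close> it turns \<open>\<beta>\<close> into the unperturbed amplitudes
    \<open>B\<close>.\<close>
  also have "dt N (\<lambda>a b. (if a = b then 1 else 0) + (\<Sum>k<M. \<beta> a k * (s * \<psi> b 0 k)))
      = dt N (\<lambda>a b. (if a = b then 1 else 0) + (- s * H a b)) *
        dt N (\<lambda>a b. (if a = b then 1 else 0) + (\<Sum>k<M. \<beta> a k * (s * \<psi> b 0 k)))"
  proof -
    have "dt N (\<lambda>a b. (if a = b then 1 else 0) + (- s * H a b)) = 1"
      by (rule dt_unipotent[of N \<tau>]) (auto simp: H_def)
    then show ?thesis by (simp only: mult_1_left)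
  qed
  also have "\<dots> = dt N (\<lambda>a b. (if a = b then 1 else 0) + s * ?K a b)"
    unfolding dt_mult
  proof (rule dt_cong)
    fix a b assume ab: "a < N" "b < N"
    let ?Y = "\<lambda>c. \<Sum>k<M. \<beta> c k * (s * \<psi> b 0 k)"
    have "(\<Sum>c<N. ((if a = c then 1 else 0) + - s * H a c) * ((if c = b then 1 else 0) + ?Y c))
        = (\<Sum>c<N. (if a = c then (if c = b then 1 else 0) + ?Y c else 0)
            - (if c = b then s * H a c else 0) - s * H a c * ?Y c)"
      by (rule sum.cong) (auto simp: algebra_simps)
    also have "\<dots> = (if a = b then 1 else 0) + ?Y a - s * H a b - (\<Sum>c<N. s * H a c * ?Y c)"
      using ab by (simp add: sum_subtractf)
    also have "(\<Sum>c<N. s * H a c * ?Y c) = (\<Sum>k<M. (s * (\<Sum>c<N. H a c * \<beta> c k)) * (s * \<psi> b 0 k))"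
      unfolding sum_distrib_left sum_distrib_right
      by (subst sum.swap) (simp add: mult_ac)
    also have "\<dots> = (\<Sum>k<M. (\<beta> a k - B a k) * (s * \<psi> b 0 k))"
      by (simp add: exp\<beta>[OF ab(1)])
    also have "\<dots> = ?Y a - s * (\<Sum>k<M. B a k * \<psi> b 0 k)"
      by (simp add: algebra_simps sum_subtractf sum_distrib_left)
    finally show "(\<Sum>c<N. ((if a = c then 1 else 0) + - s * H a c) * ((if c = b then 1 else 0) + ?Y c))
        = (if a = b then 1 else 0) + s * ?K a b"
      unfolding BX[OF ab, symmetric] by (simp add: algebra_simps)
  qed
  finally show ?thesis unfolding G_def .
qed

end

section \<open>Contour integrals over circles\<close>

definition circ :: "real \<Rightarrow> (complex \<Rightarrow> complex) \<Rightarrow> complex" where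
  "circ \<rho> f = contour_integral (circlepath 0 \<rho>) f / (2 * of_real pi * \<i>)"

lemma circ_cong:
  "0 < \<rho> \<Longrightarrow> (\<And>z. norm z = \<rho> \<Longrightarrow> f z = g z) \<Longrightarrow> circ \<rho> f = circ \<rho> g"
  unfolding circ_def by (intro arg_cong2[where f = "(/)"] contour_integral_cong) auto

lemma contour_integrable_circle:
  "0 < \<rho> \<Longrightarrow> continuous_on (sphere 0 \<rho>) f \<Longrightarrow> f contour_integrable_on circlepath 0 \<rho>"
  by (intro contour_integrable_continuous_circlepath) simp

lemma circ_add:
  assumes "0 < \<rho>" "continuous_on (sphere 0 \<rho>) f" "continuous_on (sphere 0 \<rho>) g"
  shows "circ \<rho> (\<lambda>z. f z + g z) = circ \<rho> f + circ \<rho> g"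
  by (simp add: circ_def contour_integral_add contour_integrable_circle assms add_divide_distrib)

lemma circ_diff:
  assumes "0 < \<rho>" "continuous_on (sphere 0 \<rho>) f" "continuous_on (sphere 0 \<rho>) g"
  shows "circ \<rho> (\<lambda>z. f z - g z) = circ \<rho> f - circ \<rho> g"
  by (simp add: circ_def contour_integral_diff contour_integrable_circle assms diff_divide_distrib)

lemma circ_lmul:
  assumes "0 < \<rho>" "continuous_on (sphere 0 \<rho>) f"
  shows "circ \<rho> (\<lambda>z. c * f z) = c * circ \<rho> f"
  by (simp add: circ_def contour_integral_lmul contour_integrable_circle assms)

lemma circ_sum:
  assumes "0 < \<rho>" "finite A" "\<And>i. i \<in> A \<Longrightarrow> continuous_on (sphere 0 \<rho>) (f i)"
  shows "circ \<rho> (\<lambda>z. \<Sum>i\<in>A. c i * f i z) = (\<Sum>i\<in>A. c i * circ \<rho> (f i))"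
proof -
  have "contour_integral (circlepath 0 \<rho>) (\<lambda>z. \<Sum>i\<in>A. c i * f i z)
      = (\<Sum>i\<in>A. contour_integral (circlepath 0 \<rho>) (\<lambda>z. c i * f i z))"
    using assms by (intro contour_integral_sum contour_integrable_circle continuous_intros) auto
  also have "\<dots> = (\<Sum>i\<in>A. c i * contour_integral (circlepath 0 \<rho>) (f i))"
    using assms by (intro sum.cong refl contour_integral_lmul contour_integrable_circle)
  finally show ?thesis by (simp add: circ_def sum_divide_distrib)
qed

text \<open>Concentric circles are homotopic along radial segments, on which the norm stays between
  the two radii, in whichever order these come.\<close>

lemma circ_annulus:
  assumes "0 < \<rho>" "0 < \<rho>'" "open S" "f holomorphic_on S"
    and S: "\<And>z. min \<rho> \<rho>' \<le> norm z \<Longrightarrow> norm z \<le> max \<rho> \<rho>' \<Longrightarrow> z \<in> S"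
  shows "circ \<rho> f = circ \<rho>' f"
proof -
  have "homotopic_loops S (circlepath 0 \<rho>) (circlepath 0 \<rho>')"
  proof (rule homotopic_loops_linear)
    fix t :: real assume "t \<in> {0..1}"
    show "closed_segment (circlepath 0 \<rho> t) (circlepath 0 \<rho>' t) \<subseteq> S"
    proof
      fix z assume "z \<in> closed_segment (circlepath 0 \<rho> t) (circlepath 0 \<rho>' t)"
      then obtain x where x: "0 \<le> x" "x \<le> 1"
        and z: "z = (1 - x) *\<^sub>R circlepath 0 \<rho> t + x *\<^sub>R circlepath 0 \<rho>' t"
        by (auto simp: closed_segment_def)
      have "z = of_real ((1 - x) * \<rho> + x * \<rho>') * exp (2 * of_real pi * \<i> * of_real t)"
        unfolding z circlepath by (simp add: scaleR_conv_of_real algebra_simps)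
      then have "norm z = \<bar>(1 - x) * \<rho> + x * \<rho>'\<bar>"
        by (simp add: norm_mult del: of_real_add of_real_mult of_real_diff)
      then have n: "norm z = (1 - x) * \<rho> + x * \<rho>'" using assms x by simp
      have "(1 - x) * min \<rho> \<rho>' + x * min \<rho> \<rho>' \<le> norm z"
        unfolding n using x by (intro add_mono mult_left_mono) auto
      moreover have "norm z \<le> (1 - x) * max \<rho> \<rho>' + x * max \<rho> \<rho>'"
        unfolding n using x by (intro add_mono mult_left_mono) auto
      ultimately show "z \<in> S" by (intro S) (auto simp: algebra_simps)
    qed
  qed auto
  then have "contour_integral (circlepath 0 \<rho>) f = contour_integral (circlepath 0 \<rho>') f"
    using assms by (intro Cauchy_theorem_homotopic_loops) auto
  then show ?thesis by (simp add: circ_def)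
qed

lemma circ_disc:
  assumes "0 < \<rho>" "\<rho> < R" "f holomorphic_on ball 0 R"
  shows "circ \<rho> f = 0"
proof -
  have "(f has_contour_integral 0) (circlepath 0 \<rho>)"
    by (rule Cauchy_theorem_convex_simple[OF assms(3)]) (use assms in auto)
  then show ?thesis by (simp add: circ_def contour_integral_unique)
qed

lemma norm_circ_le:
  assumes "0 < \<rho>" "continuous_on (sphere 0 \<rho>) f" "\<And>z. norm z = \<rho> \<Longrightarrow> norm (f z) \<le> B"
  shows "norm (circ \<rho> f) \<le> B * \<rho>"
proof -
  have "norm (f (of_real \<rho>)) \<le> B" using assms(1) by (intro assms(3)) simp
  then have B: "0 \<le> B" by (rule order_trans[OF norm_ge_zero])
  have "norm (contour_integral (circlepath 0 \<rho>) f) \<le> B * (2 * pi * \<rho>)"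
    using has_contour_integral_bound_circlepath[OF
        has_contour_integral_integral[OF contour_integrable_circle[OF assms(1,2)]] B assms(1)] assms(3)
    by simp
  then show ?thesis by (simp add: circ_def norm_divide norm_mult field_simps)
qed

text \<open>Enlarging the circle to radius \<open>x\<close> leaves the integral unchanged, while
  length times maximum decays like \<open>B / x\<close>.\<close>

lemma circ_infinity:
  assumes "0 < \<rho>" "open S" "f holomorphic_on S" "\<And>z. \<rho> \<le> norm z \<Longrightarrow> z \<in> S"
    and bound: "\<And>z. R \<le> norm z \<Longrightarrow> norm (f z) \<le> B / norm z ^ 2"
  shows "circ \<rho> f = 0"
proof -
  have "norm (circ \<rho> f) \<le> B / x" if x: "x \<ge> max \<rho> R" for x
  proof -
    have "x > 0" using x assms(1) by simp
    have "circ \<rho> f = circ x f"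
      by (rule circ_annulus[OF assms(1) \<open>x > 0\<close> assms(2,3)]) (use x assms(4) in auto)
    moreover have "norm (circ x f) \<le> (B / x ^ 2) * x"
    proof (rule norm_circ_le[OF \<open>x > 0\<close>])
      have "sphere 0 x \<subseteq> S" using x assms(4) by auto
      then show "continuous_on (sphere 0 x) f"
        using assms(3) holomorphic_on_imp_continuous_on continuous_on_subset by blast
      show "norm (f z) \<le> B / x ^ 2" if "norm z = x" for z
        using bound[of z] that x by simp
    qed
    ultimately show ?thesis using \<open>x > 0\<close> by (simp add: power2_eq_square)
  qed
  then have "\<forall>\<^sub>F x in at_top. norm (circ \<rho> f) \<le> B / x"
    unfolding eventually_at_top_linorder by blast
  moreover have "((\<lambda>x. B / x) \<longlongrightarrow> 0) at_top"
    by (rule real_tendsto_divide_at_top[OF tendsto_const filterlim_ident])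
  ultimately have "norm (circ \<rho> f) \<le> 0"
    by (intro tendsto_le[OF _ _ tendsto_const[of "norm (circ \<rho> f)" at_top]]) auto
  then show ?thesis by simp
qed

lemma powi_eq_power: "0 \<le> k \<Longrightarrow> (z::complex) powi k = z ^ nat k"
  by (simp add: power_int_def)

lemma holomorphic_on_powi:
  assumes "0 \<notin> S" shows "(\<lambda>z. z powi k) holomorphic_on S"
  using assms by (intro holomorphic_intros) auto

lemma circ_powi:
  assumes "0 < \<rho>"
  shows "circ \<rho> (\<lambda>z. z powi k) = of_bool (k = - 1)"
proof (cases k "- 1 :: int" rule: linorder_cases)
  case equal
  then show ?thesis
    using contour_integral_circlepath[OF assms, of 0]
    by (simp add: circ_def power_int_minus inverse_eq_divide)
next
  case greater
  then have "(\<lambda>z. z powi k) holomorphic_on ball 0 (\<rho> + 1)"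
    by (simp add: powi_eq_power) (intro holomorphic_intros)
  then have "circ \<rho> (\<lambda>z. z powi k) = 0"
    by (intro circ_disc[of \<rho> "\<rho> + 1"]) (use assms in auto)
  then show ?thesis using greater by simp
next
  case less
  have "circ \<rho> (\<lambda>z. z powi k) = 0"
  proof (rule circ_infinity[where S = "- {0}" and B = 1 and R = 1])
    show "(\<lambda>z. z powi k) holomorphic_on - {0}" by (rule holomorphic_on_powi) simp
    fix z :: complex assume z: "1 \<le> norm z"
    have "norm z powi k \<le> norm z powi (- 2)"
      using less z by (intro power_int_increasing) auto
    then show "norm (z powi k) \<le> 1 / norm z ^ 2"
      by (simp add: norm_power_int power_int_minus inverse_eq_divide)
  qed (use assms in auto)
  then show ?thesis using less by simp
qed

text \<open>The difference quotient \<open>D\<close> has a removable singularity at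
  \<open>z\<close>, so it integrates to the same value over both circles. What is left is
  \<open>1 / (w - z)\<close>, whose pole is enclosed by the outer circle only.\<close>

lemma circ_pass_pole:
  assumes "0 < \<rho>" "\<rho> < norm z" "norm z < \<rho>'" "open S" "h holomorphic_on S"
    and S: "\<And>w. \<rho> \<le> norm w \<Longrightarrow> norm w \<le> \<rho>' \<Longrightarrow> w \<in> S"
  shows "circ \<rho> (\<lambda>w. h w / (z - w)) = circ \<rho>' (\<lambda>w. h w / (z - w)) + h z"
proof -
  define D where "D w = (if w = z then deriv h z else (h w - h z) / (w - z))" for w
  have D: "D holomorphic_on S"
  proof -
    have "(\<lambda>w. if w = z then deriv h z else (h w - h z) / (w - z)) holomorphic_on S"
      by (rule pole_lemma_open[OF assms(5,4)])
    then show ?thesis by (simp add: D_def[abs_def])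
  qed
  have contD: "continuous_on (sphere 0 x) D" if "x = \<rho> \<or> x = \<rho>'" for x
    using that assms(1-3)
    by (intro continuous_on_subset[OF holomorphic_on_imp_continuous_on[OF D]]) (auto intro!: S)
  have DD: "circ \<rho> D = circ \<rho>' D"
    using assms by (intro circ_annulus[OF _ _ assms(4) D]) (auto intro!: S)
  have cont1: "continuous_on (sphere 0 x) (\<lambda>w. 1 / (w - z))" if "x = \<rho> \<or> x = \<rho>'" for x
    using that assms(2,3) by (intro continuous_intros) auto
  have split: "circ x (\<lambda>w. h w / (z - w)) = (- 1) * circ x D + (- h z) * circ x (\<lambda>w. 1 / (w - z))"
    if x: "x = \<rho> \<or> x = \<rho>'" for x
  proof -
    have "x > 0" using x assms by auto
    have "circ x (\<lambda>w. h w / (z - w)) = circ x (\<lambda>w. (- 1) * D w + (- h z) * (1 / (w - z)))"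
    proof (rule circ_cong[OF \<open>x > 0\<close>])
      fix w :: complex assume "norm w = x"
      then have "w \<noteq> z" using x assms by auto
      have "h w / (z - w) = - (h w / (w - z))" by (metis minus_diff_eq minus_divide_right)
      then show "h w / (z - w) = (- 1) * D w + (- h z) * (1 / (w - z))"
        using \<open>w \<noteq> z\<close> by (simp add: D_def diff_divide_distrib)
    qed
    also have "\<dots> = circ x (\<lambda>w. (- 1) * D w) + circ x (\<lambda>w. (- h z) * (1 / (w - z)))"
      by (rule circ_add[OF \<open>x > 0\<close>]) (intro continuous_intros contD[OF x] cont1[OF x])+
    also have "circ x (\<lambda>w. (- 1) * D w) = (- 1) * circ x D"
      by (rule circ_lmul[OF \<open>x > 0\<close> contD[OF x]])
    also have "circ x (\<lambda>w. (- h z) * (1 / (w - z))) = (- h z) * circ x (\<lambda>w. 1 / (w - z))"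
      by (rule circ_lmul[OF \<open>x > 0\<close> cont1[OF x]])
    finally show ?thesis .
  qed
  have "circ \<rho> (\<lambda>w. 1 / (w - z)) = 0"
    by (rule circ_disc[OF assms(1,2)]) (intro holomorphic_intros, auto)
  moreover have "circ \<rho>' (\<lambda>w. 1 / (w - z)) = 1"
  proof -
    have "((\<lambda>u. 1 / (u - z)) has_contour_integral (2 * of_real pi * \<i> * 1)) (circlepath 0 \<rho>')"
      using Cauchy_integral_circlepath_simple[of "\<lambda>_. 1" 0 \<rho>' z] assms(3) by simp
    then show ?thesis by (simp add: circ_def contour_integral_unique)
  qed
  ultimately show ?thesis using split DD by simp
qed

section \<open>Laurent coefficients\<close>

definition laurent_coeff :: "real \<Rightarrow> (complex \<Rightarrow> complex) \<Rightarrow> int \<Rightarrow> complex" where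
  "laurent_coeff \<rho> f l = circ \<rho> (\<lambda>z. f z * z powi (- l - 1))"

lemma powi_split: "z \<noteq> 0 \<Longrightarrow> m + n = k \<Longrightarrow> (z::'a::field) powi m * z powi n = z powi k"
  using power_int_add[of z m n] by simp

lemma continuous_on_sphere_powi: "0 < \<rho> \<Longrightarrow> continuous_on (sphere 0 \<rho>) (\<lambda>z::complex. z powi k)"
  by (intro holomorphic_on_imp_continuous_on holomorphic_on_powi) auto

lemma laurent_coeff_cong:
  "0 < \<rho> \<Longrightarrow> (\<And>z. norm z = \<rho> \<Longrightarrow> f z = g z) \<Longrightarrow> laurent_coeff \<rho> f l = laurent_coeff \<rho> g l"
  unfolding laurent_coeff_def by (rule circ_cong) auto

lemma laurent_coeff_mult_minus:
  assumes "0 < \<rho>" "continuous_on (sphere 0 \<rho>) f"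
  shows "laurent_coeff \<rho> (\<lambda>z. f z * (1 - c / z)) l = laurent_coeff \<rho> f l - c * laurent_coeff \<rho> f (l + 1)"
proof -
  have cont: "continuous_on (sphere 0 \<rho>) (\<lambda>z. f z * z powi k)" for k
    by (intro continuous_intros continuous_on_sphere_powi assms)
  have "laurent_coeff \<rho> (\<lambda>z. f z * (1 - c / z)) l
      = circ \<rho> (\<lambda>z. f z * z powi (- l - 1) - c * (f z * z powi (- (l + 1) - 1)))"
    unfolding laurent_coeff_def
  proof (rule circ_cong[OF assms(1)])
    fix z :: complex assume "norm z = \<rho>"
    then have "z \<noteq> 0" using assms by auto
    then have "z powi (- l - 1) = z powi (- (l + 1) - 1) * z"
      using powi_split[of z "- (l + 1) - 1" 1 "- l - 1"] by simp
    then show "f z * (1 - c / z) * z powi (- l - 1)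
        = f z * z powi (- l - 1) - c * (f z * z powi (- (l + 1) - 1))"
      using \<open>z \<noteq> 0\<close> by (simp add: field_simps)
  qed
  also have "\<dots> = circ \<rho> (\<lambda>z. f z * z powi (- l - 1)) - circ \<rho> (\<lambda>z. c * (f z * z powi (- (l + 1) - 1)))"
    by (rule circ_diff[OF assms(1)]) (intro continuous_intros cont)+
  also have "circ \<rho> (\<lambda>z. c * (f z * z powi (- (l + 1) - 1))) = c * circ \<rho> (\<lambda>z. f z * z powi (- (l + 1) - 1))"
    by (rule circ_lmul[OF assms(1) cont])
  finally show ?thesis by (simp only: laurent_coeff_def)
qed

lemma laurent_coeff_mult_plus:
  assumes "0 < \<rho>" "continuous_on (sphere 0 \<rho>) f"
  shows "laurent_coeff \<rho> (\<lambda>z. f z * (1 - z * c)) l = laurent_coeff \<rho> f l - c * laurent_coeff \<rho> f (l - 1)"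
proof -
  have cont: "continuous_on (sphere 0 \<rho>) (\<lambda>z. f z * z powi k)" for k
    by (intro continuous_intros continuous_on_sphere_powi assms)
  have "laurent_coeff \<rho> (\<lambda>z. f z * (1 - z * c)) l
      = circ \<rho> (\<lambda>z. f z * z powi (- l - 1) - c * (f z * z powi (- (l - 1) - 1)))"
    unfolding laurent_coeff_def
  proof (rule circ_cong[OF assms(1)])
    fix z :: complex assume "norm z = \<rho>"
    then have "z \<noteq> 0" using assms by auto
    then have "z powi (- (l - 1) - 1) = z powi (- l - 1) * z"
      using powi_split[of z "- l - 1" 1 "- (l - 1) - 1"] by simp
    then show "f z * (1 - z * c) * z powi (- l - 1)
        = f z * z powi (- l - 1) - c * (f z * z powi (- (l - 1) - 1))"
      by (simp only:) (simp add: algebra_simps)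
  qed
  also have "\<dots> = circ \<rho> (\<lambda>z. f z * z powi (- l - 1)) - circ \<rho> (\<lambda>z. c * (f z * z powi (- (l - 1) - 1)))"
    by (rule circ_diff[OF assms(1)]) (intro continuous_intros cont)+
  also have "circ \<rho> (\<lambda>z. c * (f z * z powi (- (l - 1) - 1))) = c * circ \<rho> (\<lambda>z. f z * z powi (- (l - 1) - 1))"
    by (rule circ_lmul[OF assms(1) cont])
  finally show ?thesis by (simp only: laurent_coeff_def)
qed

text \<open>Both kinds of factors at once, in the form of the recursion that a transfer step
  inverts.\<close>

lemma laurent_coeff_mult_if:
  assumes "0 < \<rho>" "continuous_on (sphere 0 \<rho>) f"
  shows "laurent_coeff \<rho> (\<lambda>z. f z * (if b then 1 - of_real (inverse x) / z else 1 - z * of_real x)) l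
       = (if b then laurent_coeff \<rho> f l - laurent_coeff \<rho> f (l + 1) / of_real x
          else laurent_coeff \<rho> f l - of_real x * laurent_coeff \<rho> f (l - 1))"
proof -
  have "of_real (inverse x) * y = y / of_real x" for y :: complex
    by (simp add: divide_inverse mult.commute)
  then show ?thesis
    using laurent_coeff_mult_minus[OF assms, of "of_real (inverse x)" l]
      laurent_coeff_mult_plus[OF assms, of "of_real x" l]
    by (cases b) (simp_all only: if_True if_False)
qed

lemma laurent_coeff_disc:
  assumes "0 < \<rho>" "\<rho> < R" "f holomorphic_on ball 0 R" "l < 0"
  shows "laurent_coeff \<rho> f l = 0"
  unfolding laurent_coeff_def
proof (rule circ_disc[OF assms(1,2)])
  have "(\<lambda>z. f z * z ^ nat (- l - 1)) holomorphic_on ball 0 R"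
    by (intro holomorphic_intros assms)
  then show "(\<lambda>z. f z * z powi (- l - 1)) holomorphic_on ball 0 R"
    using assms(4) by (simp add: powi_eq_power)
qed

lemma powi_le_inverse_square:
  assumes "1 \<le> (x::real)" "k \<le> - 2"
  shows "x powi k \<le> 1 / x\<^sup>2"
proof -
  have "x powi k \<le> x powi (- 2)" using assms by (intro power_int_increasing) auto
  then show ?thesis by (simp add: power_int_minus inverse_eq_divide)
qed

lemma laurent_coeff_infinity:
  assumes "0 < \<rho>" "open U" "f holomorphic_on U" "\<And>z. \<rho> \<le> norm z \<Longrightarrow> z \<in> U"
    and bound: "\<And>z. R \<le> norm z \<Longrightarrow> norm (f z) \<le> B * norm z ^ n" and "1 \<le> R" "int n < l"
  shows "laurent_coeff \<rho> f l = 0"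
  unfolding laurent_coeff_def
proof (rule circ_infinity[where S = "U \<inter> - {0}" and R = R and B = B])
  show "(\<lambda>z. f z * z powi (- l - 1)) holomorphic_on U \<inter> - {0}"
    by (intro holomorphic_on_mult holomorphic_on_powi holomorphic_on_subset[OF assms(3)]) auto
  fix z :: complex assume z: "R \<le> norm z"
  have z1: "1 \<le> norm z" "z \<noteq> 0" using z assms(6) by auto
  have "0 \<le> B * norm z ^ n" using norm_ge_zero bound[OF z] by (rule order_trans)
  moreover have "0 < norm z ^ n" using z1 by simp
  ultimately have B: "0 \<le> B" by (simp only: zero_le_mult_iff) linarith
  have "norm (f z * z powi (- l - 1)) \<le> (B * norm z ^ n) * norm z powi (- l - 1)"
    unfolding norm_mult norm_power_int using bound[OF z] by (intro mult_right_mono) auto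
  also have "\<dots> = B * norm z powi (int n - l - 1)"
    using powi_split[of "norm z" "int n" "- l - 1" "int n - l - 1"] z1 by simp
  also have "\<dots> \<le> B * (1 / (norm z)\<^sup>2)"
    using B z1 assms(7) by (intro mult_left_mono powi_le_inverse_square) auto
  finally show "norm (f z * z powi (- l - 1)) \<le> B / (norm z)\<^sup>2" by simp
qed (use assms in auto)

lemma norm_laurent_coeff_le:
  assumes "0 < \<rho>" "continuous_on (sphere 0 \<rho>) f"
  obtains B where "\<And>l. norm (laurent_coeff \<rho> f l) \<le> B * \<rho> powi (- l)"
proof -
  have "compact (f ` sphere 0 \<rho>)" by (rule compact_continuous_image[OF assms(2)]) simp
  then obtain B where B: "\<And>z. norm z = \<rho> \<Longrightarrow> norm (f z) \<le> B"
    by (fastforce dest!: compact_imp_bounded simp: bounded_iff)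
  have "norm (laurent_coeff \<rho> f l) \<le> B * \<rho> powi (- l)" for l
  proof -
    have "norm (laurent_coeff \<rho> f l) \<le> (B * \<rho> powi (- l - 1)) * \<rho>"
      unfolding laurent_coeff_def
    proof (rule norm_circ_le[OF assms(1)])
      show "continuous_on (sphere 0 \<rho>) (\<lambda>z. f z * z powi (- l - 1))"
        by (intro continuous_intros continuous_on_sphere_powi assms)
      show "norm (f z * z powi (- l - 1)) \<le> B * \<rho> powi (- l - 1)" if "norm z = \<rho>" for z
        unfolding norm_mult norm_power_int that using B[OF that] assms(1) by (intro mult_right_mono) auto
    qed
    also have "\<dots> = B * \<rho> powi (- l)"
      using powi_split[of \<rho> "- l - 1" 1 "- l"] assms(1) by simp
    finally show ?thesis .
  qed
  then show ?thesis by (rule that)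
qed

text \<open>Cauchy's estimate: coefficients taken on a circle of radius \<rho> grow at most at the
  rate \<open>1 / \<rho>\<close>, so a larger admissible circle means slower growth.\<close>

lemma fast_laurent_coeff:
  assumes "0 < \<rho>" "continuous_on (sphere 0 \<rho>) f" "1 / \<rho> < R"
  shows "fast R (\<lambda>p. laurent_coeff \<rho> f (int p - c))"
proof -
  obtain B where B: "\<And>l. norm (laurent_coeff \<rho> f l) \<le> B * \<rho> powi (- l)"
    using norm_laurent_coeff_le[OF assms(1,2)] by blast
  show ?thesis
  proof (rule fastI[OF _ assms(3)])
    show "0 < 1 / \<rho>" using assms by simp
    fix p
    have "\<rho> powi (- (int p - c)) = \<rho> powi c * (1 / \<rho>) ^ p"
      using powi_split[of \<rho> c "- int p" "- (int p - c)"] assms(1)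
      by (simp add: power_int_minus power_divide inverse_eq_divide)
    then show "norm (laurent_coeff \<rho> f (int p - c)) \<le> (B * \<rho> powi c) * (1 / \<rho>) ^ p"
      using B[of "int p - c"] by (simp add: mult.assoc)
  qed
qed

lemma geometric_expansion:
  fixes z w :: complex
  assumes "w \<noteq> 0" "z \<noteq> w"
  shows "1 / (z - w) = (\<Sum>k<K. - (z ^ k) * w powi (- int k - 1)) + z ^ K * w powi (- int K) / (z - w)"
proof (induction K)
  case (Suc K)
  have "w powi (- int K) = w powi (- int K - 1) * w"
    using powi_split[of w "- int K - 1" 1 "- int K"] assms by simp
  moreover have "- int (Suc K) = - int K - 1" by simp
  ultimately have "z ^ K * w powi (- int K) / (z - w)
      = - (z ^ K) * w powi (- int K - 1) + z ^ Suc K * w powi (- int (Suc K)) / (z - w)"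
    using assms by (simp only:) (simp add: field_simps)
  then show ?case using Suc by simp
qed simp

section \<open>The symbols of the kernel and their Laurent coefficients\<close>

context transfer
begin

text \<open>\<open>PP n\<close> and \<open>PM S n\<close> are \<open>Phi_plus\<close> and
  \<open>Phi_minus\<close> at reversed time \<open>n\<close>: the steps \<open>1..n\<close> cross
  half-integers above that time, the steps \<open>Suc n..S\<close> cross those below it.\<close>

definition PP :: "nat \<Rightarrow> complex \<Rightarrow> complex" where
  "PP n z = (\<Prod>i\<in>{i \<in> {1..n}. \<not> up i}. 1 - z * of_real (r i))"

definition PM :: "nat \<Rightarrow> nat \<Rightarrow> complex \<Rightarrow> complex" where
  "PM S n z = (\<Prod>i\<in>{i \<in> {Suc n..S}. up i}. 1 - of_real (inverse (r i)) / z)"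

text \<open>The inequality with \<open>Rrad\<close> without division, its infinite value being
  absorbed by the empty quantifier; \<open>outer_rad\<close> does the same for
  \<open>Rstar\<close>.\<close>

definition inner_rad :: "nat \<Rightarrow> real \<Rightarrow> bool" where
  "inner_rad n \<rho> \<longleftrightarrow> 0 < \<rho> \<and> (\<forall>i\<in>{1..n}. \<not> up i \<longrightarrow> \<rho> * r i < 1)"

definition outer_rad :: "nat \<Rightarrow> nat \<Rightarrow> real \<Rightarrow> bool" where
  "outer_rad S n \<rho> \<longleftrightarrow> 0 < \<rho> \<and> (\<forall>i\<in>{Suc n..S}. up i \<longrightarrow> 1 < \<rho> * r i)"

text \<open>The radius \<open>mid n\<close> lies in the gap between \<open>1 / r (n + 1)\<close> and \<open>1 / r n\<close>, where all the series converge.\<close>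

definition mid :: "nat \<Rightarrow> real" where "mid n = 2 / (r n + r (Suc n))"

definition alpha :: "nat \<Rightarrow> nat \<Rightarrow> complex \<Rightarrow> complex" where "alpha S n z = PM S n z / PP n z"
definition beta :: "nat \<Rightarrow> nat \<Rightarrow> complex \<Rightarrow> complex" where "beta S n z = PP n z / PM S n z"

definition ca :: "nat \<Rightarrow> nat \<Rightarrow> int \<Rightarrow> complex" where
  "ca S n = laurent_coeff (mid n) (alpha S n)"
text \<open>The sign of the index is reversed so that \<open>ca\<close> and \<open>cb\<close> are
  both evaluated at a position minus a common shift: the powers for \<open>x - c\<close> and
  \<open>p2 - c\<close> multiply to the power \<open>x - p2\<close>.\<close>

definition cb :: "nat \<Rightarrow> nat \<Rightarrow> int \<Rightarrow> complex" where
  "cb S n l = laurent_coeff (mid n) (beta S n) (- l)"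
definition ckap :: "nat \<Rightarrow> nat \<Rightarrow> nat \<Rightarrow> int \<Rightarrow> complex" where
  "ckap S n m = laurent_coeff (mid n) (\<lambda>z. alpha S n z * beta S m z)"

lemma r_le: "i \<le> j \<Longrightarrow> r i \<le> r j"
  using lift_Suc_mono_le[of r] r_less less_imp_le by metis

lemma mid_pos: "0 < mid n"
  using r_pos[of n] r_pos[of "Suc n"] by (simp add: mid_def)

lemma mid_mult_less: "i \<le> n \<Longrightarrow> mid n * r i < 1"
  using r_le[of i n] r_less[of n] r_pos[of n] r_pos[of "Suc n"] by (simp add: mid_def field_simps)

lemma mid_mult_greater: "n < i \<Longrightarrow> 1 < mid n * r i"
  using r_le[of "Suc n" i] r_less[of n] r_pos[of n] r_pos[of "Suc n"] by (simp add: mid_def field_simps)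

lemma inner_rad_mid: "n \<le> m \<Longrightarrow> inner_rad n (mid m)"
  using mid_mult_less[of _ m] by (auto simp: inner_rad_def mid_pos)

lemma outer_rad_mid: "m \<le> n \<Longrightarrow> outer_rad S n (mid m)"
  using mid_mult_greater[of m] by (auto simp: outer_rad_def mid_pos)

text \<open>An \<open>up\<close> step adds no factor to \<open>PP\<close>, so the pole-free disc at
  time \<open>Suc n\<close> still contains the larger radius \<open>mid n\<close>. This yields
  growth below \<open>r (Suc n)\<close> for the coefficients after the step, which its telescoping
  sum requires.\<close>

lemma inner_rad_mid_up: "up (Suc n) \<Longrightarrow> inner_rad (Suc n) (mid n)"
  using mid_mult_less[of _ n] by (auto simp: inner_rad_def mid_pos le_Suc_eq)

lemma inverse_mid_less: "1 / mid n < r (Suc n)"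
  using r_less[of n] by (simp add: mid_def)

lemma inner_rad_antimono: "inner_rad n \<rho> \<Longrightarrow> 0 < \<rho>' \<Longrightarrow> \<rho>' \<le> \<rho> \<Longrightarrow> inner_rad n \<rho>'"
  unfolding inner_rad_def using r_pos by (meson mult_right_mono less_imp_le order_le_less_trans)

lemma outer_rad_mono: "outer_rad S n \<rho> \<Longrightarrow> \<rho> \<le> \<rho>' \<Longrightarrow> outer_rad S n \<rho>'"
  unfolding outer_rad_def using r_pos by (meson mult_right_mono less_imp_le order_less_le_trans)

lemma open_inner: "open {z::complex. inner_rad n (norm z)}"
proof -
  have "{z::complex. inner_rad n (norm z)} = - {0} \<inter> (\<Inter>i\<in>{i \<in> {1..n}. \<not> up i}. {z. norm z * r i < 1})"
    by (auto simp: inner_rad_def)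
  moreover have "open {z::complex. norm z * r i < 1}" for i
    by (intro open_Collect_less continuous_intros)
  ultimately show ?thesis by (auto intro!: open_INT)
qed

lemma open_outer: "open {z::complex. outer_rad S n (norm z)}"
proof -
  have "{z::complex. outer_rad S n (norm z)} = - {0} \<inter> (\<Inter>i\<in>{i \<in> {Suc n..S}. up i}. {z. 1 < norm z * r i})"
    by (auto simp: outer_rad_def)
  moreover have "open {z::complex. 1 < norm z * r i}" for i
    by (intro open_Collect_less continuous_intros)
  ultimately show ?thesis by (auto intro!: open_INT)
qed

lemma PP_nonzero:
  assumes "inner_rad n (norm z)" shows "PP n z \<noteq> 0"
proof
  assume "PP n z = 0"
  then obtain i where i: "i \<in> {1..n}" "\<not> up i" "z * of_real (r i) = 1"
    by (auto simp: PP_def)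
  then have "norm z * r i = 1" using r_pos[of i] by (metis norm_mult norm_of_real norm_one abs_of_pos)
  then show False using assms i by (auto simp: inner_rad_def)
qed

lemma PM_nonzero:
  assumes "outer_rad S n (norm z)" shows "PM S n z \<noteq> 0"
proof
  assume "PM S n z = 0"
  then obtain i where i: "i \<in> {Suc n..S}" "up i" "of_real (inverse (r i)) / z = 1"
    by (auto simp: PM_def)
  then have "of_real (inverse (r i)) = z" by (simp only: divide_eq_1_iff)
  then have "norm z = \<bar>inverse (r i)\<bar>" using norm_of_real[of "inverse (r i)"] by metis
  then have "norm z * r i = 1" using r_pos[of i] by (simp only: abs_of_pos positive_imp_inverse_positive) simp
  then show False using assms i by (auto simp: outer_rad_def)
qed

lemma holomorphic_PP: "PP n holomorphic_on A"
  unfolding PP_def[abs_def] by (intro holomorphic_intros)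

lemma holomorphic_PM: "0 \<notin> A \<Longrightarrow> PM S n holomorphic_on A"
  unfolding PM_def[abs_def] by (intro holomorphic_intros) auto

lemma holomorphic_alpha: "alpha S n holomorphic_on {z. inner_rad n (norm z)}"
  unfolding alpha_def[abs_def]
  by (intro holomorphic_on_divide holomorphic_PP holomorphic_PM) (auto simp: PP_nonzero, simp add: inner_rad_def)

lemma holomorphic_beta: "beta S n holomorphic_on {z. outer_rad S n (norm z)}"
  unfolding beta_def[abs_def]
  by (intro holomorphic_on_divide holomorphic_PP holomorphic_PM) (auto simp: PM_nonzero, simp add: outer_rad_def)

lemma continuous_on_alpha: "inner_rad n \<rho> \<Longrightarrow> continuous_on (sphere 0 \<rho>) (alpha S n)"
  by (rule continuous_on_subset[OF holomorphic_on_imp_continuous_on[OF holomorphic_alpha]]) auto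

lemma continuous_on_beta: "outer_rad S n \<rho> \<Longrightarrow> continuous_on (sphere 0 \<rho>) (beta S n)"
  by (rule continuous_on_subset[OF holomorphic_on_imp_continuous_on[OF holomorphic_beta]]) auto

text \<open>The admissible radii are closed under shrinking, so there is no pole between \<rho> and
  \<open>mid n\<close>. For \<open>beta\<close> they are closed under enlarging.\<close>

lemma laurent_coeff_alpha:
  assumes "inner_rad n \<rho>" shows "laurent_coeff \<rho> (alpha S n) l = ca S n l"
  unfolding ca_def laurent_coeff_def
proof (rule circ_annulus[OF _ mid_pos open_inner])
  show "0 < \<rho>" using assms by (simp add: inner_rad_def)
  show "(\<lambda>z. alpha S n z * z powi (- l - 1)) holomorphic_on {z. inner_rad n (norm z)}"
    by (intro holomorphic_on_mult holomorphic_alpha holomorphic_on_powi) (simp add: inner_rad_def)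
  fix z :: complex assume z: "min \<rho> (mid n) \<le> norm z" "norm z \<le> max \<rho> (mid n)"
  have "0 < norm z" using z(1) mid_pos[of n] \<open>0 < \<rho>\<close> by linarith
  then show "z \<in> {z. inner_rad n (norm z)}"
    using z(2) assms inner_rad_mid[of n n] inner_rad_antimono by (auto simp: max_def split: if_splits)
qed

lemma laurent_coeff_beta:
  assumes "outer_rad S n \<rho>" shows "laurent_coeff \<rho> (beta S n) l = cb S n (- l)"
  unfolding cb_def laurent_coeff_def minus_minus
proof (rule circ_annulus[OF _ mid_pos open_outer])
  show "0 < \<rho>" using assms by (simp add: outer_rad_def)
  show "(\<lambda>z. beta S n z * z powi (- l - 1)) holomorphic_on {z. outer_rad S n (norm z)}"
    by (intro holomorphic_on_mult holomorphic_beta holomorphic_on_powi) (simp add: outer_rad_def)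
  fix z :: complex assume z: "min \<rho> (mid n) \<le> norm z" "norm z \<le> max \<rho> (mid n)"
  then show "z \<in> {z. outer_rad S n (norm z)}"
    using z(1) assms outer_rad_mid[of n n S] outer_rad_mono by (auto simp: min_def split: if_splits)
qed

text \<open>The inequality \<open>n <= m\<close> puts \<open>mid n\<close> into both ranges of
  radii, so the whole annulus between it and \<rho> avoids the poles of both factors.\<close>

lemma laurent_coeff_alpha_beta:
  assumes "inner_rad n \<rho>" "outer_rad S m \<rho>" "n \<le> m"
  shows "laurent_coeff \<rho> (\<lambda>z. alpha S n z * beta S m z) l = ckap S n m l"
  unfolding ckap_def laurent_coeff_def
proof (rule circ_annulus[OF _ mid_pos open_Int[OF open_inner open_outer]])
  show "0 < \<rho>" using assms by (simp add: inner_rad_def)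
  show "(\<lambda>z. alpha S n z * beta S m z * z powi (- l - 1)) holomorphic_on
      {z. inner_rad n (norm z)} \<inter> {z. outer_rad S m (norm z)}"
    by (intro holomorphic_on_mult holomorphic_on_subset[OF holomorphic_alpha]
        holomorphic_on_subset[OF holomorphic_beta] holomorphic_on_powi) (auto simp: inner_rad_def)
  fix z :: complex assume z: "min \<rho> (mid n) \<le> norm z" "norm z \<le> max \<rho> (mid n)"
  have "0 < norm z" using z(1) mid_pos[of n] \<open>0 < \<rho>\<close> by linarith
  then have "inner_rad n (norm z)"
    using z(2) assms inner_rad_mid[of n n] inner_rad_antimono by (auto simp: max_def split: if_splits)
  moreover have "outer_rad S m (norm z)"
    using z(1) assms outer_rad_mid[of n m S] outer_rad_mono by (auto simp: min_def split: if_splits)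
  ultimately show "z \<in> {z. inner_rad n (norm z)} \<inter> {z. outer_rad S m (norm z)}" by simp
qed

text \<open>Crossing step \<open>Suc n\<close> moves one factor: it leaves \<open>PM\<close> if the
  step is \<open>up\<close> and enters \<open>PP\<close> otherwise. Either way the ratio is the
  factor that the transfer step inverts, which is why steps carry coefficients at time
  \<open>n\<close> to those at time \<open>Suc n\<close>.\<close>

lemma alpha_rec:
  assumes "n < S" "inner_rad (Suc n) (norm z)"
  shows "alpha S n z = alpha S (Suc n) z *
    (if up (Suc n) then 1 - of_real (inverse (r (Suc n))) / z else 1 - z * of_real (r (Suc n)))"
proof (cases "up (Suc n)")
  case True
  have "{i \<in> {Suc n..S}. up i} = insert (Suc n) {i \<in> {Suc (Suc n)..S}. up i}"
    using True assms(1) by auto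
  then have "PM S n z = (1 - of_real (inverse (r (Suc n))) / z) * PM S (Suc n) z"
    by (simp add: PM_def)
  moreover have "{i \<in> {1..Suc n}. \<not> up i} = {i \<in> {1..n}. \<not> up i}"
    using True by (auto simp: le_Suc_eq)
  then have "PP (Suc n) z = PP n z" by (simp add: PP_def)
  ultimately show ?thesis using True by (simp add: alpha_def)
next
  case False
  have "{i \<in> {Suc n..S}. up i} = {i \<in> {Suc (Suc n)..S}. up i}"
    using False by (auto simp: Suc_le_eq order_le_less)
  then have "PM S n z = PM S (Suc n) z" by (simp add: PM_def)
  moreover have "{i \<in> {1..Suc n}. \<not> up i} = insert (Suc n) {i \<in> {1..n}. \<not> up i}"
    using False by (auto simp: le_Suc_eq)
  then have "PP (Suc n) z = (1 - z * of_real (r (Suc n))) * PP n z" by (simp add: PP_def)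
  ultimately show ?thesis using False PP_nonzero[OF assms(2)] by (simp add: alpha_def)
qed

lemma ca_rec:
  assumes "n < S"
  shows "ca S n l = (if up (Suc n) then ca S (Suc n) l - ca S (Suc n) (l + 1) / of_real (r (Suc n))
           else ca S (Suc n) l - of_real (r (Suc n)) * ca S (Suc n) (l - 1))"
proof -
  let ?\<rho> = "mid (Suc n)"
  have i: "inner_rad (Suc n) ?\<rho>" "inner_rad n ?\<rho>" by (auto intro: inner_rad_mid)
  have "ca S n l = laurent_coeff ?\<rho> (alpha S n) l" using laurent_coeff_alpha[OF i(2)] by simp
  also have "\<dots> = laurent_coeff ?\<rho> (\<lambda>z. alpha S (Suc n) z *
      (if up (Suc n) then 1 - of_real (inverse (r (Suc n))) / z else 1 - z * of_real (r (Suc n)))) l"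
    by (rule laurent_coeff_cong[OF mid_pos]) (rule alpha_rec[OF assms], use i in simp)
  finally show ?thesis
    by (simp only: laurent_coeff_mult_if[OF mid_pos continuous_on_alpha[OF i(1)]]
        laurent_coeff_alpha[OF i(1)])
qed

lemma ckap_rec:
  assumes "n < m" "m \<le> S"
  shows "ckap S n m l = (if up (Suc n) then ckap S (Suc n) m l - ckap S (Suc n) m (l + 1) / of_real (r (Suc n))
           else ckap S (Suc n) m l - of_real (r (Suc n)) * ckap S (Suc n) m (l - 1))"
proof -
  let ?\<rho> = "mid (Suc n)"
  let ?f = "\<lambda>z. alpha S (Suc n) z * beta S m z"
  have i: "inner_rad (Suc n) ?\<rho>" "inner_rad n ?\<rho>" "outer_rad S m ?\<rho>"
    using assms by (auto intro: inner_rad_mid outer_rad_mid)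
  have eq: "laurent_coeff ?\<rho> ?f l' = ckap S (Suc n) m l'" for l'
    using laurent_coeff_alpha_beta[OF i(1,3)] assms by simp
  have cont: "continuous_on (sphere 0 ?\<rho>) ?f"
    by (intro continuous_intros continuous_on_alpha continuous_on_beta i)
  have "ckap S n m l = laurent_coeff ?\<rho> (\<lambda>z. alpha S n z * beta S m z) l"
    using laurent_coeff_alpha_beta[OF i(2,3)] assms by simp
  also have "\<dots> = laurent_coeff ?\<rho> (\<lambda>z. ?f z *
      (if up (Suc n) then 1 - of_real (inverse (r (Suc n))) / z else 1 - z * of_real (r (Suc n)))) l"
  proof (rule laurent_coeff_cong[OF mid_pos])
    fix z :: complex assume "norm z = ?\<rho>"
    then have e: "alpha S n z = alpha S (Suc n) z *
      (if up (Suc n) then 1 - of_real (inverse (r (Suc n))) / z else 1 - z * of_real (r (Suc n)))"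
      using assms i by (intro alpha_rec) auto
    show "alpha S n z * beta S m z = ?f z *
      (if up (Suc n) then 1 - of_real (inverse (r (Suc n))) / z else 1 - z * of_real (r (Suc n)))"
      unfolding e by (simp only: mult.assoc mult.commute mult.left_commute)
  qed
  finally show ?thesis
    by (simp only: laurent_coeff_mult_if[OF mid_pos cont] eq)
qed

section \<open>Supports and growth of the coefficients\<close>

lemma ckap_same: "ckap S m m l = of_bool (l = 0)"
proof -
  have "ckap S m m l = laurent_coeff (mid m) (\<lambda>z. 1) l"
    unfolding ckap_def
  proof (rule laurent_coeff_cong[OF mid_pos])
    fix z :: complex assume "norm z = mid m"
    then have "PP m z \<noteq> 0" "PM S m z \<noteq> 0"
      by (auto intro!: PP_nonzero PM_nonzero inner_rad_mid outer_rad_mid)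
    then show "alpha S m z * beta S m z = 1" by (simp add: alpha_def beta_def)
  qed
  also have "\<dots> = of_bool (- l - 1 = - 1)"
    unfolding laurent_coeff_def using circ_powi[OF mid_pos] by simp
  finally show ?thesis by simp
qed

text \<open>For \<open>n <= m\<close> the symbol \<open>alpha S n z * beta S m z\<close> is a
  product of \<open>m - n\<close> factors, each of degree one in \<open>z\<close> or in
  \<open>1 / z\<close>; every step of the recursion widens the support by one place.\<close>

lemma ckap_support:
  assumes "n \<le> m" "m \<le> S" "int (m - n) < \<bar>l\<bar>"
  shows "ckap S n m l = 0"
  using assms
proof (induction "m - n" arbitrary: n l)
  case 0
  then show ?case by (auto simp: ckap_same)
next
  case (Suc k)
  then have "n < m" "k = m - Suc n" "Suc n \<le> m" by auto
  moreover have "int (m - Suc n) < \<bar>l\<bar>" "int (m - Suc n) < \<bar>l + 1\<bar>" "int (m - Suc n) < \<bar>l - 1\<bar>"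
    using Suc.prems \<open>n < m\<close> by (auto simp: of_nat_diff)
  ultimately show ?case using Suc.hyps(1)[of "Suc n"] Suc.prems by (simp add: ckap_rec)
qed

text \<open>At time \<open>S\<close> no factor is left in \<open>PM\<close>, so the symbol is
  holomorphic at the origin. Every step back extends the support by at most one place to the
  left.\<close>

lemma ca_support_low:
  assumes "n \<le> S" "l < - int (S - n)"
  shows "ca S n l = 0"
  using assms
proof (induction "S - n" arbitrary: n l)
  case 0
  have n: "n = S" using 0(1,2) by linarith
  have l: "l < 0" using 0(3) n by simp
  \<comment> \<open>All zeros of \<open>PP S\<close> have modulus at least \<open>1 / r S\<close>,
    as \<open>r S\<close> is the largest rate involved.\<close>
  let ?R = "1 / r S"
  have "PM S S z = 1" for z by (simp add: PM_def)
  moreover have "(\<lambda>z. 1 / PP S z) holomorphic_on ball 0 ?R"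
  proof (intro holomorphic_on_divide holomorphic_PP holomorphic_intros)
    fix z :: complex assume z: "z \<in> ball 0 ?R"
    show "PP S z \<noteq> 0"
    proof (cases "z = 0")
      case False
      have "norm z * r i < 1" if "i \<le> S" for i
      proof -
        have "norm z * r i \<le> norm z * r S" using r_le[OF that] by (intro mult_left_mono) auto
        also have "\<dots> < 1" using z r_pos[of S] by (simp add: field_simps)
        finally show ?thesis .
      qed
      then show ?thesis using False by (intro PP_nonzero) (auto simp: inner_rad_def)
    qed (simp add: PP_def)
  qed
  moreover have "mid S < ?R" using mid_mult_less[of S S] r_pos[of S] by (simp add: field_simps)
  ultimately show ?case
    unfolding n ca_def using l by (intro laurent_coeff_disc[OF mid_pos]) (auto simp: alpha_def[abs_def])
next
  case (Suc k)
  then have "n < S" "k = S - Suc n" "Suc n \<le> S" by auto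
  moreover have "l < - int (S - Suc n)" "l + 1 < - int (S - Suc n)" "l - 1 < - int (S - Suc n)"
    using Suc.prems \<open>n < S\<close> by (auto simp: of_nat_diff)
  ultimately show ?case using Suc.hyps(1)[of "Suc n"] by (simp add: ca_rec)
qed

lemma fast_ca: "fast (r (Suc n)) (\<lambda>p. ca S n (int p - c))"
  unfolding ca_def
  by (rule fast_laurent_coeff[OF mid_pos continuous_on_alpha[OF inner_rad_mid] inverse_mid_less]) simp

lemma fast_ca_up:
  assumes "up (Suc n)" shows "fast (r (Suc n)) (\<lambda>p. ca S (Suc n) (int p - c))"
  unfolding laurent_coeff_alpha[OF inner_rad_mid_up[OF assms], symmetric]
  by (rule fast_laurent_coeff[OF mid_pos continuous_on_alpha[OF inner_rad_mid_up[OF assms]] inverse_mid_less])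

lemma fast_ckap:
  assumes "n \<le> m" "m \<le> S" shows "fast (r k) (\<lambda>p. ckap S n m (int p - c))"
proof (rule fast_finite_support[OF r_pos])
  fix p assume "nat (c + int m + 1) \<le> p"
  then have "int (m - n) < \<bar>int p - c\<bar>" by linarith
  then show "ckap S n m (int p - c) = 0" by (rule ckap_support[OF assms])
qed

lemma PM_expansion:
  obtains d :: "nat \<Rightarrow> complex" where "\<And>z. z \<noteq> 0 \<Longrightarrow> PM S n z = (\<Sum>j\<le>S. d j * z powi (- int j))"
proof -
  define I where "I = {i \<in> {Suc n..S}. up i}"
  define P where "P = (\<Prod>i\<in>I. [:1, - of_real (inverse (r i)):] :: complex poly)"
  have "degree P \<le> (\<Sum>i\<in>I. degree [:1, - of_real (inverse (r i)) :: complex:])"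
    unfolding P_def using degree_prod_sum_le[of I "\<lambda>i. [:1, - of_real (inverse (r i)) :: complex:]"]
    by (simp add: I_def o_def)
  also have "\<dots> \<le> (\<Sum>i\<in>I. 1)" by (intro sum_mono) simp
  also have "\<dots> \<le> S"
  proof -
    have "card I \<le> card {1..S}" unfolding I_def by (intro card_mono) auto
    then show ?thesis by simp
  qed
  finally have deg: "degree P \<le> S" .
  have "PM S n z = (\<Sum>j\<le>S. coeff P j * z powi (- int j))" if "z \<noteq> 0" for z
  proof -
    have "PM S n z = poly P (1 / z)"
      by (simp add: PM_def P_def I_def poly_prod)
    also have "\<dots> = (\<Sum>j\<le>degree P. coeff P j * (1 / z) ^ j)" by (rule poly_altdef)
    also have "\<dots> = (\<Sum>j\<le>S. coeff P j * (1 / z) ^ j)"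
      by (rule sum.mono_neutral_left) (use deg in \<open>auto simp: coeff_eq_0\<close>)
    finally show ?thesis
      by (simp add: power_int_minus power_divide inverse_eq_divide)
  qed
  then show ?thesis by (rule that)
qed

text \<open>At time 0 no factor is in \<open>PP\<close>, so the symbol is a polynomial in
  \<open>1 / z\<close> of degree at most \<open>S\<close>. Multiplication by \<open>beta\<close> is
  then a finite convolution, which raises no question of convergence.\<close>

lemma ckap_0_eq_sum:
  "ckap S 0 m l = (\<Sum>j\<le>S. ca S 0 (- int j) * cb S m (- int j - l))"
  and ca_0_support: "0 < l' \<or> l' < - int S \<Longrightarrow> ca S 0 l' = 0"
proof -
  obtain d where d: "\<And>z. z \<noteq> 0 \<Longrightarrow> PM S 0 z = (\<Sum>j\<le>S. d j * z powi (- int j))"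
    using PM_expansion[of S 0] by blast
  have nz: "z \<noteq> 0" if "norm z = mid k" for z :: complex and k using that mid_pos[of k] by auto
  have a0: "alpha S 0 z = (\<Sum>j\<le>S. d j * z powi (- int j))" if "z \<noteq> 0" for z
    using d[OF that] by (simp add: alpha_def PP_def)
  have a: "ca S 0 l = (\<Sum>j\<le>S. d j * of_bool (l = - int j))" for l
  proof -
    have "ca S 0 l = circ (mid 0) (\<lambda>z. \<Sum>j\<le>S. d j * z powi (- int j - l - 1))"
      unfolding ca_def laurent_coeff_def
    proof (rule circ_cong[OF mid_pos])
      fix z :: complex assume "norm z = mid 0"
      note z = nz[OF this]
      show "alpha S 0 z * z powi (- l - 1) = (\<Sum>j\<le>S. d j * z powi (- int j - l - 1))"
      proof -
        have e: "z powi (- int j) * z powi (- l - 1) = z powi (- int j - l - 1)" for j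
          by (rule powi_split[OF z]) simp
        show ?thesis unfolding a0[OF z] sum_distrib_right by (simp only: mult.assoc e)
      qed
    qed
    also have "\<dots> = (\<Sum>j\<le>S. d j * circ (mid 0) (\<lambda>z. z powi (- int j - l - 1)))"
      by (rule circ_sum[OF mid_pos]) (auto intro: continuous_on_sphere_powi mid_pos)
    also have "\<dots> = (\<Sum>j\<le>S. d j * of_bool (l = - int j))"
      unfolding circ_powi[OF mid_pos] by (intro sum.cong refl arg_cong2[where f = "(*)"]) auto
    finally show ?thesis .
  qed
  have ad: "ca S 0 (- int j) = d j" if "j \<le> S" for j
    using that by (simp add: a of_bool_def if_distrib cong: if_cong)
  show "ca S 0 l' = 0" if "0 < l' \<or> l' < - int S"
    unfolding a by (rule sum.neutral) (use that in auto)
  have cont: "continuous_on (sphere 0 (mid 0)) (\<lambda>z. beta S m z * z powi k)" for k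
    by (intro continuous_intros continuous_on_beta outer_rad_mid continuous_on_sphere_powi mid_pos) simp
  have "ckap S 0 m l = circ (mid 0) (\<lambda>z. \<Sum>j\<le>S. d j * (beta S m z * z powi (- (int j + l) - 1)))"
    unfolding ckap_def laurent_coeff_def
  proof (rule circ_cong[OF mid_pos])
    fix z :: complex assume "norm z = mid 0"
    note z = nz[OF this]
    have e: "z powi (- int j) * z powi (- l - 1) = z powi (- (int j + l) - 1)" for j
      by (rule powi_split[OF z]) simp
    have "alpha S 0 z * beta S m z * z powi (- l - 1)
        = (\<Sum>j\<le>S. d j * (beta S m z * (z powi (- int j) * z powi (- l - 1))))"
      unfolding a0[OF z] sum_distrib_right by (intro sum.cong refl) (simp only: mult_ac)
    then show "alpha S 0 z * beta S m z * z powi (- l - 1)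
        = (\<Sum>j\<le>S. d j * (beta S m z * z powi (- (int j + l) - 1)))"
      by (simp only: e)
  qed
  also have "\<dots> = (\<Sum>j\<le>S. d j * circ (mid 0) (\<lambda>z. beta S m z * z powi (- (int j + l) - 1)))"
    by (rule circ_sum[OF mid_pos]) (auto intro: cont)
  also have "\<dots> = (\<Sum>j\<le>S. ca S 0 (- int j) * cb S m (- int j - l))"
  proof (intro sum.cong refl)
    fix j assume "j \<in> {..S}"
    have "circ (mid 0) (\<lambda>z. beta S m z * z powi (- (int j + l) - 1)) = cb S m (- (int j + l))"
      using laurent_coeff_beta[OF outer_rad_mid[of 0 m S], of "int j + l"] by (simp add: laurent_coeff_def)
    then show "d j * circ (mid 0) (\<lambda>z. beta S m z * z powi (- (int j + l) - 1))
        = ca S 0 (- int j) * cb S m (- int j - l)"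
      using ad \<open>j \<in> {..S}\<close> by simp
  qed
  finally show "ckap S 0 m l = (\<Sum>j\<le>S. ca S 0 (- int j) * cb S m (- int j - l))" .
qed

section \<open>The reciprocal symbol at infinity and the double integral\<close>

lemma beta_bound:
  obtains B where "\<And>w. max 1 (2 / r 0) \<le> norm w \<Longrightarrow> norm (beta S n w) \<le> B * norm w ^ n"
proof -
  define I where "I = {i \<in> {1..n}. \<not> up i}"
  define J where "J = {i \<in> {Suc n..S}. up i}"
  have "norm (beta S n w) \<le> ((\<Prod>i\<in>I. 1 + r i) * 2 ^ card J) * norm w ^ n"
    if w: "max 1 (2 / r 0) \<le> norm w" for w
  proof -
    \<comment> \<open>Beyond \<open>2 / r 0\<close> every factor of \<open>PM\<close> has modulus at
      least 1/2, because \<open>r 0\<close> is the smallest rate; beyond 1 every factor of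
      \<open>PP\<close> is bounded by a multiple of \<open>norm w\<close>.\<close>
    have w1: "1 \<le> norm w" and w2: "2 / r 0 \<le> norm w" using w by auto
    have w0: "w \<noteq> 0" using w1 by auto
    have "norm (PP n w) \<le> (\<Prod>i\<in>I. (1 + r i) * norm w)"
      unfolding PP_def I_def[symmetric] prod_norm[symmetric]
    proof (intro prod_mono conjI)
      fix i
      have "norm (1 - w * of_real (r i)) \<le> 1 + norm w * r i"
        using norm_triangle_ineq4[of 1 "w * of_real (r i)"] r_pos[of i] by (simp add: norm_mult)
      also have "\<dots> \<le> (1 + r i) * norm w" using w1 by (simp add: algebra_simps)
      finally show "norm (1 - w * of_real (r i)) \<le> (1 + r i) * norm w" .
    qed simp
    also have "\<dots> = (\<Prod>i\<in>I. 1 + r i) * norm w ^ card I" by (simp add: prod.distrib)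
    also have "\<dots> \<le> (\<Prod>i\<in>I. 1 + r i) * norm w ^ n"
    proof (intro mult_left_mono power_increasing w1 prod_nonneg)
      have "card I \<le> card {1..n}" unfolding I_def by (intro card_mono) auto
      then show "card I \<le> n" by simp
      show "0 \<le> 1 + r i" for i using r_pos[of i] by linarith
    qed
    finally have num: "norm (PP n w) \<le> (\<Prod>i\<in>I. 1 + r i) * norm w ^ n" .
    have "(\<Prod>i\<in>J. 1 / 2 :: real) \<le> norm (PM S n w)"
      unfolding PM_def J_def[symmetric] prod_norm[symmetric]
    proof (intro prod_mono conjI)
      fix i
      have "2 / r i \<le> 2 / r 0" using r_le[of 0 i] r_pos[of 0] by (intro divide_left_mono) auto
      then have "2 / r i \<le> norm w" using w2 by linarith
      moreover have "norm (of_real (inverse (r i)) / w) = inverse (r i) / norm w"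
        unfolding norm_divide norm_of_real using r_pos[of i] by simp
      ultimately have "norm (of_real (inverse (r i)) / w) \<le> 1 / 2"
        using r_pos[of i] w1 by (simp add: field_simps)
      then show "1 / 2 \<le> norm (1 - of_real (inverse (r i)) / w)"
        using norm_triangle_ineq2[of 1 "of_real (inverse (r i)) / w"] by simp
    qed simp
    then have den: "(1 / 2) ^ card J \<le> norm (PM S n w)" by simp
    have "norm (beta S n w) \<le> ((\<Prod>i\<in>I. 1 + r i) * norm w ^ n) / (1 / 2) ^ card J"
      unfolding beta_def norm_divide
      by (rule frac_le[OF order_trans[OF norm_ge_zero num] num _ den]) simp
    then show ?thesis by (simp add: power_divide mult_ac)
  qed
  then show ?thesis by (rule that)
qed

text \<open>Growth of order \<open>n\<close> at infinity excludes powers above \<open>n\<close>; in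
  the reversed index of \<open>cb\<close> these are the values below \<open>- n\<close>.\<close>

lemma cb_support:
  assumes "l < - int n" shows "cb S n l = 0"
proof -
  obtain B where B: "\<And>w. max 1 (2 / r 0) \<le> norm w \<Longrightarrow> norm (beta S n w) \<le> B * norm w ^ n"
    using beta_bound[of S n] by blast
  show ?thesis unfolding cb_def
  proof (rule laurent_coeff_infinity[OF mid_pos open_outer holomorphic_beta])
    show "norm (beta S n w) \<le> B * norm w ^ n" if "max 1 (2 / r 0) \<le> norm w" for w by (rule B[OF that])
    show "w \<in> {w. outer_rad S n (norm w)}" if "mid n \<le> norm w" for w :: complex
      using outer_rad_mono[OF outer_rad_mid[of n n S] that] by simp
  qed (use assms in auto)
qed

text \<open>Expanding \<open>1 / (z - w)\<close> in powers of \<open>z / w\<close> up to order \<open>K\<close> leaves a remainder that decays like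
  \<open>1 / w\<^sup>2\<close>, so that its integral vanishes.\<close>

lemma circ_beta_outside:
  assumes \<rho>: "outer_rad S n \<rho>" and z: "norm z < \<rho>" and K: "l + int n + 1 \<le> int K"
  shows "circ \<rho> (\<lambda>w. beta S n w * w powi l / (z - w)) = - (\<Sum>k<K. z ^ k * cb S n (l - int k))"
proof -
  have pos: "0 < \<rho>" using \<rho> by (simp add: outer_rad_def)
  obtain B where B: "\<And>w. max 1 (2 / r 0) \<le> norm w \<Longrightarrow> norm (beta S n w) \<le> B * norm w ^ n"
    using beta_bound[of S n] by blast
  have B0: "0 \<le> B"
  proof -
    define w :: complex where "w = of_real (max 1 (2 / r 0))"
    have nw: "norm w = max 1 (2 / r 0)" by (simp add: w_def)
    have "0 \<le> B * norm w ^ n" using norm_ge_zero B[of w] nw by (metis order_refl order_trans)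
    moreover have "0 < norm w ^ n" using nw by (intro zero_less_power) simp
    ultimately show ?thesis by (simp only: zero_le_mult_iff) linarith
  qed
  let ?rem = "\<lambda>w. beta S n w * w powi (l - int K) / (z - w)"
  have rem0: "circ \<rho> ?rem = 0"
  proof (rule circ_infinity[where S = "{w :: complex. outer_rad S n (norm w)} \<inter> {w. norm z < norm w}"
        and B = "2 * B" and R = "max (max 1 (2 / r 0)) (2 * norm z)"])
    show "open ({w :: complex. outer_rad S n (norm w)} \<inter> {w. norm z < norm w})"
      by (intro open_Int open_outer open_Collect_less continuous_intros)
    show "?rem holomorphic_on {w. outer_rad S n (norm w)} \<inter> {w. norm z < norm w}"
      by (intro holomorphic_on_divide holomorphic_on_mult holomorphic_on_subset[OF holomorphic_beta]
          holomorphic_on_powi holomorphic_intros) (auto simp: outer_rad_def)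
    fix w :: complex assume w: "max (max 1 (2 / r 0)) (2 * norm z) \<le> norm w"
    have w1: "1 \<le> norm w" "w \<noteq> 0" and wz: "2 * norm z \<le> norm w" using w by auto
    have "norm w / 2 \<le> norm (z - w)"
      using norm_triangle_ineq2[of w z] wz by (simp add: norm_minus_commute)
    then have "norm (?rem w) \<le> (B * norm w ^ n * norm w powi (l - int K)) / (norm w / 2)"
      unfolding norm_divide norm_mult norm_power_int using w w1 B0
      by (intro frac_le mult_mono B) auto
    also have "\<dots> = 2 * B * (norm w powi int n * norm w powi (l - int K) * norm w powi (- 1))"
      using w1 by (simp add: power_int_minus field_simps)
    \<comment> \<open>The lower bound on \<open>K\<close> is chosen to make this exponent at most
      -2.\<close>
    also have "norm w powi int n * norm w powi (l - int K) * norm w powi (- 1) = norm w powi (int n + l - int K - 1)"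
      using w1 by (simp only: powi_split norm_eq_zero not_False_eq_True) (rule arg_cong, simp)
    also have "2 * B * \<dots> \<le> 2 * B * (1 / (norm w)\<^sup>2)"
      using B0 w1 K by (intro mult_left_mono powi_le_inverse_square) auto
    finally show "norm (?rem w) \<le> 2 * B / (norm w)\<^sup>2" by simp
  qed (use pos z outer_rad_mono[OF \<rho>] in auto)
  have contb: "continuous_on (sphere 0 \<rho>) (\<lambda>w. beta S n w * w powi k)" for k
    by (intro continuous_intros continuous_on_beta[OF \<rho>] continuous_on_sphere_powi pos)
  have contr: "continuous_on (sphere 0 \<rho>) ?rem"
    using z by (intro continuous_on_divide contb continuous_intros) auto
  have "circ \<rho> (\<lambda>w. beta S n w * w powi l / (z - w))
      = circ \<rho> (\<lambda>w. (\<Sum>k<K. - (z ^ k) * (beta S n w * w powi (- (int k - l) - 1))) + z ^ K * ?rem w)"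
  proof (rule circ_cong[OF pos])
    fix w :: complex assume "norm w = \<rho>"
    then have w: "w \<noteq> 0" "z \<noteq> w" using pos z by auto
    have "beta S n w * w powi l / (z - w) = beta S n w * w powi l * (1 / (z - w))" by simp
    also have "\<dots> = (\<Sum>k<K. - (z ^ k) * (beta S n w * (w powi l * w powi (- int k - 1))))
        + z ^ K * (beta S n w * (w powi l * w powi (- int K)) / (z - w))"
      by (subst geometric_expansion[OF w, of K]) (simp add: algebra_simps sum_distrib_left)
    also have "(\<Sum>k<K. - (z ^ k) * (beta S n w * (w powi l * w powi (- int k - 1))))
        = (\<Sum>k<K. - (z ^ k) * (beta S n w * w powi (- (int k - l) - 1)))"
      by (intro sum.cong refl) (simp add: powi_split[OF w(1)] algebra_simps)
    also have "w powi l * w powi (- int K) = w powi (l - int K)"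
      by (rule powi_split[OF w(1)]) simp
    finally show "beta S n w * w powi l / (z - w)
        = (\<Sum>k<K. - (z ^ k) * (beta S n w * w powi (- (int k - l) - 1))) + z ^ K * ?rem w" .
  qed
  also have "\<dots> = circ \<rho> (\<lambda>w. \<Sum>k<K. - (z ^ k) * (beta S n w * w powi (- (int k - l) - 1)))
      + circ \<rho> (\<lambda>w. z ^ K * ?rem w)"
    by (rule circ_add[OF pos]) (intro continuous_intros contb contr)+
  also have "circ \<rho> (\<lambda>w. z ^ K * ?rem w) = z ^ K * circ \<rho> ?rem" by (rule circ_lmul[OF pos contr])
  also have "circ \<rho> (\<lambda>w. \<Sum>k<K. - (z ^ k) * (beta S n w * w powi (- (int k - l) - 1)))
      = (\<Sum>k<K. - (z ^ k) * circ \<rho> (\<lambda>w. beta S n w * w powi (- (int k - l) - 1)))"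
    by (rule circ_sum[OF pos]) (auto intro: contb)
  also have "\<dots> = (\<Sum>k<K. - (z ^ k) * cb S n (l - int k))"
    using laurent_coeff_beta[OF \<rho>, of "int _ - l"] by (intro sum.cong refl) (simp add: laurent_coeff_def)
  finally show ?thesis by (simp add: rem0 sum_negf)
qed

text \<open>For \<open>n1 \<le> n2\<close> the circle of \<open>w\<close> lies inside that of \<open>z\<close>; moving it outside produces the residue at
  \<open>w = z\<close>, which integrates to the term \<open>ckap\<close>.\<close>

lemma kernel_integral:
  assumes \<rho>1: "inner_rad n1 \<rho>1" and \<rho>2: "outer_rad S n2 \<rho>2"
    and le: "n1 \<le> n2 \<Longrightarrow> \<rho>2 < \<rho>1" and gt: "n2 < n1 \<Longrightarrow> \<rho>1 < \<rho>2"
    and K: "l2 + int n2 + 1 \<le> int K"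
  shows "circ \<rho>1 (\<lambda>z. alpha S n1 z * z powi (- l1 - 1) *
            circ \<rho>2 (\<lambda>w. beta S n2 w * w powi l2 / (z - w)))
       = (if n1 \<le> n2 then ckap S n1 n2 (l1 - l2) else 0)
         - (\<Sum>k<K. cb S n2 (l2 - int k) * ca S n1 (l1 - int k))"
proof -
  have p1: "0 < \<rho>1" and p2: "0 < \<rho>2" using \<rho>1 \<rho>2 by (auto simp: inner_rad_def outer_rad_def)
  let ?h = "\<lambda>z. if n1 \<le> n2 then beta S n2 z * z powi l2 else 0"
  have inner: "circ \<rho>2 (\<lambda>w. beta S n2 w * w powi l2 / (z - w))
      = ?h z - (\<Sum>k<K. z ^ k * cb S n2 (l2 - int k))" if z: "norm z = \<rho>1" for z
  proof (cases "n1 \<le> n2")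
    case False
    then show ?thesis using circ_beta_outside[OF \<rho>2 _ K, of z] gt z by simp
  next
    case True
    \<comment> \<open>Any radius above \<open>\<rho>1\<close> would serve for the outer circle;
      \<open>\<rho>1 + 1\<close> is a convenient one.\<close>
    have "circ \<rho>2 (\<lambda>w. beta S n2 w * w powi l2 / (z - w))
        = circ (\<rho>1 + 1) (\<lambda>w. beta S n2 w * w powi l2 / (z - w)) + beta S n2 z * z powi l2"
    proof (rule circ_pass_pole[OF p2 _ _ open_outer[of S n2]])
      show "(\<lambda>w. beta S n2 w * w powi l2) holomorphic_on {w. outer_rad S n2 (norm w)}"
        by (intro holomorphic_on_mult holomorphic_beta holomorphic_on_powi) (simp add: outer_rad_def)
    qed (use le[OF True] z outer_rad_mono[OF \<rho>2] in auto)
    then show ?thesis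
      using circ_beta_outside[OF outer_rad_mono[OF \<rho>2] _ K, of "\<rho>1 + 1" z] le[OF True] z True by simp
  qed
  have conta: "continuous_on (sphere 0 \<rho>1) (\<lambda>z. alpha S n1 z * z powi k)" for k
    by (intro continuous_intros continuous_on_alpha[OF \<rho>1] continuous_on_sphere_powi p1)
  have nz: "z \<noteq> 0" if "norm z = \<rho>1" for z :: complex using that p1 by auto
  have "circ \<rho>1 (\<lambda>z. alpha S n1 z * z powi (- l1 - 1) *
            circ \<rho>2 (\<lambda>w. beta S n2 w * w powi l2 / (z - w)))
      = circ \<rho>1 (\<lambda>z. alpha S n1 z * z powi (- l1 - 1) * ?h z
          - (\<Sum>k<K. cb S n2 (l2 - int k) * (alpha S n1 z * z powi (- (l1 - int k) - 1))))"
  proof (rule circ_cong[OF p1])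
    fix z :: complex assume z: "norm z = \<rho>1"
    have e: "z powi (- l1 - 1) * z ^ k = z powi (- (l1 - int k) - 1)" for k
      using powi_split[OF nz[OF z], of "- l1 - 1" "int k" "- (l1 - int k) - 1"] by simp
    show "alpha S n1 z * z powi (- l1 - 1) * circ \<rho>2 (\<lambda>w. beta S n2 w * w powi l2 / (z - w))
        = alpha S n1 z * z powi (- l1 - 1) * ?h z
          - (\<Sum>k<K. cb S n2 (l2 - int k) * (alpha S n1 z * z powi (- (l1 - int k) - 1)))"
      unfolding inner[OF z] right_diff_distrib sum_distrib_left
      by (intro arg_cong2[where f = "(-)"] refl sum.cong)
        (simp only: e[symmetric] mult_ac)
  qed
  also have "\<dots> = circ \<rho>1 (\<lambda>z. alpha S n1 z * z powi (- l1 - 1) * ?h z)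
      - circ \<rho>1 (\<lambda>z. \<Sum>k<K. cb S n2 (l2 - int k) * (alpha S n1 z * z powi (- (l1 - int k) - 1)))"
  proof (rule circ_diff[OF p1])
    show "continuous_on (sphere 0 \<rho>1) (\<lambda>z. alpha S n1 z * z powi (- l1 - 1) * ?h z)"
    proof (cases "n1 \<le> n2")
      case True
      then have "outer_rad S n2 \<rho>1" using outer_rad_mono[OF \<rho>2] le by simp
      then show ?thesis
        using True by (simp) (intro continuous_intros conta continuous_on_beta continuous_on_sphere_powi p1)
    qed simp
    show "continuous_on (sphere 0 \<rho>1) (\<lambda>z. \<Sum>k<K. cb S n2 (l2 - int k) *
        (alpha S n1 z * z powi (- (l1 - int k) - 1)))"
      by (intro continuous_intros conta)
  qed
  also have "circ \<rho>1 (\<lambda>z. \<Sum>k<K. cb S n2 (l2 - int k) * (alpha S n1 z * z powi (- (l1 - int k) - 1)))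
      = (\<Sum>k<K. cb S n2 (l2 - int k) * circ \<rho>1 (\<lambda>z. alpha S n1 z * z powi (- (l1 - int k) - 1)))"
    by (rule circ_sum[OF p1]) (auto intro: conta)
  also have "\<dots> = (\<Sum>k<K. cb S n2 (l2 - int k) * ca S n1 (l1 - int k))"
    unfolding laurent_coeff_alpha[OF \<rho>1, symmetric] laurent_coeff_def by (rule refl)
  also have "circ \<rho>1 (\<lambda>z. alpha S n1 z * z powi (- l1 - 1) * ?h z)
      = (if n1 \<le> n2 then ckap S n1 n2 (l1 - l2) else 0)"
  proof (cases "n1 \<le> n2")
    case True
    then have o: "outer_rad S n2 \<rho>1" using outer_rad_mono[OF \<rho>2] le by simp
    have "circ \<rho>1 (\<lambda>z. alpha S n1 z * z powi (- l1 - 1) * ?h z)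
        = laurent_coeff \<rho>1 (\<lambda>z. alpha S n1 z * beta S n2 z) (l1 - l2)"
      unfolding laurent_coeff_def
    proof (rule circ_cong[OF p1])
      fix z :: complex assume "norm z = \<rho>1"
      then have e: "z powi (- l1 - 1) * z powi l2 = z powi (- (l1 - l2) - 1)"
        by (intro powi_split nz) auto
      show "alpha S n1 z * z powi (- l1 - 1) * ?h z
          = alpha S n1 z * beta S n2 z * z powi (- (l1 - l2) - 1)"
        using True by (simp only: if_True e[symmetric] mult_ac)
    qed
    then show ?thesis using laurent_coeff_alpha_beta[OF \<rho>1 o True] True by simp
  next
    case False
    then show ?thesis by (simp add: circ_def)
  qed
  finally show ?thesis .
qed

end

section \<open>The correlation kernel and path expansion\<close>

lemma tendsto_dt:
  fixes f :: "'b \<Rightarrow> nat \<Rightarrow> nat \<Rightarrow> complex"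
  assumes "\<And>i j. i < n \<Longrightarrow> j < n \<Longrightarrow> ((\<lambda>x. f x i j) \<longlongrightarrow> h i j) F"
  shows "((\<lambda>x. dt n (f x)) \<longlongrightarrow> dt n h) F"
  unfolding dt_eq_sum
proof (intro tendsto_intros)
  fix p i assume "p \<in> {p. p permutes {0..<n}}" "i \<in> {0..<n}"
  then show "((\<lambda>x. f x i (p i)) \<longlongrightarrow> h i (p i)) F"
    by (intro assms) (auto simp: permutes_less_iff)
qed

section \<open>Solutions of the Gram systems and the kernel\<close>

context transfer
begin

text \<open>The part \<open>c >= M\<close> of the convolution of the two coefficient sequences. For
  \<open>m2 <= S\<close> the upper limit loses nothing, since \<open>cb\<close> vanishes for
  \<open>c\<close> beyond \<open>p2 + m2\<close>.\<close>

definition phi :: "nat \<Rightarrow> nat \<Rightarrow> nat \<Rightarrow> nat \<Rightarrow> nat \<Rightarrow> nat \<Rightarrow> complex" where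
  "phi S M m2 p2 m x = (\<Sum>c\<in>{M..p2 + S}. cb S m2 (int p2 - int c) * ca S m (int x - int c))"

definition corr_kernel :: "nat \<Rightarrow> nat \<Rightarrow> nat \<Rightarrow> nat \<Rightarrow> nat \<Rightarrow> nat \<Rightarrow> complex" where
  "corr_kernel S M m1 p1 m2 p2 =
     (if m1 \<le> m2 then ckap S m1 m2 (int p1 - int p2) else 0) - phi S M m2 p2 m1 p1"

lemma fast_phi: "fast (r (Suc m)) (phi S M m2 p2 m)"
  unfolding phi_def[abs_def] by (intro fast_sum fast_scale fast_ca r_pos)

text \<open>The shifts satisfy \<open>c >= M >= S\<close>, which puts position -1 below the support
  of each shifted coefficient sequence. Truncation to natural positions is therefore
  harmless.\<close>

lemma step_phi:
  assumes "m < S" "S \<le> M"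
  shows "step (Suc m) (phi S M m2 p2 m) = phi S M m2 p2 (Suc m)"
proof -
  have "step (Suc m) (\<lambda>x. ca S m (int x - int c)) = (\<lambda>x. ca S (Suc m) (int x - int c))"
    if "c \<in> {M..p2 + S}" for c
    by (rule step_shifted[OF ca_rec[OF assms(1)]])
       (use that assms in \<open>auto intro: ca_support_low fast_ca_up\<close>)
  then show ?thesis
    unfolding phi_def[abs_def] by (subst step_sum) (auto intro: fast_ca)
qed

text \<open>The condition \<open>S <= p2\<close> keeps the finite support around \<open>p2\<close>
  within the natural positions.\<close>

lemma step_ckap:
  assumes "m < m2" "m2 \<le> S" "S \<le> p2"
  shows "step (Suc m) (\<lambda>x. ckap S m m2 (int x - int p2)) = (\<lambda>x. ckap S (Suc m) m2 (int x - int p2))"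
proof (rule step_shifted[OF ckap_rec[OF assms(1,2)]])
  show "ckap S (Suc m) m2 (- 1 - int p2) = 0"
    using assms by (intro ckap_support) auto
  show "fast (r (Suc m)) (\<lambda>x. ckap S (Suc m) m2 (int x - int p2))"
    using assms by (intro fast_ckap) auto
qed

text \<open>At time 0 only shifts \<open>c >= x\<close> contribute. For \<open>x >= M\<close> the
  cut at \<open>M\<close> thus removes nothing and the whole convolution remains, so that
  \<open>ckap - phi\<close> vanishes there, as the Gram system demands.\<close>

lemma phi_0_eq_ckap:
  assumes "m2 \<le> S" "M \<le> x"
  shows "phi S M m2 p2 0 x = ckap S 0 m2 (int x - int p2)"
proof -
  let ?f = "\<lambda>c. cb S m2 (int p2 - int c) * ca S 0 (int x - int c)"
  have z1: "?f c = 0" if "c < x \<or> x + S < c" for c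
    using ca_0_support[of "int x - int c" S] that by auto
  have z2: "?f c = 0" if "p2 + S < c" for c
    using cb_support[of "int p2 - int c" m2 S] that assms by auto
  have "phi S M m2 p2 0 x = (\<Sum>c\<in>{M..p2 + S} \<union> {x..x + S}. ?f c)"
    unfolding phi_def
  proof (rule sum.mono_neutral_left)
    show "\<forall>c\<in>({M..p2 + S} \<union> {x..x + S}) - {M..p2 + S}. ?f c = 0"
    proof
      fix c assume "c \<in> ({M..p2 + S} \<union> {x..x + S}) - {M..p2 + S}"
      then have "p2 + S < c" using assms(2) by auto
      then show "?f c = 0" by (rule z2)
    qed
  qed auto
  also have "\<dots> = (\<Sum>c\<in>{x..x + S}. ?f c)"
  proof (rule sum.mono_neutral_right)
    show "\<forall>c\<in>({M..p2 + S} \<union> {x..x + S}) - {x..x + S}. ?f c = 0"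
    proof
      fix c assume "c \<in> ({M..p2 + S} \<union> {x..x + S}) - {x..x + S}"
      then have "c < x \<or> x + S < c" by auto
      then show "?f c = 0" by (rule z1)
    qed
  qed auto
  also have "\<dots> = (\<Sum>j\<le>S. ?f (x + j))"
    using sum.shift_bounds_cl_nat_ivl[of ?f 0 x S] by (simp add: add.commute atLeast0AtMost)
  also have "\<dots> = (\<Sum>j\<le>S. ca S 0 (- int j) * cb S m2 (- int j - (int x - int p2)))"
    by (intro sum.cong refl) (simp add: algebra_simps)
  finally show ?thesis by (simp only: ckap_0_eq_sum)
qed

lemma dt_prop_inf_eq_kernel:
  fixes \<tau> p :: "nat \<Rightarrow> nat" and s :: complex
  assumes \<tau>: "\<And>a. a < N \<Longrightarrow> 0 < \<tau> a \<and> \<tau> a \<le> S" and p: "\<And>a. a < N \<Longrightarrow> S \<le> p a" and M: "S \<le> M"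
  shows "dt M (\<lambda>i k. prop_inf (\<lambda>m x. 1 + s * (\<Sum>a<N. of_bool (\<tau> a = m \<and> p a = x))) (unit_vec_at k) S i)
       = dt M (\<lambda>i k. evolve 0 S (unit_vec_at k) i) *
         dt N (\<lambda>a b. (if a = b then 1 else 0) + s * corr_kernel S M (\<tau> a) (p a) (\<tau> b) (p b))"
proof -
  define \<phi> where "\<phi> b = phi S M (\<tau> b) (p b)" for b
  \<comment> \<open>The complementary part of the convolution, that of the shifts
    \<open>c < M\<close>.\<close>
  define \<psi> where "\<psi> b m x = ckap S m (\<tau> b) (int x - int (p b)) - \<phi> b m x" for b m x
  have step\<psi>: "step (Suc m) (\<psi> b m) = \<psi> b (Suc m)" if "b < N" "m < \<tau> b" for b m
  proof -
    have b: "\<tau> b \<le> S" "m < S" "S \<le> p b" using \<tau>[OF that(1)] p[OF that(1)] that(2) by auto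
    have "step (Suc m) (\<lambda>x. ckap S m (\<tau> b) (int x - int (p b)) + (- 1) * \<phi> b m x)
        = (\<lambda>x. step (Suc m) (\<lambda>x. ckap S m (\<tau> b) (int x - int (p b))) x
             + step (Suc m) (\<lambda>x. (- 1) * \<phi> b m x) x)"
      unfolding \<phi>_def using that b
      by (intro step_add fast_ckap fast_scale fast_phi) auto
    also have "step (Suc m) (\<lambda>x. (- 1) * \<phi> b m x) = (\<lambda>x. (- 1) * step (Suc m) (\<phi> b m) x)"
      unfolding \<phi>_def by (rule step_scale[OF fast_phi])
    also have "step (Suc m) (\<phi> b m) = \<phi> b (Suc m)" unfolding \<phi>_def by (rule step_phi[OF b(2) M])
    also have "step (Suc m) (\<lambda>x. ckap S m (\<tau> b) (int x - int (p b)))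
        = (\<lambda>x. ckap S (Suc m) (\<tau> b) (int x - int (p b)))"
      by (rule step_ckap[OF that(2) b(1,3)])
    finally show ?thesis by (simp add: \<psi>_def[abs_def])
  qed
  have "dt M (\<lambda>i k. prop_inf (\<lambda>m x. 1 + s * (\<Sum>a<N. of_bool (\<tau> a = m \<and> p a = x))) (unit_vec_at k) S i)
       = dt M (\<lambda>i k. evolve 0 S (unit_vec_at k) i) *
         dt N (\<lambda>a b. (if a = b then 1 else 0) + s *
           (if \<tau> a \<le> \<tau> b then \<psi> b (\<tau> a) (p a) else - \<phi> b (\<tau> a) (p a)))"
  proof (rule eynard_mehta[OF \<tau>])
    show "\<psi> b 0 x = 0" if "b < N" "M \<le> x" for b x
      using phi_0_eq_ckap[of "\<tau> b" S M x "p b"] \<tau>[OF that(1)] that(2) by (simp add: \<psi>_def \<phi>_def)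
    show "evolve 0 m (\<psi> b 0) = \<psi> b m" if "b < N" "m \<le> \<tau> b" for b m
      using that(2) by (induction m) (auto simp: step\<psi>[OF that(1)])
    show "\<psi> b (\<tau> b) x = unit_vec_at (p b) x - \<phi> b (\<tau> b) x" for b x
      by (simp add: \<psi>_def ckap_same unit_vec_at_def)
    show "fast (r (Suc (\<tau> b))) (\<phi> b (\<tau> b))" for b unfolding \<phi>_def by (rule fast_phi)
    show "evolve (\<tau> b) k (\<phi> b (\<tau> b)) = \<phi> b (\<tau> b + k)" if "\<tau> b + k \<le> S" for b k
      using that unfolding \<phi>_def by (induction k) (auto simp: step_phi[OF _ M])
    \<comment> \<open>At the last time only shifts \<open>c <= x\<close> contribute, while all
      shifts in \<open>phi\<close> are at least \<open>M\<close>.\<close>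
    show "\<phi> b S x = 0" if "x < M" for b x
      unfolding \<phi>_def phi_def
      by (rule sum.neutral) (use that ca_support_low[of S S] in auto)
  qed
  also have "(\<lambda>a b. (if a = b then 1 else 0) + s *
           (if \<tau> a \<le> \<tau> b then \<psi> b (\<tau> a) (p a) else - \<phi> b (\<tau> a) (p a)))
      = (\<lambda>a b. (if a = b then 1 else 0) + s * corr_kernel S M (\<tau> a) (p a) (\<tau> b) (p b))"
    by (intro ext) (simp add: \<psi>_def \<phi>_def corr_kernel_def)
  finally show ?thesis .
qed

text \<open>Writing \<open>c = M + k\<close> turns the sum in \<open>phi\<close> into the one
  produced by the geometric expansion of \<open>1 / (z - w)\<close>; subtracting \<open>M\<close>
  turns positions back into the exponents of the kernel.\<close>

lemma corr_kernel_eq_integral: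
  assumes "inner_rad m1 \<rho>1" "outer_rad S m2 \<rho>2" "m2 \<le> S"
    and "m1 \<le> m2 \<Longrightarrow> \<rho>2 < \<rho>1" "m2 < m1 \<Longrightarrow> \<rho>1 < \<rho>2"
  shows "corr_kernel S M m1 p1 m2 p2 =
     circ \<rho>1 (\<lambda>z. alpha S m1 z * z powi (- (int p1 - int M) - 1) *
       circ \<rho>2 (\<lambda>w. beta S m2 w * w powi (int p2 - int M) / (z - w)))"
proof -
  \<comment> \<open>The truncated subtraction agrees with the range of \<open>c\<close>: for
    \<open>p2 + S < M\<close> both sums are empty.\<close>
  let ?K = "p2 + S + 1 - M"
  have "phi S M m2 p2 m1 p1
      = (\<Sum>k<?K. cb S m2 (int p2 - int M - int k) * ca S m1 (int p1 - int M - int k))"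
  proof -
    have "phi S M m2 p2 m1 p1
        = (\<Sum>k<?K. cb S m2 (int p2 - int (M + k)) * ca S m1 (int p1 - int (M + k)))"
      unfolding phi_def by (rule sum.reindex_bij_witness[of _ "\<lambda>k. M + k" "\<lambda>c. c - M"]) auto
    then show ?thesis by (simp only: of_nat_add diff_diff_eq)
  qed
  moreover have "int p2 - int M + int m2 + 1 \<le> int ?K" using assms(3) by linarith
  ultimately show ?thesis
    unfolding corr_kernel_def
    using kernel_integral[OF assms(1,2,4,5), of "int p2 - int M" ?K "int p1 - int M"] by simp
qed

section \<open>One-step determinants and sums over interlacing chains\<close>

lemma dt_T:
  assumes P: "strict_mono_on {..<M} P" and Q: "strict_mono_on {..<M} Q"
  shows "dt M (\<lambda>j k. T i (P j) (Q k))
       = of_bool (if up i then interlaced M P Q else interlaced M Q P) *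
         of_real ((\<Prod>j<M. r i ^ P j) / (\<Prod>j<M. r i ^ Q j))"
proof -
  define E where "E j k = (if (if up i then P j \<le> Q k else Q k \<le> P j) then 1 else 0 :: complex)" for j k
  have "dt M (\<lambda>j k. T i (P j) (Q k))
      = dt M (\<lambda>j k. of_real (r i ^ P j) * of_real (inverse (r i ^ Q k)) * E j k)"
    by (rule dt_cong) (simp add: T_def E_def divide_inverse)
  also have "\<dots> = (\<Prod>j<M. of_real (r i ^ P j)) * (\<Prod>j<M. of_real (inverse (r i ^ Q j))) * dt M E"
    by (rule dt_scale)
  also have "dt M E = of_bool (if up i then interlaced M P Q else interlaced M Q P)"
  proof (cases "up i")
    case True
    then show ?thesis using dt_interlaced[OF P Q] by (simp add: E_def[abs_def])
  next
    case False
    then have "dt M E = dt M (\<lambda>j k. if Q j \<le> P k then 1 else 0)"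
      by (subst dt_transpose[symmetric]) (simp add: E_def[abs_def])
    then show ?thesis using dt_interlaced[OF Q P] False by simp
  qed
  finally show ?thesis
    by (simp add: divide_inverse prod_inversef[symmetric] mult_ac)
qed

definition chain_ok :: "nat \<Rightarrow> nat \<Rightarrow> (nat \<Rightarrow> nat \<Rightarrow> nat) \<Rightarrow> bool" where
  "chain_ok M S c \<longleftrightarrow> (\<forall>i<S. if up (Suc i) then interlaced M (c (Suc i)) (c i) else interlaced M (c i) (c (Suc i)))"

text \<open>Both ends are the packed positions \<open>0, ..., M - 1\<close>, the tuple of the empty
  partition.\<close>

definition closed_chain :: "nat \<Rightarrow> nat \<Rightarrow> (nat \<Rightarrow> nat \<Rightarrow> nat) \<Rightarrow> nat \<Rightarrow> nat \<Rightarrow> nat" where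
  "closed_chain M S c = c(0 := restrict id {..<M}, S := restrict id {..<M})"

lemma incr_tuples_id: "M \<le> L \<Longrightarrow> restrict id {..<M} \<in> incr_tuples M {..<L}"
  by (auto simp: incr_tuples_def strict_mono_on_def)

lemma closed_chain_in:
  assumes "c \<in> {1..n} \<rightarrow>\<^sub>E incr_tuples M {..<L}" "M \<le> L" "i \<le> Suc n"
  shows "closed_chain M (Suc n) c i \<in> incr_tuples M {..<L}"
  using assms incr_tuples_id[of M L] by (cases "i = 0"; cases "i = Suc n") (auto simp: closed_chain_def)

lemma dt_prop_fin_T:
  assumes "M \<le> L"
  shows "dt M (\<lambda>j k. prop_fin T g {..<L} (unit_vec_at k) (Suc n) j)
       = (\<Sum>c\<in>{c \<in> {1..n} \<rightarrow>\<^sub>E incr_tuples M {..<L}. chain_ok M (Suc n) (closed_chain M (Suc n) c)}.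
           (\<Prod>i<Suc n. \<Prod>j<M. g (Suc i) (closed_chain M (Suc n) c (Suc i) j)) *
           of_real (\<Prod>i<Suc n. (\<Prod>j<M. r (Suc i) ^ closed_chain M (Suc n) c (Suc i) j) /
                                (\<Prod>j<M. r (Suc i) ^ closed_chain M (Suc n) c i j)))"
proof -
  let ?id = "restrict id {..<M} :: nat \<Rightarrow> nat"
  let ?C = "closed_chain M (Suc n)"
  let ?PE = "{1..n} \<rightarrow>\<^sub>E incr_tuples M {..<L}"
  let ?w = "\<lambda>c. (\<Prod>i<Suc n. \<Prod>j<M. g (Suc i) (?C c (Suc i) j)) *
           of_real (\<Prod>i<Suc n. (\<Prod>j<M. r (Suc i) ^ ?C c (Suc i) j) / (\<Prod>j<M. r (Suc i) ^ ?C c i j))"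
  have "dt M (\<lambda>j k. prop_fin T g {..<L} (unit_vec_at k) (Suc n) j)
      = dt M (\<lambda>j k. prop_fin T g {..<L} (unit_vec_at (?id k)) (Suc n) (?id j))"
    by (rule dt_cong) simp
  also have "\<dots> = (\<Sum>c\<in>?PE. \<Prod>i<Suc n. step_weight M T g (Suc i) (?C c (Suc i)) (?C c i))"
    unfolding closed_chain_def
    by (rule dt_prop_fin_eq_sum_chains[OF finite_lessThan incr_tuples_id[OF assms] incr_tuples_id[OF assms]])
  also have "\<dots> = (\<Sum>c\<in>?PE. of_bool (chain_ok M (Suc n) (?C c)) * ?w c)"
  proof (rule sum.cong[OF refl])
    fix c assume c: "c \<in> ?PE"
    let ?ok = "\<lambda>i. if up (Suc i) then interlaced M (?C c (Suc i)) (?C c i) else interlaced M (?C c i) (?C c (Suc i))"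
    have sm: "strict_mono_on {..<M} (?C c i)" if "i \<le> Suc n" for i
      using closed_chain_in[OF c assms that] by (simp add: incr_tuples_def)
    have "(\<Prod>i<Suc n. step_weight M T g (Suc i) (?C c (Suc i)) (?C c i))
        = (\<Prod>i<Suc n. (\<Prod>j<M. g (Suc i) (?C c (Suc i) j)) * (of_bool (?ok i) *
            of_real ((\<Prod>j<M. r (Suc i) ^ ?C c (Suc i) j) / (\<Prod>j<M. r (Suc i) ^ ?C c i j))))"
      unfolding step_weight_def
      by (intro prod.cong refl arg_cong2[where f = "(*)"] dt_T sm) auto
    also have "\<dots> = (\<Prod>i<Suc n. of_bool (?ok i)) * ?w c"
      by (simp only: prod.distrib of_real_prod mult_ac)
    also have "(\<Prod>i<Suc n. of_bool (?ok i)) = (of_bool (chain_ok M (Suc n) (?C c)) :: complex)"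
    proof (cases "chain_ok M (Suc n) (?C c)")
      case True
      then have "?ok i" if "i < Suc n" for i using that unfolding chain_ok_def by blast
      then show ?thesis using True by (simp add: prod.neutral del: prod.lessThan_Suc)
    next
      case False
      then obtain i where "i < Suc n" "\<not> ?ok i" unfolding chain_ok_def by blast
      then have "(\<Prod>i<Suc n. of_bool (?ok i)) = (0 :: complex)"
        by (intro prod_zero bexI[of _ i]) simp_all
      then show ?thesis using False by simp
    qed
    finally show "(\<Prod>i<Suc n. step_weight M T g (Suc i) (?C c (Suc i)) (?C c i))
        = of_bool (chain_ok M (Suc n) (?C c)) * ?w c" .
  qed
  also have "\<dots> = (\<Sum>c\<in>{c \<in> ?PE. chain_ok M (Suc n) (?C c)}. ?w c)"
    by (rule sum.mono_neutral_cong_right) (auto intro!: finite_PiE finite_incr_tuples)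
  finally show ?thesis .
qed

text \<open>Summation by parts in multiplicative form: the two powers with exponent
  \<open>s i\<close>, one from each adjacent step, combine to the ratio of consecutive rates, which
  later becomes the weight \<open>q\<close> of a time.\<close>

lemma prod_ratio_powers:
  assumes "s 0 = 0"
  shows "(\<Prod>i<Suc n. r (Suc i) ^ s (Suc i) / r (Suc i) ^ s i)
       = (\<Prod>i\<in>{1..n}. (r i / r (Suc i)) ^ s i) * r (Suc n) ^ s (Suc n)"
proof (induction n)
  case 0
  then show ?case using assms by simp
next
  case (Suc n)
  have "r k \<noteq> 0" for k using r_pos[of k] by simp
  then show ?case
    by (subst prod.lessThan_Suc) (simp only: Suc.IH, simp add: power_divide)
qed

end

section \<open>The Schur process\<close>

text \<open>Connects the determinant of matrices indexed by a finite type, as in the statement, with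
  the one indexed by numbers. The enumeration \<open>h\<close> transports permutations together with
  their signs.\<close>

lemma det_eq_dt:
  fixes K :: "'n::finite \<Rightarrow> 'n \<Rightarrow> complex"
  assumes h: "bij_betw h {0..<CARD('n)} UNIV"
  shows "Determinants.det (\<chi> a b. K a b) = dt (CARD('n)) (\<lambda>i j. K (h i) (h j))"
proof -
  let ?N = "CARD('n)"
  let ?m = "map_permutation {0..<?N} h"
  have inj: "inj_on h {0..<?N}" using h by (rule bij_betw_imp_inj_on)
  have bij: "bij_betw ?m {p. p permutes {0..<?N}} {p. p permutes UNIV}"
  proof (rule bij_betw_byWitness[where f' = "map_permutation UNIV (inv_into {0..<?N} h)"])
    have h': "bij_betw (inv_into {0..<?N} h) UNIV {0..<?N}" by (rule bij_betw_inv_into[OF h])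
    show "\<forall>p\<in>{p. p permutes {0..<?N}}. map_permutation UNIV (inv_into {0..<?N} h) (?m p) = p"
      using map_permutation_compose_inv[OF h] inv_into_f_f[OF inj] by blast
    show "\<forall>p\<in>{p. p permutes UNIV}. ?m (map_permutation UNIV (inv_into {0..<?N} h) p) = p"
      using map_permutation_compose_inv[OF h', of _ h] f_inv_into_f[of _ h "{0..<?N}"] h
      by (auto simp: bij_betw_def)
    show "?m ` {p. p permutes {0..<?N}} \<subseteq> {p. p permutes UNIV}"
      using map_permutation_permutes[OF h] by blast
    show "map_permutation UNIV (inv_into {0..<?N} h) ` {p. p permutes UNIV} \<subseteq> {p. p permutes {0..<?N}}"
      using map_permutation_permutes[OF h'] by blast
  qed
  have "Determinants.det (\<chi> a b. K a b)
      = (\<Sum>p | p permutes (UNIV :: 'n set). of_int (sign p) * (\<Prod>a\<in>UNIV. K a (p a)))"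
    by (simp add: Determinants.det_def)
  also have "\<dots> = (\<Sum>p | p permutes {0..<?N}. of_int (sign (?m p)) * (\<Prod>a\<in>UNIV. K a (?m p a)))"
    by (rule sum.reindex_bij_betw[OF bij, symmetric])
  also have "\<dots> = (\<Sum>p | p permutes {0..<?N}. of_int (sign p) * (\<Prod>i = 0..<?N. K (h i) (h (p i))))"
  proof (rule sum.cong[OF refl])
    fix p assume "p \<in> {p. p permutes {0..<?N}}"
    then have p: "p permutes {0..<?N}" by simp
    have "(\<Prod>a\<in>UNIV. K a (?m p a)) = (\<Prod>i = 0..<?N. K (h i) (?m p (h i)))"
      by (rule prod.reindex_bij_betw[OF h, symmetric])
    also have "\<dots> = (\<Prod>i = 0..<?N. K (h i) (h (p i)))"
      by (intro prod.cong refl) (simp add: map_permutation_apply[OF inj])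
    finally show "of_int (sign (?m p)) * (\<Prod>a\<in>UNIV. K a (?m p a))
        = of_int (sign p) * (\<Prod>i = 0..<?N. K (h i) (h (p i)))"
      using sign_map_permutation[OF inj p] by simp
  qed
  finally show ?thesis by (simp add: dt_eq_sum)
qed

text \<open>For nonnegative terms the limit along one exhausting sequence of finite sets bounds all
  finite sums, so summability comes out as a conclusion.\<close>

lemma has_sum_exhaustion:
  fixes f :: "'b \<Rightarrow> real"
  assumes nonneg: "\<And>x. x \<in> A \<Longrightarrow> 0 \<le> f x"
    and fin: "\<And>L. finite (C L)" and sub: "\<And>L. C L \<subseteq> A"
    and exh: "\<And>F. finite F \<Longrightarrow> F \<subseteq> A \<Longrightarrow> \<forall>\<^sub>F L in sequentially. F \<subseteq> C L"
    and lim: "(\<lambda>L. sum f (C L)) \<longlonglongrightarrow> l"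
  shows "(f has_sum l) A"
proof -
  have bd: "sum f F \<le> l" if F: "finite F" "F \<subseteq> A" for F
  proof (rule tendsto_lowerbound[OF lim])
    show "\<forall>\<^sub>F L in sequentially. sum f F \<le> sum f (C L)"
      using exh[OF F]
    proof eventually_elim
      case (elim L)
      show ?case by (rule sum_mono2[OF fin elim]) (use sub nonneg in auto)
    qed
  qed simp
  have summ: "f summable_on A"
    by (rule nonneg_bdd_above_summable_on[OF nonneg]) (auto intro!: bdd_aboveI2 bd)
  have "infsum f A \<le> l" by (rule infsum_le_finite_sums[OF summ bd])
  moreover have "l \<le> infsum f A"
    by (rule tendsto_upperbound[OF lim])
       (use fin sub nonneg summ in \<open>auto intro!: always_eventually finite_sum_le_infsum\<close>)
  ultimately show ?thesis using has_sum_infsum[OF summ] by simp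
qed

text \<open>Injectivity of \<open>f\<close> makes each factor either 1 or \<open>1 + s\<close>;
  injectivity of \<open>key\<close> lets the occupied marks be counted instead of the occupied
  keys.\<close>

lemma prod_marked_points:
  fixes s :: "'b::comm_ring_1"
  assumes A: "finite A" "inj_on f A" and Y: "finite Y" "inj_on key Y"
  shows "(\<Prod>y\<in>Y. 1 + s * (\<Sum>a\<in>A. of_bool (f a = key y))) = (1 + s) ^ card {a \<in> A. f a \<in> key ` Y}"
proof -
  have image_filter: "B \<inter> f ` A = f ` {a \<in> A. f a \<in> B}" for B by blast
  have "(\<Sum>a\<in>A. of_bool (f a = key y)) = (of_bool (key y \<in> f ` A) :: 'b)" for y
  proof (cases "key y \<in> f ` A")
    case True
    then obtain a where a: "a \<in> A" "f a = key y" by auto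
    have "(\<Sum>a\<in>A. of_bool (f a = key y)) = (\<Sum>b\<in>{a}. 1 :: 'b)"
      by (rule sum.mono_neutral_cong_right) (use A a in \<open>auto simp: inj_on_def\<close>)
    then show ?thesis using True by simp
  next
    case False
    then have "f a \<noteq> key y" if "a \<in> A" for a using that by (metis imageI)
    then have "(\<Sum>a\<in>A. of_bool (f a = key y)) = (0 :: 'b)" by (intro sum.neutral) auto
    then show ?thesis using False by simp
  qed
  then have "(\<Prod>y\<in>Y. 1 + s * (\<Sum>a\<in>A. of_bool (f a = key y))) = (\<Prod>y\<in>Y. if key y \<in> f ` A then 1 + s else 1)"
    by (intro prod.cong) auto
  also have "\<dots> = (\<Prod>y\<in>{y \<in> Y. key y \<in> f ` A}. 1 + s)"
    by (rule prod.inter_filter[OF Y(1), symmetric])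
  also have "\<dots> = (1 + s) ^ card {y \<in> Y. key y \<in> f ` A}" by simp
  also have "card {y \<in> Y. key y \<in> f ` A} = card (key ` {y \<in> Y. key y \<in> f ` A})"
    by (rule card_image[symmetric]) (use Y in \<open>auto intro: inj_on_subset\<close>)
  also have "key ` {y \<in> Y. key y \<in> f ` A} = key ` Y \<inter> f ` A" by blast
  also have "\<dots> = f ` {a \<in> A. f a \<in> key ` Y}" by (rule image_filter)
  also have "card \<dots> = card {a \<in> A. f a \<in> key ` Y}"
    by (rule card_image) (use A in \<open>auto intro: inj_on_subset\<close>)
  finally show ?thesis .
qed

section \<open>The model in reversed time\<close>

locale schur_model =
  fixes N :: nat and u v :: "nat \<Rightarrow> int" and q :: "int \<Rightarrow> real"
  assumes model: "model_ok N u v q"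
begin

lemma v_between: "i \<in> {1..N} \<Longrightarrow> u (i - 1) < v i \<and> v i < u i"
  using model by (simp add: model_ok_def)

lemma q_bounds: "u 0 < t \<Longrightarrow> t < u N \<Longrightarrow> 0 < q t \<and> q t < 1"
  using model by (simp add: model_ok_def)

lemma u_mono: "i \<le> j \<Longrightarrow> j \<le> N \<Longrightarrow> u i \<le> u j"
proof (induction j rule: nat_induct)
  case (Suc j)
  show ?case
  proof (cases "i = Suc j")
    case False
    then have "u i \<le> u j" using Suc by auto
    moreover have "u j < u (Suc j)" using v_between[of "Suc j"] Suc.prems by auto
    ultimately show ?thesis by simp
  qed simp
qed simp

lemma u_less: "u 0 < u N"
proof -
  have N: "1 \<le> N" using model by (simp add: model_ok_def)
  have "u 0 < u 1" using v_between[of 1] N by auto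
  also have "u 1 \<le> u N" using u_mono[of 1 N] N by simp
  finally show ?thesis .
qed

text \<open>The number of steps, and thereby also a bound on the number of parts of every partition
  in a configuration.\<close>

definition S :: nat where "S = nat (u N - u 0)"

lemma int_S: "int S = u N - u 0" using u_less by (simp add: S_def)

definition upstep :: "nat \<Rightarrow> bool" where
  "upstep i \<longleftrightarrow> real_of_int (u N - int i) + 1/2 \<in> Dminus N u v"

text \<open>The values of \<open>rr\<close> at \<open>0\<close> and beyond \<open>S\<close> have no meaning in the model; they only keep \<open>rr\<close> strictly
  increasing.\<close>

definition rr :: "nat \<Rightarrow> real" where
  "rr i = (if i \<le> S then \<Prod>t\<in>{u 0<..u N - int i}. if t < u N then q t else 1/2 else 2 ^ (i - S))"

lemma rr_Suc: "i < S \<Longrightarrow> rr i = (if i = 0 then 1/2 else q (u N - int i)) * rr (Suc i)"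
proof -
  assume i: "i < S"
  have "{u 0<..u N - int i} = insert (u N - int i) {u 0<..u N - int (Suc i)}"
    using i int_S by auto
  then show ?thesis using i by (simp add: rr_def)
qed

lemma rr_S: "rr S = 1" using int_S by (simp add: rr_def)

lemma rr_pos: "0 < rr i"
  unfolding rr_def using q_bounds by (auto intro!: prod_pos)

lemma rr_less: "rr i < rr (Suc i)"
proof (cases "i < S")
  case True
  have "(if i = 0 then 1/2 else q (u N - int i)) < 1"
    using True int_S q_bounds[of "u N - int i"] by auto
  then show ?thesis using rr_Suc[OF True] rr_pos[of "Suc i"] by simp
next
  case False
  show ?thesis
  proof (cases "i = S")
    case True
    then show ?thesis using rr_S by (simp add: rr_def)
  next
    case False
    then show ?thesis using \<open>\<not> i < S\<close> by (simp add: rr_def Suc_diff_le)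
  qed
qed

sublocale transfer rr upstep
  by standard (rule rr_pos rr_less)+

lemma rr_ratio: "0 < i \<Longrightarrow> i < S \<Longrightarrow> rr i / rr (Suc i) = q (u N - int i)"
  using rr_Suc[of i] rr_pos[of "Suc i"] by simp

text \<open>The half-integer crossed by step \<open>i\<close>, between the times
  \<open>u N - i\<close> and \<open>u N - i + 1\<close>.\<close>

definition half :: "nat \<Rightarrow> real" where "half i = real_of_int (u N - int i) + 1/2"

lemma xplus_half: "1 \<le> i \<Longrightarrow> i \<le> S \<Longrightarrow> xplus u q (half i) = rr i"
proof -
  assume i: "1 \<le> i" "i \<le> S"
  have "{t. u 0 < t \<and> real_of_int t < half i} = {u 0<..u N - int i}"
  proof -
    have "real_of_int t < half i \<longleftrightarrow> t \<le> u N - int i" for t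
      unfolding half_def by linarith
    then have "{t. u 0 < t \<and> real_of_int t < half i} = {t. u 0 < t \<and> t \<le> u N - int i}" by (simp only:)
    then show ?thesis by (simp only: greaterThanAtMost_def greaterThan_def atMost_def Int_def mem_Collect_eq)
  qed
  then have "xplus u q (half i) = (\<Prod>t\<in>{u 0<..u N - int i}. q t)" by (simp add: xplus_def)
  also have "\<dots> = (\<Prod>t\<in>{u 0<..u N - int i}. if t < u N then q t else 1/2)"
    by (rule prod.cong) (use i in auto)
  finally show ?thesis using i by (simp add: rr_def)
qed

lemma HalfInts_cases:
  assumes "m \<in> HalfInts" obtains t :: int where "m = real_of_int t + 1/2"
proof -
  obtain t where "m - 1/2 = real_of_int t" using assms by (auto simp: HalfInts_def Ints_def)
  then show ?thesis using that[of t] by simp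
qed

lemma half_in_HalfInts: "real_of_int t + 1/2 \<in> HalfInts"
  by (simp add: HalfInts_def)

lemma Dminus_iff: "real_of_int t + 1/2 \<in> Dminus N u v \<longleftrightarrow> (\<exists>i\<in>{1..N}. u (i - 1) \<le> t \<and> t < v i)"
proof -
  have "real_of_int a < real_of_int t + 1/2 \<longleftrightarrow> a \<le> t" "real_of_int t + 1/2 < real_of_int a \<longleftrightarrow> t < a" for a
    by linarith+
  then show ?thesis by (simp add: Dminus_def half_in_HalfInts)
qed

lemma Dplus_iff: "real_of_int t + 1/2 \<in> Dplus N u v \<longleftrightarrow> (\<exists>i\<in>{1..N}. v i \<le> t \<and> t < u i)"
proof -
  have "real_of_int a < real_of_int t + 1/2 \<longleftrightarrow> a \<le> t" "real_of_int t + 1/2 < real_of_int a \<longleftrightarrow> t < a" for a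
    by linarith+
  then show ?thesis by (simp add: Dplus_def half_in_HalfInts)
qed

text \<open>The intervals of the two kinds tile the range from \<open>u 0\<close> to
  \<open>u N\<close>. The least \<open>i\<close> with \<open>t < u i\<close> names the block that
  contains \<open>t\<close>.\<close>

lemma Dplus_iff_not_Dminus:
  assumes "u 0 \<le> t" "t < u N"
  shows "real_of_int t + 1/2 \<in> Dplus N u v \<longleftrightarrow> real_of_int t + 1/2 \<notin> Dminus N u v"
proof
  assume "real_of_int t + 1/2 \<in> Dplus N u v"
  then obtain j where j: "j \<in> {1..N}" "v j \<le> t" "t < u j" unfolding Dplus_iff by blast
  show "real_of_int t + 1/2 \<notin> Dminus N u v"
  proof
    assume "real_of_int t + 1/2 \<in> Dminus N u v"
    then obtain i where i: "i \<in> {1..N}" "u (i - 1) \<le> t" "t < v i" unfolding Dminus_iff by blast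
    consider "i < j" | "i = j" | "j < i" by linarith
    then show False
    proof cases
      case 1
      then have "u i \<le> u (j - 1)" using j by (intro u_mono) auto
      then show False using v_between[OF i(1)] v_between[OF j(1)] i j by linarith
    next
      case 3
      then have "u j \<le> u (i - 1)" using i by (intro u_mono) auto
      then show False using i j by linarith
    qed (use i j in auto)
  qed
next
  assume nm: "real_of_int t + 1/2 \<notin> Dminus N u v"
  define i where "i = (LEAST i. t < u i)"
  have i: "t < u i" "i \<le> N" unfolding i_def using assms(2) by (auto intro: LeastI Least_le)
  have "i \<noteq> 0" using i assms(1) by (intro notI) auto
  moreover have "u (i - 1) \<le> t"
    using not_less_Least[of "i - 1" "\<lambda>i. t < u i"] \<open>i \<noteq> 0\<close> by (simp add: i_def[symmetric] not_less)
  moreover have "\<not> t < v i" using nm calculation i unfolding Dminus_iff by auto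
  ultimately show "real_of_int t + 1/2 \<in> Dplus N u v"
    unfolding Dplus_iff using i by (intro bexI[of _ i]) auto
qed

lemma D_range:
  assumes "m \<in> Dplus N u v \<or> m \<in> Dminus N u v"
  obtains i where "i \<in> {1..S}" "m = half i"
proof -
  have "m \<in> HalfInts" using assms by (auto simp: Dplus_def Dminus_def)
  then obtain t where m: "m = real_of_int t + 1/2" by (rule HalfInts_cases)
  have "u 0 \<le> t \<and> t < u N"
  proof (cases "m \<in> Dplus N u v")
    case True
    then obtain j where j: "j \<in> {1..N}" "v j \<le> t" "t < u j" unfolding m Dplus_iff by blast
    then have "u 0 \<le> u (j - 1)" "u j \<le> u N" by (auto intro!: u_mono)
    then show ?thesis using v_between[OF j(1)] j by linarith
  next
    case False
    then obtain j where j: "j \<in> {1..N}" "u (j - 1) \<le> t" "t < v j" using assms unfolding m Dminus_iff by blast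
    then have "u 0 \<le> u (j - 1)" "u j \<le> u N" by (auto intro!: u_mono)
    then show ?thesis using v_between[OF j(1)] j by linarith
  qed
  then show ?thesis
    using int_S by (intro that[of "nat (u N - t)"]) (auto simp: m half_def)
qed

lemma half_in_Dminus: "half i \<in> Dminus N u v \<longleftrightarrow> upstep i"
  by (simp add: half_def upstep_def)

lemma half_in_Dplus: "i \<in> {1..S} \<Longrightarrow> half i \<in> Dplus N u v \<longleftrightarrow> \<not> upstep i"
  unfolding half_def upstep_def using int_S by (intro Dplus_iff_not_Dminus) auto

definition rtime :: "int \<Rightarrow> nat" where "rtime t = nat (u N - t)"

lemma half_inj: "inj half"
  by (auto simp: inj_def half_def)

section \<open>Translation of the functions, radii and kernel of the statement\<close>

lemma Dplus_above:
  assumes "u 0 \<le> t" "t \<le> u N"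
  shows "{m \<in> Dplus N u v. real_of_int t < m} = half ` {i \<in> {1..rtime t}. \<not> upstep i}"
proof -
  have *: "real_of_int t < half i \<longleftrightarrow> i \<le> rtime t" for i
    unfolding half_def rtime_def using assms by linarith
  have "rtime t \<le> S" using assms int_S by (simp add: rtime_def)
  show ?thesis
  proof (intro equalityI subsetI)
    fix m assume m: "m \<in> {m \<in> Dplus N u v. real_of_int t < m}"
    then obtain i where "i \<in> {1..S}" "m = half i" using D_range by blast
    then show "m \<in> half ` {i \<in> {1..rtime t}. \<not> upstep i}"
      using m * half_in_Dplus by auto
  next
    fix m assume "m \<in> half ` {i \<in> {1..rtime t}. \<not> upstep i}"
    then show "m \<in> {m \<in> Dplus N u v. real_of_int t < m}"
      using * half_in_Dplus \<open>rtime t \<le> S\<close> by auto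
  qed
qed

lemma Dminus_below:
  assumes "u 0 \<le> t" "t \<le> u N"
  shows "{m \<in> Dminus N u v. m < real_of_int t} = half ` {i \<in> {Suc (rtime t)..S}. upstep i}"
proof -
  have *: "half i < real_of_int t \<longleftrightarrow> rtime t < i" for i
    unfolding half_def rtime_def using assms by linarith
  show ?thesis
  proof (intro equalityI subsetI)
    fix m assume m: "m \<in> {m \<in> Dminus N u v. m < real_of_int t}"
    then obtain i where "i \<in> {1..S}" "m = half i" using D_range by blast
    then show "m \<in> half ` {i \<in> {Suc (rtime t)..S}. upstep i}"
      using m * half_in_Dminus by auto
  next
    fix m assume "m \<in> half ` {i \<in> {Suc (rtime t)..S}. upstep i}"
    then show "m \<in> {m \<in> Dminus N u v. m < real_of_int t}"
      using * half_in_Dminus by auto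
  qed
qed

lemma rtime_le: "u 0 \<le> t \<Longrightarrow> rtime t \<le> S"
  using int_S by (simp add: rtime_def)

lemma Phi_plus_eq:
  assumes "u 0 \<le> t" "t \<le> u N"
  shows "Phi_plus N u v q z t = PP (rtime t) z"
proof -
  have "Phi_plus N u v q z t = (\<Prod>i\<in>{i \<in> {1..rtime t}. \<not> upstep i}. 1 - z * of_real (xplus u q (half i)))"
    unfolding Phi_plus_def Dplus_above[OF assms]
    by (subst prod.reindex) (auto intro: inj_on_subset[OF half_inj])
  also have "\<dots> = PP (rtime t) z"
    unfolding PP_def by (rule prod.cong) (use rtime_le[OF assms(1)] in \<open>auto simp: xplus_half\<close>)
  finally show ?thesis .
qed

lemma Phi_minus_eq:
  assumes "u 0 \<le> t" "t \<le> u N"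
  shows "Phi_minus N u v q z t = PM S (rtime t) z"
proof -
  have "Phi_minus N u v q z t = (\<Prod>i\<in>{i \<in> {Suc (rtime t)..S}. upstep i}. 1 - of_real (xminus u q (half i)) / z)"
    unfolding Phi_minus_def Dminus_below[OF assms]
    by (subst prod.reindex) (auto intro: inj_on_subset[OF half_inj])
  also have "\<dots> = PM S (rtime t) z"
    unfolding PM_def by (rule prod.cong) (auto simp: xminus_def xplus_half)
  finally show ?thesis .
qed

lemma Rrad_iff:
  assumes "u 0 \<le> t" "t \<le> u N"
  shows "0 < \<rho> \<and> ereal \<rho> < Rrad N u v q t \<longleftrightarrow> inner_rad (rtime t) \<rho>"
proof -
  let ?A = "{i \<in> {1..rtime t}. \<not> upstep i}"
  have "ereal \<rho> < Rrad N u v q t \<longleftrightarrow> (\<forall>i\<in>?A. \<rho> < 1 / xplus u q (half i))"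
  proof (cases "?A = {}")
    case True
    show ?thesis unfolding Rrad_def Dplus_above[OF assms]
      by (simp only: True image_empty if_True ball_empty) simp
  next
    case False
    then have "Rrad N u v q t = ereal (Min ((\<lambda>m. 1 / xplus u q m) ` half ` ?A))"
      unfolding Rrad_def Dplus_above[OF assms] by (simp only: image_is_empty if_False)
    moreover have "\<rho> < Min ((\<lambda>m. 1 / xplus u q m) ` half ` ?A) \<longleftrightarrow> (\<forall>i\<in>?A. \<rho> < 1 / xplus u q (half i))"
      by (subst Min_gr_iff) (use False in auto)
    ultimately show ?thesis by simp
  qed
  also have "\<dots> \<longleftrightarrow> (\<forall>i\<in>?A. \<rho> * rr i < 1)"
    using rtime_le[OF assms(1)] rr_pos by (intro ball_cong refl) (simp add: xplus_half pos_less_divide_eq)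
  finally show ?thesis unfolding inner_rad_def by auto
qed

lemma Rstar_iff:
  assumes "u 0 \<le> t" "t \<le> u N"
  shows "0 < \<rho> \<and> Rstar N u v q t < \<rho> \<longleftrightarrow> outer_rad S (rtime t) \<rho>"
proof -
  let ?A = "{i \<in> {Suc (rtime t)..S}. upstep i}"
  have "0 < \<rho> \<and> Rstar N u v q t < \<rho> \<longleftrightarrow> 0 < \<rho> \<and> (\<forall>i\<in>?A. xminus u q (half i) < \<rho>)"
  proof (cases "?A = {}")
    case True
    show ?thesis unfolding Rstar_def Dminus_below[OF assms]
      by (simp only: True image_empty if_True ball_empty) simp
  next
    case False
    then have "Rstar N u v q t = Max (xminus u q ` half ` ?A)"
      unfolding Rstar_def Dminus_below[OF assms] by (simp only: image_is_empty if_False)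
    moreover have "Max (xminus u q ` half ` ?A) < \<rho> \<longleftrightarrow> (\<forall>i\<in>?A. xminus u q (half i) < \<rho>)"
      by (subst Max_less_iff) (use False in auto)
    ultimately show ?thesis by simp
  qed
  also have "\<dots> \<longleftrightarrow> 0 < \<rho> \<and> (\<forall>i\<in>?A. 1 < \<rho> * rr i)"
    using rr_pos by (intro conj_cong refl ball_cong) (auto simp: xminus_def xplus_half field_simps)
  finally show ?thesis unfolding outer_rad_def by auto
qed

lemma radii_ok_iff:
  assumes "u 0 < t1" "t1 < u N" "u 0 < t2" "t2 < u N"
  shows "radii_ok N u v q t1 t2 \<rho>1 \<rho>2 \<longleftrightarrow> inner_rad (rtime t1) \<rho>1 \<and> outer_rad S (rtime t2) \<rho>2 \<and>
     (rtime t1 \<le> rtime t2 \<longrightarrow> \<rho>2 < \<rho>1) \<and> (rtime t2 < rtime t1 \<longrightarrow> \<rho>1 < \<rho>2)"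
proof -
  have "rtime t1 \<le> rtime t2 \<longleftrightarrow> t2 \<le> t1" "rtime t2 < rtime t1 \<longleftrightarrow> t1 < t2"
    using assms by (auto simp: rtime_def)
  then show ?thesis
    using Rrad_iff[of t1 \<rho>1] Rstar_iff[of t2 \<rho>2] assms unfolding radii_ok_def by auto
qed

lemma radii_exist:
  assumes "u 0 < t1" "t1 < u N" "u 0 < t2" "t2 < u N"
  shows "\<exists>\<rho>1 \<rho>2. radii_ok N u v q t1 t2 \<rho>1 \<rho>2"
proof -
  let ?n = "rtime t1" and ?m = "rtime t2"
  show ?thesis
  proof (cases "?n \<le> ?m")
    case True
    \<comment> \<open>any two radii in the gap \<open>(1 / rr (n + 1), 1 / rr n)\<close> are admissible\<close>
    define a where "a = 1 / rr (Suc ?n)"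
    have "a < mid ?n" using inverse_mid_less[of ?n] mid_pos[of ?n] rr_pos[of "Suc ?n"]
      by (simp add: a_def field_simps)
    define b where "b = (a + mid ?n) / 2"
    have ab: "a < b" "b < mid ?n" using \<open>a < mid ?n\<close> by (auto simp: b_def)
    have "0 < a" using rr_pos by (simp add: a_def)
    have "1 < b * rr i" if "?m < i" for i
    proof -
      have "1 = a * rr (Suc ?n)" using rr_pos[of "Suc ?n"] by (simp add: a_def)
      also have "\<dots> < b * rr (Suc ?n)" using ab rr_pos by (intro mult_strict_right_mono)
      also have "\<dots> \<le> b * rr i" using that True r_le[of "Suc ?n" i] ab \<open>0 < a\<close> by (intro mult_left_mono) auto
      finally show ?thesis .
    qed
    then have "outer_rad S ?m b" using ab \<open>0 < a\<close> by (auto simp: outer_rad_def)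
    then show ?thesis
      using True ab inner_rad_mid[of ?n ?n] by (intro exI[of _ "mid ?n"] exI[of _ b]) (simp add: radii_ok_iff[OF assms])
  next
    \<comment> \<open>For \<open>t1 < t2\<close> nothing bounds the second radius from above, so it
      can be enlarged until it exceeds the first.\<close>
    case False
    have "outer_rad S ?m (mid ?n + mid ?m)"
      using outer_rad_mono[OF outer_rad_mid[of ?m ?m S]] mid_pos[of ?n] by simp
    then show ?thesis
      using False inner_rad_mid[of ?n ?n] mid_pos[of ?m]
      by (intro exI[of _ "mid ?n"] exI[of _ "mid ?n + mid ?m"]) (simp add: radii_ok_iff[OF assms])
  qed
qed

text \<open>Half-integral positions make both exponents integers, so \<open>powr\<close> becomes
  \<open>powi\<close> and no branch of the logarithm enters.\<close>

lemma Kern_eq_circ: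
  assumes t: "u 0 < t1" "t1 < u N" "u 0 < t2" "t2 < u N" and ok: "radii_ok N u v q t1 t2 \<rho>1 \<rho>2"
  shows "Kern N u v q \<rho>1 \<rho>2 t1 (real_of_int l1 + 1/2) t2 (real_of_int l2 + 1/2)
       = circ \<rho>1 (\<lambda>z. alpha S (rtime t1) z * z powi (- l1 - 1) *
           circ \<rho>2 (\<lambda>w. beta S (rtime t2) w * w powi l2 / (z - w)))"
proof -
  have p: "0 < \<rho>1" "0 < \<rho>2" using ok by (auto simp: radii_ok_def)
  have ci: "contour_integral (circlepath 0 \<rho>) f = (2 * of_real pi * \<i>) * circ \<rho> f" for \<rho> f
    by (simp add: circ_def)
  let ?F = "\<lambda>z w. (Phi_minus N u v q z t1 * Phi_plus N u v q w t2) /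
         (Phi_plus N u v q z t1 * Phi_minus N u v q w t2) *
         (z powr complex_of_real (- (real_of_int l1 + 1/2) - 1/2) *
          w powr complex_of_real (real_of_int l2 + 1/2 - 1/2)) / (z - w)"
  have lm: "circ \<rho> (\<lambda>z. c * f z) = c * circ \<rho> f" for \<rho> c f
    by (simp add: circ_def contour_integral_integral mult.assoc)
  have F: "circ \<rho>2 (?F z) = alpha S (rtime t1) z * z powi (- l1 - 1) *
           circ \<rho>2 (\<lambda>w. beta S (rtime t2) w * w powi l2 / (z - w))" if z: "norm z = \<rho>1" for z
  proof -
    have "z \<noteq> 0" using z p by auto
    have zp: "z powr complex_of_real (- (real_of_int l1 + 1/2) - 1/2) = z powi (- l1 - 1)"
    proof -
      have "complex_of_real (- (real_of_int l1 + 1/2) - 1/2) = of_int (- l1 - 1)"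
        by (simp add: field_simps)
      then show ?thesis using complex_powr_of_int[of z "- l1 - 1"] \<open>z \<noteq> 0\<close> by (simp only:) simp
    qed
    have "circ \<rho>2 (?F z) = circ \<rho>2 (\<lambda>w. (alpha S (rtime t1) z * z powi (- l1 - 1)) *
        (beta S (rtime t2) w * w powi l2 / (z - w)))"
    proof (rule circ_cong[OF p(2)])
      fix w :: complex assume "norm w = \<rho>2"
      then have "w \<noteq> 0" using p by auto
      have wp: "w powr complex_of_real (real_of_int l2 + 1/2 - 1/2) = w powi l2"
      proof -
        have "complex_of_real (real_of_int l2 + 1/2 - 1/2) = of_int l2" by simp
        then show ?thesis using complex_powr_of_int[of w l2] \<open>w \<noteq> 0\<close> by (simp only:) simp
      qed
      show "?F z w = (alpha S (rtime t1) z * z powi (- l1 - 1)) *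
        (beta S (rtime t2) w * w powi l2 / (z - w))"
      proof -
        have Phi: "Phi_minus N u v q z t1 = PM S (rtime t1) z" "Phi_plus N u v q z t1 = PP (rtime t1) z"
          "Phi_minus N u v q w t2 = PM S (rtime t2) w" "Phi_plus N u v q w t2 = PP (rtime t2) w"
          using t by (simp_all add: Phi_minus_eq Phi_plus_eq)
        show ?thesis
          unfolding zp wp Phi alpha_def beta_def by (simp only: divide_inverse inverse_mult_distrib mult_ac)
      qed
    qed
    then show ?thesis by (simp only: lm)
  qed
  have "Kern N u v q \<rho>1 \<rho>2 t1 (real_of_int l1 + 1/2) t2 (real_of_int l2 + 1/2)
      = circ \<rho>1 (\<lambda>z. circ \<rho>2 (?F z))"
    unfolding Kern_def ci lm by (simp add: power2_eq_square)
  also have "\<dots> = circ \<rho>1 (\<lambda>z. alpha S (rtime t1) z * z powi (- l1 - 1) *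
           circ \<rho>2 (\<lambda>w. beta S (rtime t2) w * w powi l2 / (z - w)))"
    by (rule circ_cong[OF p(1)]) (rule F)
  finally show ?thesis .
qed

lemma Kern_eq_corr_kernel:
  assumes t: "u 0 < t1" "t1 < u N" "u 0 < t2" "t2 < u N" and ok: "radii_ok N u v q t1 t2 \<rho>1 \<rho>2"
    and j1: "j1 = real_of_int (int p1 - int M) + 1/2" and j2: "j2 = real_of_int (int p2 - int M) + 1/2"
  shows "Kern N u v q \<rho>1 \<rho>2 t1 j1 t2 j2 = corr_kernel S M (rtime t1) p1 (rtime t2) p2"
proof -
  have o: "inner_rad (rtime t1) \<rho>1" "outer_rad S (rtime t2) \<rho>2"
     "rtime t1 \<le> rtime t2 \<Longrightarrow> \<rho>2 < \<rho>1" "rtime t2 < rtime t1 \<Longrightarrow> \<rho>1 < \<rho>2"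
    using ok unfolding radii_ok_iff[OF t] by auto
  have m: "rtime t2 \<le> S" using t by (intro rtime_le) simp
  show ?thesis
    unfolding j1 j2 Kern_eq_circ[OF t ok] by (rule corr_kernel_eq_integral[OF o(1,2) m o(3,4), symmetric])
qed

text \<open>For all admissible radii the integral equals \<open>corr_kernel\<close>, in which no
  radius occurs.\<close>

lemma Kern_indep:
  assumes t: "u 0 < t1" "t1 < u N" "u 0 < t2" "t2 < u N" and j: "j1 \<in> HalfInts" "j2 \<in> HalfInts"
    and ok: "radii_ok N u v q t1 t2 \<rho>1 \<rho>2" "radii_ok N u v q t1 t2 \<rho>1' \<rho>2'"
  shows "Kern N u v q \<rho>1 \<rho>2 t1 j1 t2 j2 = Kern N u v q \<rho>1' \<rho>2' t1 j1 t2 j2"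
proof -
  obtain l1 l2 where l: "j1 = real_of_int l1 + 1/2" "j2 = real_of_int l2 + 1/2"
    using HalfInts_cases j by metis
  \<comment> \<open>Large enough to make both shifted positions natural numbers.\<close>
  define M where "M = nat \<bar>l1\<bar> + nat \<bar>l2\<bar>"
  have "j1 = real_of_int (int (nat (l1 + int M)) - int M) + 1/2"
    "j2 = real_of_int (int (nat (l2 + int M)) - int M) + 1/2"
    by (auto simp: l M_def)
  then show ?thesis using Kern_eq_corr_kernel[OF t] ok by metis
qed

end

section \<open>Configurations as non-intersecting paths\<close>

lemma partition_mono:
  assumes "is_partition la" "1 \<le> k" "k \<le> l"
  shows "la l \<le> la k"
  using assms(3)
proof (induction l rule: dec_induct)
  case (step n)
  then have "la (Suc n) \<le> la n" using assms by (simp add: is_partition_def)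
  then show ?case using step by simp
qed simp

lemma is_partition_empty: "is_partition empty_partition"
  by (simp add: is_partition_def empty_partition_def)

text \<open>The parts are read from the last to the first, so that the tuple of positions increases.\<close>

definition tuple_of :: "nat \<Rightarrow> (nat \<Rightarrow> nat) \<Rightarrow> nat \<Rightarrow> nat" where
  "tuple_of M la = restrict (\<lambda>j. la (M - j) + j) {..<M}"

lemma tuple_of_apply: "j < M \<Longrightarrow> tuple_of M la j = la (M - j) + j"
  by (simp add: tuple_of_def)

lemma strict_mono_tuple_of:
  assumes "is_partition la" shows "strict_mono_on {..<M} (tuple_of M la)"
proof (rule strict_mono_onI)
  fix i j assume ij: "i \<in> {..<M}" "j \<in> {..<M}" "i < j"
  then have "la (M - i) \<le> la (M - j)" by (intro partition_mono[OF assms]) auto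
  then show "tuple_of M la i < tuple_of M la j" using ij by (simp add: tuple_of_def)
qed

lemma tuple_of_in_incr_tuples:
  assumes "is_partition la" "la 1 + M \<le> L"
  shows "tuple_of M la \<in> incr_tuples M {..<L}"
proof -
  have "la (M - j) + j < L" if "j < M" for j
  proof -
    have "la (M - j) \<le> la 1" by (rule partition_mono[OF assms(1)]) (use that in auto)
    then show ?thesis using that assms(2) by linarith
  qed
  then show ?thesis
    using strict_mono_tuple_of[OF assms(1)] by (auto simp: incr_tuples_def tuple_of_def)
qed

text \<open>The shift by \<open>j\<close> turns \<open>la (Suc k) <= mu k\<close> into a strict
  inequality between neighbouring positions. Since the parts beyond \<open>M\<close> vanish, the
  \<open>M\<close> entries of the tuples decide.\<close>

lemma interlace_iff_interlaced:
  assumes "\<And>k. M < k \<Longrightarrow> la k = 0" "\<And>k. M < k \<Longrightarrow> mu k = 0"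
  shows "interlace la mu \<longleftrightarrow> interlaced M (tuple_of M mu) (tuple_of M la)"
proof
  assume i: "interlace la mu"
  show "interlaced M (tuple_of M mu) (tuple_of M la)"
    unfolding interlaced_def
  proof (intro conjI allI impI)
    fix j assume "j < M"
    then show "tuple_of M mu j \<le> tuple_of M la j" using i by (simp add: tuple_of_def interlace_def)
  next
    fix j assume j: "Suc j < M"
    have "la (Suc (M - Suc j)) \<le> mu (M - Suc j)" using i j by (simp add: interlace_def)
    moreover have "Suc (M - Suc j) = M - j" using j by simp
    ultimately show "tuple_of M la j < tuple_of M mu (Suc j)" using j by (simp add: tuple_of_def)
  qed
next
  assume i: "interlaced M (tuple_of M mu) (tuple_of M la)"
  show "interlace la mu"
    unfolding interlace_def
  proof (intro allI impI conjI)
    fix k :: nat assume k: "1 \<le> k"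
    show "mu k \<le> la k"
    proof (cases "k \<le> M")
      case True
      then have "tuple_of M mu (M - k) \<le> tuple_of M la (M - k)" using i k by (simp add: interlaced_def)
      then show ?thesis using True k by (simp add: tuple_of_def)
    qed (use assms in simp)
    show "la (Suc k) \<le> mu k"
    proof (cases "Suc k \<le> M")
      case True
      then have "tuple_of M la (M - Suc k) < tuple_of M mu (Suc (M - Suc k))"
        using i k by (simp add: interlaced_def)
      moreover have "Suc (M - Suc k) = M - k" using True by simp
      ultimately show ?thesis using True k by (simp add: tuple_of_def)
    qed (use assms in simp)
  qed
qed

lemma psize_eq_sum:
  assumes "is_partition la" "\<And>k. M < k \<Longrightarrow> la k = 0"
  shows "psize la = (\<Sum>j<M. la (M - j))"
proof -
  have "psize la = (\<Sum>k\<in>{1..M}. la k)"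
    unfolding psize_def
  proof (rule sum.mono_neutral_left)
    show "{k. la k \<noteq> 0} \<subseteq> {1..M}"
    proof
      fix k assume "k \<in> {k. la k \<noteq> 0}"
      then have "la k \<noteq> 0" by simp
      moreover have "la 0 = 0" using assms(1) by (simp add: is_partition_def)
      ultimately have "k \<noteq> 0" "\<not> M < k" using assms(2) by metis+
      then show "k \<in> {1..M}" by simp
    qed
  qed auto
  also have "\<dots> = (\<Sum>j<M. la (M - j))"
    by (rule sum.reindex_bij_witness[of _ "\<lambda>j. M - j" "\<lambda>k. M - k"]) auto
  finally show ?thesis .
qed

lemma strict_mono_on_ge:
  fixes P :: "nat \<Rightarrow> nat"
  assumes "strict_mono_on {..<M} P" "j < M" shows "j \<le> P j"
  using assms(2)
proof (induction j)
  case (Suc j)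
  then have "P j < P (Suc j)" using assms(1) by (simp add: strict_mono_on_def)
  then show ?case using Suc by simp
qed simp

section \<open>Encoding of configurations by chains of tuples\<close>

context schur_model
begin

lemma S_pos: "0 < S" using int_S u_less by simp

lemma configs_iff:
  "lam \<in> configs N u v \<longleftrightarrow> (\<forall>t. is_partition (lam t)) \<and> (\<forall>t. t \<le> u 0 \<or> t \<ge> u N \<longrightarrow> lam t = empty_partition) \<and>
     (\<forall>i<S. if upstep (Suc i) then interlace (lam (u N - int i)) (lam (u N - int (Suc i)))
            else interlace (lam (u N - int (Suc i))) (lam (u N - int i)))"
proof -
  let ?A = "\<lambda>t. (real_of_int t + 1/2 \<in> Dminus N u v \<longrightarrow> interlace (lam (t + 1)) (lam t)) \<and>
        (real_of_int t + 1/2 \<in> Dplus N u v \<longrightarrow> interlace (lam t) (lam (t + 1)))"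
  let ?B = "\<lambda>i. if upstep (Suc i) then interlace (lam (u N - int i)) (lam (u N - int (Suc i)))
            else interlace (lam (u N - int (Suc i))) (lam (u N - int i))"
  have AB: "?A (u N - int (Suc i)) = ?B i" if "i < S" for i
  proof -
    have e: "u N - int (Suc i) + 1 = u N - int i" by simp
    have "real_of_int (u N - int (Suc i)) + 1/2 = half (Suc i)" by (simp only: half_def)
    then show ?thesis unfolding e using half_in_Dminus half_in_Dplus[of "Suc i"] that by simp
  qed
  have "(\<forall>t. u 0 \<le> t \<and> t < u N \<longrightarrow> ?A t) \<longleftrightarrow> (\<forall>i<S. ?B i)"
  proof (intro iffI allI impI)
    fix i assume "\<forall>t. u 0 \<le> t \<and> t < u N \<longrightarrow> ?A t" "i < S"
    moreover have "u 0 \<le> u N - int (Suc i) \<and> u N - int (Suc i) < u N" using \<open>i < S\<close> int_S by auto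
    ultimately show "?B i" using AB by blast
  next
    fix t assume B: "\<forall>i<S. ?B i" and t: "u 0 \<le> t \<and> t < u N"
    define i where "i = nat (u N - t - 1)"
    have "i < S" "t = u N - int (Suc i)" using t int_S by (auto simp: i_def)
    then show "?A t" using B AB[OF \<open>i < S\<close>] by metis
  qed
  then show ?thesis unfolding configs_def is_config_def mem_Collect_eq by (simp only:)
qed

lemma config_partition: "lam \<in> configs N u v \<Longrightarrow> is_partition (lam t)"
  by (simp add: configs_iff)

lemma config_outside: "lam \<in> configs N u v \<Longrightarrow> t \<le> u 0 \<or> u N \<le> t \<Longrightarrow> lam t = empty_partition"
  unfolding configs_iff by blast

text \<open>Interlacing lets the number of parts grow by at most one per step, and there are none at
  \<open>u 0\<close>. Hence \<open>M >= S\<close> paths capture a whole configuration.\<close>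

lemma config_length:
  assumes "lam \<in> configs N u v" "S < k"
  shows "lam t k = 0"
proof -
  have step: "lam (u 0 + int n) k' = 0" if "n \<le> S" "n < k'" for n k'
    using that
  proof (induction n arbitrary: k')
    case 0
    then show ?case using config_outside[OF assms(1), of "u 0"] by (simp add: empty_partition_def)
  next
    case (Suc n)
    define i where "i = S - Suc n"
    have i: "i < S" "u N - int i = u 0 + int (Suc n)" "u N - int (Suc i) = u 0 + int n"
      using Suc.prems int_S by (auto simp: i_def)
    have B: "if upstep (Suc i) then interlace (lam (u 0 + int (Suc n))) (lam (u 0 + int n))
            else interlace (lam (u 0 + int n)) (lam (u 0 + int (Suc n)))"
      using assms(1) i unfolding configs_iff by metis
    obtain k'' where k'': "k' = Suc k''" "n < k''" using Suc.prems by (cases k') auto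
    have z: "lam (u 0 + int n) k'' = 0" "lam (u 0 + int n) k' = 0"
      using Suc.IH[of k''] Suc.IH[of k'] Suc.prems k'' by auto
    show ?case
    proof (cases "upstep (Suc i)")
      case True
      then have "lam (u 0 + int (Suc n)) (Suc k'') \<le> lam (u 0 + int n) k''"
        using B k'' by (simp add: interlace_def)
      then show ?thesis using z k'' by simp
    next
      case False
      then have "lam (u 0 + int (Suc n)) k' \<le> lam (u 0 + int n) k'"
        using B k'' by (simp add: interlace_def)
      then show ?thesis using z by simp
    qed
  qed
  show ?thesis
  proof (cases "u 0 \<le> t \<and> t \<le> u N")
    case True
    have e: "u 0 + int (nat (t - u 0)) = t" using True by simp
    have "nat (t - u 0) \<le> S" using True int_S by linarith
    then show ?thesis using step[of "nat (t - u 0)" k] assms(2) unfolding e by simp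
  next
    case False
    then show ?thesis using config_outside[OF assms(1), of t] by (auto simp: empty_partition_def)
  qed
qed

text \<open>The largest of the \<open>M\<close> positions is \<open>lam t 1 + M - 1\<close>, so
  these are the configurations with all positions below \<open>L\<close>.\<close>

definition bounded_configs :: "nat \<Rightarrow> nat \<Rightarrow> (int \<Rightarrow> nat \<Rightarrow> nat) set" where
  "bounded_configs M L = {lam \<in> configs N u v. \<forall>t. lam t 1 + M \<le> L}"

definition chains :: "nat \<Rightarrow> nat \<Rightarrow> (nat \<Rightarrow> nat \<Rightarrow> nat) set" where
  "chains M L = {c \<in> {1..S - 1} \<rightarrow>\<^sub>E incr_tuples M {..<L}. chain_ok M S (closed_chain M S c)}"

definition enc :: "nat \<Rightarrow> (int \<Rightarrow> nat \<Rightarrow> nat) \<Rightarrow> nat \<Rightarrow> nat \<Rightarrow> nat" where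
  "enc M lam = restrict (\<lambda>i. tuple_of M (lam (u N - int i))) {1..S - 1}"

text \<open>The truncated subtraction is exact on chains, because entry \<open>j\<close> of a
  strictly increasing tuple is at least \<open>j\<close>.\<close>

definition dec :: "nat \<Rightarrow> (nat \<Rightarrow> nat \<Rightarrow> nat) \<Rightarrow> int \<Rightarrow> nat \<Rightarrow> nat" where
  "dec M c t k = (if u 0 < t \<and> t < u N \<and> 1 \<le> k \<and> k \<le> M then c (nat (u N - t)) (M - k) - (M - k) else 0)"

lemma tuple_of_empty: "tuple_of M empty_partition = restrict id {..<M}"
  unfolding tuple_of_def by (rule restrict_ext) (simp add: empty_partition_def)

lemma closed_chain_enc:
  assumes "lam \<in> configs N u v" "i \<le> S"
  shows "closed_chain M S (enc M lam) i = tuple_of M (lam (u N - int i))"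
proof -
  consider "i = 0" | "i = S" | "1 \<le> i" "i \<le> S - 1" "i \<noteq> S" using assms(2) by linarith
  then show ?thesis
  proof cases
    case 1
    then show ?thesis using config_outside[OF assms(1), of "u N"] S_pos
      by (simp add: closed_chain_def tuple_of_empty)
  next
    case 2
    then show ?thesis using config_outside[OF assms(1), of "u 0"] int_S
      by (simp add: closed_chain_def tuple_of_empty)
  next
    case 3
    then show ?thesis by (simp add: closed_chain_def enc_def)
  qed
qed

lemma enc_in_chains:
  assumes M: "S \<le> M" and lam: "lam \<in> bounded_configs M L"
  shows "enc M lam \<in> chains M L"
proof -
  have c: "lam \<in> configs N u v" and b: "lam t 1 + M \<le> L" for t
    using lam by (auto simp: bounded_configs_def)
  have "enc M lam \<in> {1..S - 1} \<rightarrow>\<^sub>E incr_tuples M {..<L}"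
    using tuple_of_in_incr_tuples[OF config_partition[OF c] b] by (simp add: enc_def)
  moreover have "chain_ok M S (closed_chain M S (enc M lam))"
    unfolding chain_ok_def
  proof (intro allI impI)
    fix i assume i: "i < S"
    have z: "lam t k = 0" if "M < k" for t k using config_length[OF c, of k t] that M by simp
    show "if upstep (Suc i)
         then interlaced M (closed_chain M S (enc M lam) (Suc i)) (closed_chain M S (enc M lam) i)
         else interlaced M (closed_chain M S (enc M lam) i) (closed_chain M S (enc M lam) (Suc i))"
    proof -
      have "if upstep (Suc i) then interlace (lam (u N - int i)) (lam (u N - int (Suc i)))
            else interlace (lam (u N - int (Suc i))) (lam (u N - int i))"
        using c i unfolding configs_iff by blast
      then show ?thesis
        by (simp only: closed_chain_enc[OF c less_imp_le[OF i]] closed_chain_enc[OF c Suc_leI[OF i]]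
            interlace_iff_interlaced[OF z z])
    qed
  qed
  ultimately show ?thesis by (simp add: chains_def)
qed

lemma dec_in_bounded_configs:
  assumes M: "S \<le> M" "M \<le> L" and c: "c \<in> chains M L"
  shows "dec M c \<in> bounded_configs M L" "enc M (dec M c) = c"
proof -
  have cPE: "c \<in> {1..S - 1} \<rightarrow>\<^sub>E incr_tuples M {..<L}" and ok: "chain_ok M S (closed_chain M S c)"
    using c by (auto simp: chains_def)
  have ci: "c i \<in> incr_tuples M {..<L}" if "i \<in> {1..S - 1}" for i using cPE that by (rule PiE_mem)
  have sm: "strict_mono_on {..<M} (c i)" "j < M \<Longrightarrow> c i j < L" if "i \<in> {1..S - 1}" for i j
    using ci[OF that] by (auto simp: incr_tuples_def)
  have time: "nat (u N - t) \<in> {1..S - 1}" if "u 0 < t" "t < u N" for t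
    using that int_S by auto
  have part: "is_partition (dec M c t)" for t
  proof -
    have "dec M c t (Suc k) \<le> dec M c t k" if "1 \<le> k" for k
    proof (cases "u 0 < t \<and> t < u N \<and> Suc k \<le> M")
      case True
      let ?i = "nat (u N - t)"
      have mono: "strict_mono_on {..<M} (c ?i)" using sm(1)[OF time] True by blast
      have "c ?i (M - Suc k) < c ?i (M - k)"
        by (rule strict_mono_onD[OF mono]) (use True that in auto)
      moreover have "M - Suc k \<le> c ?i (M - Suc k)"
        using strict_mono_on_ge[OF mono] True by simp
      moreover have "M - k = Suc (M - Suc k)" using True by linarith
      moreover have "dec M c t (Suc k) = c ?i (M - Suc k) - (M - Suc k)"
        "dec M c t k = c ?i (M - k) - (M - k)"
        using True that by (simp_all add: dec_def)
      ultimately show ?thesis by linarith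
    qed (auto simp: dec_def)
    moreover have "finite {k. dec M c t k \<noteq> 0}"
      by (rule finite_subset[of _ "{..M}"]) (auto simp: dec_def split: if_splits)
    ultimately show ?thesis by (simp add: is_partition_def dec_def)
  qed
  have empty: "dec M c t = empty_partition" if "t \<le> u 0 \<or> u N \<le> t" for t
    using that by (auto simp: dec_def[abs_def] empty_partition_def)
  have tup: "tuple_of M (dec M c (u N - int i)) = closed_chain M S c i" if "i \<le> S" for i
  proof -
    have "i = 0 \<or> i = S \<or> (i \<in> {1..S - 1} \<and> i \<noteq> S)" using that by auto
    then consider "i = 0" | "i = S" | "i \<in> {1..S - 1}" "i \<noteq> S" by blast
    then show ?thesis
    proof cases
      case 1
      then show ?thesis using empty[of "u N"] S_pos by (simp add: closed_chain_def tuple_of_empty)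
    next
      case 2
      then show ?thesis using empty[of "u 0"] int_S by (simp add: closed_chain_def tuple_of_empty)
    next
      case 3
      have e: "u 0 < u N - int i" "u N - int i < u N" using 3 int_S by auto
      have "tuple_of M (dec M c (u N - int i)) j = c i j" for j
      proof (cases "j < M")
        case True
        have "Suc 0 \<le> M - j" using True by simp
        then show ?thesis using strict_mono_on_ge[OF sm(1)[OF 3(1)] True] e True
          by (simp add: tuple_of_def dec_def)
      next
        case False
        then show ?thesis using ci[OF 3(1)] by (auto simp: tuple_of_def incr_tuples_def PiE_def extensional_def)
      qed
      then show ?thesis using 3 by (auto simp: closed_chain_def)
    qed
  qed
  have z: "dec M c t k = 0" if "M < k" for t k using that by (simp add: dec_def)
  have conf: "dec M c \<in> configs N u v"
    unfolding configs_iff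
  proof (intro conjI allI impI)
    fix i assume i: "i < S"
    show "if upstep (Suc i) then interlace (dec M c (u N - int i)) (dec M c (u N - int (Suc i)))
            else interlace (dec M c (u N - int (Suc i))) (dec M c (u N - int i))"
    proof -
      have "if upstep (Suc i) then interlaced M (closed_chain M S c (Suc i)) (closed_chain M S c i)
            else interlaced M (closed_chain M S c i) (closed_chain M S c (Suc i))"
        using ok i unfolding chain_ok_def by blast
      then show ?thesis
        by (simp only: tup[OF less_imp_le[OF i], symmetric] tup[OF Suc_leI[OF i], symmetric]
            interlace_iff_interlaced[OF z z])
    qed
  qed (use part empty in auto)
  have "dec M c t 1 + M \<le> L" for t
  proof (cases "u 0 < t \<and> t < u N")
    case True
    have M1: "M - 1 < M" "1 \<le> M" using M S_pos by auto
    then have "c (nat (u N - t)) (M - 1) < L" "M - 1 \<le> c (nat (u N - t)) (M - 1)"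
      using sm(2)[OF time] strict_mono_on_ge[OF sm(1)[OF time]] True by auto
    then show ?thesis using True M1 by (simp add: dec_def)
  next
    case False
    then have "dec M c t 1 = 0" by (auto simp: dec_def)
    then show ?thesis using M by simp
  qed
  then show "dec M c \<in> bounded_configs M L" using conf by (simp add: bounded_configs_def)
  show "enc M (dec M c) = c"
  proof
    fix i
    show "enc M (dec M c) i = c i"
    proof (cases "i \<in> {1..S - 1}")
      case True
      then have "i \<noteq> 0" "i \<noteq> S" "i \<le> S" using S_pos by auto
      then show ?thesis using True tup[of i] by (simp add: enc_def closed_chain_def)
    next
      case False
      then show ?thesis using cPE by (auto simp: enc_def PiE_def extensional_def)
    qed
  qed
qed

lemma dec_enc:
  assumes "S \<le> M" "lam \<in> configs N u v"
  shows "dec M (enc M lam) = lam"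
proof (intro ext)
  fix t k
  show "dec M (enc M lam) t k = lam t k"
  proof (cases "u 0 < t \<and> t < u N")
    case True
    then have i: "nat (u N - t) \<in> {1..S - 1}" "u N - int (nat (u N - t)) = t" using int_S by auto
    consider "k = 0" | "M < k" | "1 \<le> k" "k \<le> M" by linarith
    then show ?thesis
    proof cases
      case 1
      then show ?thesis using config_partition[OF assms(2), of t] by (simp add: dec_def is_partition_def)
    next
      case 2
      then show ?thesis using config_length[OF assms(2), of k t] assms(1) by (simp add: dec_def)
    next
      case 3
      then have "enc M lam (nat (u N - t)) (M - k) = lam t k + (M - k)"
        using i by (simp add: enc_def tuple_of_def)
      then show ?thesis using True 3 by (simp add: dec_def)
    qed
  next
    case False
    then show ?thesis using config_outside[OF assms(2), of t] by (auto simp: dec_def empty_partition_def)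
  qed
qed

lemma bij_betw_enc:
  assumes "S \<le> M" "M \<le> L"
  shows "bij_betw (enc M) (bounded_configs M L) (chains M L)"
proof (rule bij_betw_byWitness[where f' = "dec M"])
  show "\<forall>lam\<in>bounded_configs M L. dec M (enc M lam) = lam"
    using dec_enc[OF assms(1)] by (simp add: bounded_configs_def)
  show "\<forall>c\<in>chains M L. enc M (dec M c) = c"
    using dec_in_bounded_configs(2)[OF assms] by blast
  show "enc M ` bounded_configs M L \<subseteq> chains M L"
    using enc_in_chains[OF assms(1)] by blast
  show "dec M ` chains M L \<subseteq> bounded_configs M L"
    using dec_in_bounded_configs(1)[OF assms] by blast
qed

lemma finite_bounded_configs:
  assumes "S \<le> M" shows "finite (bounded_configs M L)"
proof (cases "M \<le> L")
  case True
  have "finite (chains M L)"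
    unfolding chains_def by (auto intro!: finite_PiE finite_incr_tuples)
  then show ?thesis using bij_betw_finite[OF bij_betw_enc[OF assms True]] by simp
next
  case False
  then have "bounded_configs M L = {}" by (auto simp: bounded_configs_def)
  then show ?thesis by simp
qed

text \<open>The offsets \<open>j\<close> of the positions contribute the same power to numerator and
  denominator and cancel. The sizes that remain regroup into powers of ratios of consecutive rates,
  which are the weights \<open>q\<close>.\<close>

lemma prod_weights_enc:
  assumes M: "S \<le> M" and lam: "lam \<in> configs N u v"
  shows "(\<Prod>i<S. (\<Prod>j<M. rr (Suc i) ^ closed_chain M S (enc M lam) (Suc i) j) /
                   (\<Prod>j<M. rr (Suc i) ^ closed_chain M S (enc M lam) i j)) = weight N u q lam"
proof -
  define s where "s i = psize (lam (u N - int i))" for i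
  obtain n where n: "S = Suc n" using S_pos by (cases S) auto
  have s0: "s i = 0" if "i = 0 \<or> i = S" for i
    using that config_outside[OF lam, of "u N - int i"] int_S
    by (auto simp: s_def psize_def empty_partition_def)
  have P: "(\<Prod>j<M. x ^ closed_chain M S (enc M lam) i j) = x ^ s i * x ^ (\<Sum>j<M. j)" if "i \<le> S" for i and x :: real
  proof -
    have "(\<Prod>j<M. x ^ closed_chain M S (enc M lam) i j) = (\<Prod>j<M. x ^ (lam (u N - int i) (M - j) + j))"
      by (rule prod.cong) (simp_all add: closed_chain_enc[OF lam that] tuple_of_apply)
    also have "\<dots> = x ^ (\<Sum>j<M. lam (u N - int i) (M - j)) * x ^ (\<Sum>j<M. j)"
      by (simp add: power_add prod.distrib power_sum)
    also have "(\<Sum>j<M. lam (u N - int i) (M - j)) = s i"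
      unfolding s_def using config_length[OF lam] M
      by (intro psize_eq_sum[symmetric] config_partition[OF lam]) auto
    finally show ?thesis .
  qed
  have "(\<Prod>i<S. (\<Prod>j<M. rr (Suc i) ^ closed_chain M S (enc M lam) (Suc i) j) /
                   (\<Prod>j<M. rr (Suc i) ^ closed_chain M S (enc M lam) i j))
      = (\<Prod>i<S. rr (Suc i) ^ s (Suc i) / rr (Suc i) ^ s i)"
    by (rule prod.cong) (use rr_pos in \<open>auto simp: P less_imp_neq[symmetric]\<close>)
  also have "\<dots> = (\<Prod>i\<in>{1..n}. (rr i / rr (Suc i)) ^ s i) * rr S ^ s S"
    unfolding n by (rule prod_ratio_powers) (simp add: s0)
  also have "\<dots> = (\<Prod>i\<in>{1..n}. (q (u N - int i)) ^ s i)"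
    using s0 rr_ratio n by simp
  also have "\<dots> = weight N u q lam"
    unfolding weight_def s_def
    by (rule prod.reindex_bij_witness[of _ "\<lambda>t. nat (u N - t)" "\<lambda>i. u N - int i"]) (use int_S n in auto)
  finally show ?thesis .
qed

section \<open>Marked points and their generating function\<close>

definition hits :: "nat \<Rightarrow> nat \<Rightarrow> (nat \<Rightarrow> nat) \<Rightarrow> (nat \<Rightarrow> nat) \<Rightarrow> (int \<Rightarrow> nat \<Rightarrow> nat) \<Rightarrow> nat" where
  "hits M n \<tau> p lam = card {a \<in> {..<n}. \<exists>j<M. tuple_of M (lam (u N - int (\<tau> a))) j = p a}"

lemma prod_marks_enc:
  fixes s :: complex
  assumes lam: "lam \<in> configs N u v"
    and \<tau>: "\<And>a. a < n \<Longrightarrow> 0 < \<tau> a \<and> \<tau> a \<le> S" and inj: "inj_on (\<lambda>a. (\<tau> a, p a)) {..<n}"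
  shows "(\<Prod>i<S. \<Prod>j<M. 1 + s * (\<Sum>a<n. of_bool (\<tau> a = Suc i \<and> p a = closed_chain M S (enc M lam) (Suc i) j)))
       = (1 + s) ^ hits M n \<tau> p lam"
proof -
  let ?C = "closed_chain M S (enc M lam)"
  let ?key = "\<lambda>(i, j). (Suc i, ?C (Suc i) j)"
  have C: "?C i = tuple_of M (lam (u N - int i))" if "i \<le> S" for i
    by (rule closed_chain_enc[OF lam that])
  have key: "inj_on ?key ({..<S} \<times> {..<M})"
  proof (rule inj_onI)
    fix y y' assume y: "y \<in> {..<S} \<times> {..<M}" "y' \<in> {..<S} \<times> {..<M}" "?key y = ?key y'"
    obtain i j i' j' where ij: "y = (i, j)" "y' = (i', j')" by (cases y; cases y') blast
    then have *: "i = i'" "i < S" "j < M" "j' < M" "?C (Suc i) j = ?C (Suc i) j'" using y by auto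
    have "inj_on (?C (Suc i)) {..<M}"
      using strict_mono_on_imp_inj_on[OF strict_mono_tuple_of[OF config_partition[OF lam]]] C[of "Suc i"] *(2)
      by simp
    then have "j = j'" using * by (auto dest: inj_onD)
    then show "y = y'" using ij * by simp
  qed
  have "(\<Prod>i<S. \<Prod>j<M. 1 + s * (\<Sum>a<n. of_bool (\<tau> a = Suc i \<and> p a = ?C (Suc i) j)))
      = (\<Prod>y\<in>{..<S} \<times> {..<M}. 1 + s * (\<Sum>a\<in>{..<n}. of_bool ((\<tau> a, p a) = ?key y)))"
    by (subst prod.cartesian_product) (simp add: case_prod_unfold)
  also have "\<dots> = (1 + s) ^ card {a \<in> {..<n}. (\<tau> a, p a) \<in> ?key ` ({..<S} \<times> {..<M})}"
    by (rule prod_marked_points[OF _ inj _ key]) auto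
  also have "{a \<in> {..<n}. (\<tau> a, p a) \<in> ?key ` ({..<S} \<times> {..<M})}
      = {a \<in> {..<n}. \<exists>j<M. tuple_of M (lam (u N - int (\<tau> a))) j = p a}"
  proof (rule Collect_cong, rule conj_cong[OF refl])
    fix a assume "a \<in> {..<n}"
    then obtain i where i: "\<tau> a = Suc i" "i < S" using \<tau>[of a] by (cases "\<tau> a") auto
    have "(\<tau> a, p a) \<in> ?key ` ({..<S} \<times> {..<M}) \<longleftrightarrow> (\<exists>j<M. ?C (Suc i) j = p a)"
      using i by force
    then show "(\<tau> a, p a) \<in> ?key ` ({..<S} \<times> {..<M}) \<longleftrightarrow>
        (\<exists>j<M. tuple_of M (lam (u N - int (\<tau> a))) j = p a)"
      using C[of "Suc i"] i by simp
  qed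
  finally show ?thesis by (simp only: hits_def)
qed

lemma dt_prop_fin_eq_sum_configs:
  fixes s :: real
  assumes M: "S \<le> M" "M \<le> L"
    and \<tau>: "\<And>a. a < n \<Longrightarrow> 0 < \<tau> a \<and> \<tau> a \<le> S" and inj: "inj_on (\<lambda>a. (\<tau> a, p a)) {..<n}"
  shows "dt M (\<lambda>j k. prop_fin T (\<lambda>m x. 1 + of_real s * (\<Sum>a<n. of_bool (\<tau> a = m \<and> p a = x))) {..<L} (unit_vec_at k) S j)
       = of_real (\<Sum>lam\<in>bounded_configs M L. weight N u q lam * (1 + s) ^ hits M n \<tau> p lam)"
proof -
  obtain m where m: "S = Suc m" using S_pos by (cases S) auto
  let ?C = "closed_chain M S"
  let ?g = "\<lambda>m x. 1 + of_real s * (\<Sum>a<n. of_bool (\<tau> a = m \<and> p a = x)) :: complex"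
  let ?w = "\<lambda>c. (\<Prod>i<S. \<Prod>j<M. ?g (Suc i) (?C c (Suc i) j)) *
           of_real (\<Prod>i<S. (\<Prod>j<M. rr (Suc i) ^ ?C c (Suc i) j) / (\<Prod>j<M. rr (Suc i) ^ ?C c i j))"
  have "dt M (\<lambda>j k. prop_fin T ?g {..<L} (unit_vec_at k) S j) = (\<Sum>c\<in>chains M L. ?w c)"
    using dt_prop_fin_T[OF M(2), of ?g m] unfolding m[symmetric] chains_def by (simp add: m)
  also have "\<dots> = (\<Sum>lam\<in>bounded_configs M L. ?w (enc M lam))"
    by (rule sum.reindex_bij_betw[OF bij_betw_enc[OF M], symmetric])
  also have "\<dots> = (\<Sum>lam\<in>bounded_configs M L. of_real (weight N u q lam * (1 + s) ^ hits M n \<tau> p lam))"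
  proof (rule sum.cong[OF refl])
    fix lam assume "lam \<in> bounded_configs M L"
    then have lam: "lam \<in> configs N u v" by (simp add: bounded_configs_def)
    have marks: "(\<Prod>i<S. \<Prod>j<M. ?g (Suc i) (?C (enc M lam) (Suc i) j))
        = (1 + of_real s) ^ hits M n \<tau> p lam"
      by (rule prod_marks_enc[OF lam \<tau> inj])
    show "?w (enc M lam) = of_real (weight N u q lam * (1 + s) ^ hits M n \<tau> p lam)"
      unfolding prod_weights_enc[OF M(1) lam] marks
      by (simp only: of_real_mult of_real_power of_real_add of_real_1 mult.commute)
  qed
  finally show ?thesis by simp
qed

lemma weight_nonneg: "0 \<le> weight N u q lam"
  unfolding weight_def
proof (rule prod_nonneg)
  fix t assume "t \<in> {u 0<..<u N}"
  then have "0 \<le> q t" using q_bounds[of t] by simp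
  then show "0 \<le> q t ^ psize (lam t)" by simp
qed

lemma eventually_subset_bounded_configs:
  assumes "finite F" "F \<subseteq> configs N u v"
  shows "\<forall>\<^sub>F L in sequentially. F \<subseteq> bounded_configs M L"
proof -
  have "\<forall>\<^sub>F L in sequentially. lam \<in> bounded_configs M L" if "lam \<in> F" for lam
  proof -
    define B where "B = Max ((\<lambda>t. lam t 1) ` {u 0..u N})"
    have "lam t 1 \<le> B" for t
    proof (cases "t \<in> {u 0..u N}")
      case True
      then show ?thesis unfolding B_def by (intro Max_ge) auto
    next
      case False
      then have "lam t = empty_partition" using that assms(2) by (intro config_outside) auto
      then show ?thesis by (simp add: empty_partition_def)
    qed
    then have "lam \<in> bounded_configs M L" if "B + M \<le> L" for L
      using that \<open>lam \<in> F\<close> assms(2) by (auto simp: bounded_configs_def intro: order_trans[OF add_right_mono])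
    then show ?thesis unfolding eventually_sequentially by blast
  qed
  then have "\<forall>\<^sub>F L in sequentially. \<forall>lam\<in>F. lam \<in> bounded_configs M L"
    by (intro eventually_ball_finite[OF assms(1)] ballI)
  then show ?thesis by (simp only: subset_eq)
qed

text \<open>As \<open>L\<close> grows, the finite path sums converge entrywise on the determinant
  side and exhaust a sum of nonnegative terms on the configuration side. Summability is thus
  obtained together with the value.\<close>

lemma partition_function:
  fixes s :: real
  assumes M: "S \<le> M" and s: "0 \<le> s"
    and \<tau>: "\<And>a. a < n \<Longrightarrow> 0 < \<tau> a \<and> \<tau> a \<le> S" and inj: "inj_on (\<lambda>a. (\<tau> a, p a)) {..<n}"
    and p: "\<And>a. a < n \<Longrightarrow> S \<le> p a"
  shows "(\<lambda>lam. weight N u q lam * (1 + s) ^ hits M n \<tau> p lam) summable_on configs N u v"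
    and "complex_of_real (infsum (\<lambda>lam. weight N u q lam * (1 + s) ^ hits M n \<tau> p lam) (configs N u v))
       = dt M (\<lambda>i k. evolve 0 S (unit_vec_at k) i) *
         dt n (\<lambda>a b. (if a = b then 1 else 0) + of_real s * corr_kernel S M (\<tau> a) (p a) (\<tau> b) (p b))"
proof -
  let ?g = "\<lambda>m x. 1 + of_real s * (\<Sum>a<n. of_bool (\<tau> a = m \<and> p a = x)) :: complex"
  let ?f = "\<lambda>lam. weight N u q lam * (1 + s) ^ hits M n \<tau> p lam"
  define X where "X = dt M (\<lambda>i k. evolve 0 S (unit_vec_at k) i) *
         dt n (\<lambda>a b. (if a = b then 1 else 0) + of_real s * corr_kernel S M (\<tau> a) (p a) (\<tau> b) (p b))"
  have g: "norm (?g m x) \<le> 1 + s * real n" for m x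
  proof -
    have "norm (\<Sum>a<n. of_bool (\<tau> a = m \<and> p a = x) :: complex) \<le> (\<Sum>a<n. 1)"
      by (rule order_trans[OF norm_sum]) (intro sum_mono, simp)
    then have "norm (of_real s * (\<Sum>a<n. of_bool (\<tau> a = m \<and> p a = x) :: complex)) \<le> s * real n"
      using s unfolding norm_mult by (intro mult_mono) auto
    then show ?thesis using norm_triangle_ineq[of 1 "of_real s * (\<Sum>a<n. of_bool (\<tau> a = m \<and> p a = x) :: complex)"]
      by simp
  qed
  have entry: "(\<lambda>L. prop_fin T ?g {..<L} (unit_vec_at k) S j) \<longlonglongrightarrow> prop_inf ?g (unit_vec_at k) S j" for j k
    using prop_fin_tendsto[where v = "unit_vec_at k" and g = ?g and n = S, OF fast_unit g] by blast
  have "(\<lambda>L. dt M (\<lambda>j k. prop_fin T ?g {..<L} (unit_vec_at k) S j)) \<longlonglongrightarrow>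
      dt M (\<lambda>j k. prop_inf ?g (unit_vec_at k) S j)"
    by (rule tendsto_dt) (rule entry)
  also have "dt M (\<lambda>j k. prop_inf ?g (unit_vec_at k) S j) = X"
    unfolding X_def by (rule dt_prop_inf_eq_kernel[OF \<tau> p M])
  finally have limX: "(\<lambda>L. dt M (\<lambda>j k. prop_fin T ?g {..<L} (unit_vec_at k) S j)) \<longlonglongrightarrow> X" .
  have ev: "\<forall>\<^sub>F L in sequentially. dt M (\<lambda>j k. prop_fin T ?g {..<L} (unit_vec_at k) S j)
      = of_real (sum ?f (bounded_configs M L))"
    using eventually_ge_at_top[of M]
  proof eventually_elim
    case (elim L)
    show ?case by (rule dt_prop_fin_eq_sum_configs[OF M elim \<tau> inj])
  qed
  have limC: "(\<lambda>L. complex_of_real (sum ?f (bounded_configs M L))) \<longlonglongrightarrow> X"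
    by (rule Lim_transform_eventually[OF limX ev])
  have lim: "(\<lambda>L. sum ?f (bounded_configs M L)) \<longlonglongrightarrow> Re X"
    using tendsto_Re[OF limC] by (simp only: Re_complex_of_real)
  \<comment> \<open>A limit of real numbers is real, which lets the complex determinant be read as
    the value of a real sum.\<close>
  have X: "X = of_real (Re X)"
    using LIMSEQ_unique[OF limC tendsto_of_real[OF lim]] .
  have hs: "(?f has_sum Re X) (configs N u v)"
  proof (rule has_sum_exhaustion[OF _ finite_bounded_configs[OF M] _ eventually_subset_bounded_configs lim])
    show "0 \<le> ?f lam" for lam using weight_nonneg s by simp
    show "bounded_configs M L \<subseteq> configs N u v" for L by (auto simp: bounded_configs_def)
  qed
  then show "?f summable_on configs N u v" by (rule has_sum_imp_summable)
  show "complex_of_real (infsum ?f (configs N u v)) = X"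
    using infsumI[OF hs] X by simp
qed

lemma empty_config: "(\<lambda>t. empty_partition) \<in> configs N u v"
proof -
  have "interlace empty_partition empty_partition"
    by (simp add: interlace_def empty_partition_def)
  then show ?thesis unfolding configs_iff using is_partition_empty by (simp only: if_cancel simp_thms)
qed

text \<open>Parts of index above \<open>M\<close> are zero and occupy only sites below
  \<open>- M\<close>, whereas a natural \<open>p\<close> stands for a site above
  \<open>- M\<close>.\<close>

lemma in_Lset_iff:
  assumes lam: "lam \<in> configs N u v" and M: "S \<le> M" and p: "j = real_of_int (int p - int M) + 1/2"
  shows "j \<in> Lset (lam t) \<longleftrightarrow> (\<exists>i<M. tuple_of M (lam t) i = p)"
proof
  assume "j \<in> Lset (lam t)"
  then obtain k where k: "1 \<le> k" "j = real (lam t k) - real k + 1/2" by (auto simp: Lset_def)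
  then have e: "int p - int M = int (lam t k) - int k" using p by linarith
  have "k \<le> M"
  proof (rule ccontr)
    assume "\<not> k \<le> M"
    then have "lam t k = 0" using config_length[OF lam, of k t] M by simp
    then show False using e \<open>\<not> k \<le> M\<close> by simp
  qed
  then have "tuple_of M (lam t) (M - k) = p" using k e by (simp add: tuple_of_def)
  then show "\<exists>i<M. tuple_of M (lam t) i = p" using k \<open>k \<le> M\<close> by (intro exI[of _ "M - k"]) simp
next
  assume "\<exists>i<M. tuple_of M (lam t) i = p"
  then obtain i where i: "i < M" "lam t (M - i) + i = p" by (auto simp: tuple_of_def)
  then have "j = real (lam t (M - i)) - real (M - i) + 1/2" using p by (simp add: of_nat_diff)
  then show "j \<in> Lset (lam t)" using i unfolding Lset_def by (intro CollectI exI[of _ "M - i"]) simp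
qed

text \<open>The event that all points are occupied is the top coefficient in \<open>s\<close> of the generating
  function of the number of occupied points, so it is extracted by letting \<open>s\<close> tend to infinity.\<close>

lemma correlation_dt:
  assumes M: "S \<le> M" and n: "0 < n"
    and \<tau>: "\<And>a. a < n \<Longrightarrow> 0 < \<tau> a \<and> \<tau> a \<le> S" and inj: "inj_on (\<lambda>a. (\<tau> a, p a)) {..<n}"
    and p: "\<And>a. a < n \<Longrightarrow> S \<le> p a"
  shows "complex_of_real (config_prob N u v q (\<lambda>lam. hits M n \<tau> p lam = n))
       = dt n (\<lambda>a b. corr_kernel S M (\<tau> a) (p a) (\<tau> b) (p b))"
proof -
  let ?w = "weight N u q" and ?C = "configs N u v" and ?h = "hits M n \<tau> p"
  let ?K = "\<lambda>a b. corr_kernel S M (\<tau> a) (p a) (\<tau> b) (p b)"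
  define G where "G = dt M (\<lambda>i k. evolve 0 S (unit_vec_at k) i)"
  define Z where "Z s = infsum (\<lambda>lam. ?w lam * (1 + s) ^ ?h lam) ?C" for s :: real
  define W where "W = infsum (\<lambda>lam. ?w lam * of_bool (?h lam = n)) ?C"
  have ZG: "complex_of_real (Z s) = G * dt n (\<lambda>a b. (if a = b then 1 else 0) + of_real s * ?K a b)"
    and Zsum: "(\<lambda>lam. ?w lam * (1 + s) ^ ?h lam) summable_on ?C" if "0 \<le> s" for s
    using partition_function[OF M that \<tau> inj p] by (simp_all add: Z_def G_def)
  have Z0: "Z 0 = infsum ?w ?C" and w_sum: "?w summable_on ?C"
    using Zsum[of 0] by (simp_all add: Z_def)
  have "dt n (\<lambda>a b. (if a = b then 1 else 0) + of_real 0 * ?K a b) = 1"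
    by (rule dt_upper_triangular) auto
  \<comment> \<open>At \<open>s = 0\<close> the small determinant is 1, so the Gram determinant is
    the partition function. The empty configuration alone contributes 1 to it, which justifies the
    final division.\<close>
  then have GZ: "G = of_real (Z 0)" using ZG[of 0] by simp
  have "?w (\<lambda>t. empty_partition) = 1"
    by (simp add: weight_def psize_def empty_partition_def)
  then have "1 \<le> Z 0"
    using finite_sum_le_infsum[OF w_sum, of "{\<lambda>t. empty_partition}"] empty_config weight_nonneg
    by (simp add: Z0)
  have E_sum: "(\<lambda>lam. ?w lam * of_bool (?h lam = n)) summable_on ?C"
    by (rule summable_on_comparison_test[OF w_sum]) (use weight_nonneg in auto)
  have W: "infsum ?w {lam \<in> ?C. ?h lam = n} = W"
    unfolding W_def by (rule infsum_cong_neutral) auto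
  have hn: "?h lam \<le> n" for lam
  proof -
    have "?h lam \<le> card {..<n}" unfolding hits_def by (intro card_mono) auto
    then show ?thesis by simp
  qed
  have lower: "W \<le> Z s / s ^ n" if "0 < s" for s
  proof -
    have "W * s ^ n = infsum (\<lambda>lam. s ^ n * (?w lam * of_bool (?h lam = n))) ?C"
      by (simp add: W_def infsum_cmult_right' mult.commute)
    also have "\<dots> \<le> Z s"
      unfolding Z_def
    proof (rule infsum_mono[OF summable_on_cmult_right[OF E_sum] Zsum])
      fix lam
      have "s ^ n \<le> (1 + s) ^ n" using that by (intro power_mono) auto
      then have "?w lam * s ^ n \<le> ?w lam * (1 + s) ^ n" using weight_nonneg by (intro mult_left_mono)
      then show "s ^ n * (?w lam * of_bool (?h lam = n)) \<le> ?w lam * (1 + s) ^ ?h lam"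
        using weight_nonneg[of lam] that by (cases "?h lam = n") (simp_all add: mult.commute)
    qed (use that in simp)
    finally show ?thesis using that by (simp add: pos_le_divide_eq)
  qed
  \<comment> \<open>Configurations that occupy fewer than \<open>n\<close> points contribute only
    order \<open>s ^ (n - 1)\<close>, so division by \<open>s ^ n\<close> isolates the
    event.\<close>
  have upper: "Z s / s ^ n \<le> (1 + 1 / s) ^ n * W + ((1 + 1 / s) ^ (n - 1) / s) * Z 0" if "0 < s" for s
  proof -
    have "Z s \<le> infsum (\<lambda>lam. (1 + s) ^ n * (?w lam * of_bool (?h lam = n)) + (1 + s) ^ (n - 1) * ?w lam) ?C"
      unfolding Z_def
    proof (rule infsum_mono[OF Zsum])
      show "(\<lambda>lam. (1 + s) ^ n * (?w lam * of_bool (?h lam = n)) + (1 + s) ^ (n - 1) * ?w lam) summable_on ?C"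
        by (intro summable_on_add summable_on_cmult_right E_sum w_sum)
      fix lam
      show "?w lam * (1 + s) ^ ?h lam \<le> (1 + s) ^ n * (?w lam * of_bool (?h lam = n)) + (1 + s) ^ (n - 1) * ?w lam"
      proof (cases "?h lam = n")
        case True
        then show ?thesis using weight_nonneg[of lam] that by (simp add: mult.commute)
      next
        case False
        then have "(1 + s) ^ ?h lam \<le> (1 + s) ^ (n - 1)" using hn[of lam] that by (intro power_increasing) auto
        then have "?w lam * (1 + s) ^ ?h lam \<le> ?w lam * (1 + s) ^ (n - 1)"
          using weight_nonneg by (intro mult_left_mono)
        then show ?thesis using False by (simp add: mult.commute)
      qed
    qed (use that in simp)
    also have "\<dots> = (1 + s) ^ n * W + (1 + s) ^ (n - 1) * Z 0"
      by (simp add: infsum_add summable_on_cmult_right E_sum w_sum infsum_cmult_right' W_def Z0)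
    finally have "Z s / s ^ n \<le> ((1 + s) ^ n * W + (1 + s) ^ (n - 1) * Z 0) / s ^ n"
      using that by (intro divide_right_mono) auto
    also have "\<dots> = ((1 + s) / s) ^ n * W + (((1 + s) / s) ^ (n - 1) / s) * Z 0"
    proof -
      have sn: "s ^ n = s ^ (n - 1) * s" using power_minus_mult[OF n, of s] by simp
      have "(x * W + y * Z 0) / (d * s) = x / (d * s) * W + y / d / s * Z 0" for x y d
        by (simp add: add_divide_distrib)
      then show ?thesis by (simp only: sn power_divide)
    qed
    also have "(1 + s) / s = 1 + 1 / s" using that by (simp add: field_simps)
    finally show ?thesis .
  qed
  have inv: "((\<lambda>s::real. 1 / s) \<longlongrightarrow> 0) at_top"
    by (rule real_tendsto_divide_at_top[OF tendsto_const filterlim_ident])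
  have "((\<lambda>s. (1 + 1 / s) ^ n * W + ((1 + 1 / s) ^ (n - 1) * (1 / s)) * Z 0) \<longlongrightarrow>
      (1 + 0) ^ n * W + ((1 + 0) ^ (n - 1) * 0) * Z 0) at_top"
    by (intro tendsto_intros inv)
  then have up_lim: "((\<lambda>s. (1 + 1 / s) ^ n * W + ((1 + 1 / s) ^ (n - 1) / s) * Z 0) \<longlongrightarrow> W) at_top"
    by simp
  have limW: "((\<lambda>s. Z s / s ^ n) \<longlongrightarrow> W) at_top"
  proof (rule tendsto_sandwich[OF _ _ tendsto_const up_lim])
    show "\<forall>\<^sub>F s in at_top. W \<le> Z s / s ^ n"
      using eventually_gt_at_top[of 0] by eventually_elim (rule lower)
    show "\<forall>\<^sub>F s in at_top. Z s / s ^ n \<le> (1 + 1 / s) ^ n * W + ((1 + 1 / s) ^ (n - 1) / s) * Z 0"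
      using eventually_gt_at_top[of 0] by eventually_elim (rule upper)
  qed
  \<comment> \<open>Dividing each of the \<open>n\<close> rows of \<open>1 + s K\<close> by
    \<open>s\<close> leaves entries that tend to those of \<open>K\<close>.\<close>
  have ent: "((\<lambda>s. of_real (1 / s) * (if a = b then 1 else 0) + ?K a b) \<longlongrightarrow> of_real 0 * (if a = b then 1 else 0) + ?K a b) at_top" for a b
    by (intro tendsto_add tendsto_mult tendsto_of_real inv tendsto_const)
  have "((\<lambda>s. G * dt n (\<lambda>a b. of_real (1 / s) * (if a = b then 1 else 0) + ?K a b)) \<longlongrightarrow>
      G * dt n (\<lambda>a b. of_real 0 * (if a = b then 1 else 0) + ?K a b)) at_top"
    by (intro tendsto_mult tendsto_const tendsto_dt ent)
  then have limK: "((\<lambda>s. G * dt n (\<lambda>a b. of_real (1 / s) * (if a = b then 1 else 0) + ?K a b)) \<longlongrightarrow> G * dt n ?K) at_top"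
    by simp
  have ev: "\<forall>\<^sub>F s in at_top. G * dt n (\<lambda>a b. of_real (1 / s) * (if a = b then 1 else 0) + ?K a b)
      = of_real (Z s / s ^ n)"
    using eventually_gt_at_top[of 0]
  proof eventually_elim
    case (elim s)
    have "dt n (\<lambda>a b. of_real (1 / s) * (if a = b then 1 else 0) + ?K a b)
        = dt n (\<lambda>a b. of_real (1 / s) * ((if a = b then 1 else 0) + of_real s * ?K a b))"
      by (rule dt_cong) (use elim in \<open>simp add: distrib_left\<close>)
    also have "\<dots> = of_real (1 / s) ^ n * dt n (\<lambda>a b. (if a = b then 1 else 0) + of_real s * ?K a b)"
      by (simp only: dt_scale_rows prod_constant card_lessThan)
    finally have "G * dt n (\<lambda>a b. of_real (1 / s) * (if a = b then 1 else 0) + ?K a b)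
        = of_real (1 / s) ^ n * complex_of_real (Z s)"
      using elim by (simp only: ZG[OF less_imp_le]) (simp only: mult_ac)
    then show ?case by (simp add: power_divide)
  qed
  have "((\<lambda>s. complex_of_real (Z s / s ^ n)) \<longlongrightarrow> G * dt n ?K) at_top"
    by (rule Lim_transform_eventually[OF limK ev])
  then have "complex_of_real W = G * dt n ?K"
    by (rule tendsto_unique[OF trivial_limit_at_top_linorder tendsto_of_real[OF limW]])
  then show ?thesis
    using \<open>1 \<le> Z 0\<close> unfolding config_prob_def W by (simp add: GZ Z0)
qed

end

hide_const (open) Determinant.det

theorem mainTheorem3:
  fixes N :: nat and u v :: "nat \<Rightarrow> int" and q :: "int \<Rightarrow> real"
    and tp :: "'n::finite \<Rightarrow> int" and jp :: "'n \<Rightarrow> real"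
  assumes model: "model_ok N u v q"
    and distinct: "inj (\<lambda>a. (tp a, jp a))"
    and trange: "\<And>a. u 0 < tp a \<and> tp a < u N"
    and jhalf: "\<And>a. jp a \<in> HalfInts"
  shows "(\<forall>t1 t2. u 0 < t1 \<and> t1 < u N \<and> u 0 < t2 \<and> t2 < u N \<longrightarrow>
            (\<exists>rho1 rho2. radii_ok N u v q t1 t2 rho1 rho2))
       \<and> (\<forall>t1 j1 t2 j2 rho1 rho2 rho1' rho2'.
            u 0 < t1 \<and> t1 < u N \<and> u 0 < t2 \<and> t2 < u N \<and> j1 \<in> HalfInts \<and> j2 \<in> HalfInts \<and>
            radii_ok N u v q t1 t2 rho1 rho2 \<and> radii_ok N u v q t1 t2 rho1' rho2' \<longrightarrow>
            Kern N u v q rho1 rho2 t1 j1 t2 j2 = Kern N u v q rho1' rho2' t1 j1 t2 j2)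
       \<and> (\<forall>rho1 rho2 :: 'n \<Rightarrow> 'n \<Rightarrow> real.
            (\<forall>a b. radii_ok N u v q (tp a) (tp b) (rho1 a b) (rho2 a b)) \<longrightarrow>
            complex_of_real (config_prob N u v q (\<lambda>lam. \<forall>a. jp a \<in> Lset (lam (tp a))))
              = det (\<chi> a b. Kern N u v q (rho1 a b) (rho2 a b) (tp a) (jp a) (tp b) (jp b)))"
proof -
  interpret schur_model N u v q by standard (rule model)
  show ?thesis
  proof (intro conjI allI impI)
    fix t1 t2 assume "u 0 < t1 \<and> t1 < u N \<and> u 0 < t2 \<and> t2 < u N"
    then show "\<exists>rho1 rho2. radii_ok N u v q t1 t2 rho1 rho2" using radii_exist by blast
  next
    fix t1 j1 t2 j2 rho1 rho2 rho1' rho2'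
    assume "u 0 < t1 \<and> t1 < u N \<and> u 0 < t2 \<and> t2 < u N \<and> j1 \<in> HalfInts \<and> j2 \<in> HalfInts \<and>
            radii_ok N u v q t1 t2 rho1 rho2 \<and> radii_ok N u v q t1 t2 rho1' rho2'"
    then show "Kern N u v q rho1 rho2 t1 j1 t2 j2 = Kern N u v q rho1' rho2' t1 j1 t2 j2"
      using Kern_indep by blast
  next
    fix rho1 rho2 :: "'n \<Rightarrow> 'n \<Rightarrow> real"
    assume radii: "\<forall>a b. radii_ok N u v q (tp a) (tp b) (rho1 a b) (rho2 a b)"
    let ?n = "CARD('n)"
    obtain h where h: "bij_betw h {0..<?n} (UNIV :: 'n set)"
      using ex_bij_betw_nat_finite[of "UNIV :: 'n set"] by auto
    have "\<exists>l. jp a = real_of_int l + 1/2" for a using HalfInts_cases[OF jhalf[of a]] by blast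
    then obtain l where l: "jp a = real_of_int (l a) + 1/2" for a by metis
    \<comment> \<open>Beyond \<open>S <= M\<close>, every position \<open>l a + M\<close> has to be
      at least \<open>S\<close>, so that the finite supports around the marked points stay within
      the natural positions.\<close>
    define M where "M = S + (\<Sum>a\<in>UNIV. nat \<bar>l a\<bar>)"
    have lM: "int S \<le> l a + int M" for a
    proof -
      have "nat \<bar>l a\<bar> \<le> (\<Sum>a\<in>UNIV. nat \<bar>l a\<bar>)" by (rule member_le_sum) auto
      then show ?thesis unfolding M_def by linarith
    qed
    define p where "p i = nat (l (h i) + int M)" for i
    define \<tau> where "\<tau> i = rtime (tp (h i))" for i
    have pj: "jp (h i) = real_of_int (int (p i) - int M) + 1/2" for i
      using lM[of "h i"] by (simp add: p_def l)
    have \<tau>: "0 < \<tau> i \<and> \<tau> i \<le> S" and t\<tau>: "u N - int (\<tau> i) = tp (h i)" for i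
      using trange[of "h i"] int_S by (auto simp: \<tau>_def rtime_def)
    have pS: "S \<le> p i" for i using lM[of "h i"] by (simp add: p_def)
    have inj: "inj_on (\<lambda>i. (\<tau> i, p i)) {..<?n}"
    proof (rule inj_onI)
      fix i j assume ij: "i \<in> {..<?n}" "j \<in> {..<?n}" "(\<tau> i, p i) = (\<tau> j, p j)"
      then have "tp (h i) = tp (h j)" "jp (h i) = jp (h j)" using t\<tau> pj by (metis prod.inject)+
      then have "h i = h j" using injD[OF distinct, of "h i" "h j"] by simp
      then show "i = j" using bij_betw_imp_inj_on[OF h] ij by (auto simp: inj_on_def)
    qed
    have event: "(\<forall>a. jp a \<in> Lset (lam (tp a))) \<longleftrightarrow> hits M ?n \<tau> p lam = ?n" if "lam \<in> configs N u v" for lam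
    proof -
      have "(\<forall>a. jp a \<in> Lset (lam (tp a))) \<longleftrightarrow> (\<forall>i<?n. jp (h i) \<in> Lset (lam (tp (h i))))"
        using bij_betw_imp_surj_on[OF h] by (metis UNIV_I atLeastLessThan_iff imageE zero_le)
      also have "\<dots> \<longleftrightarrow> (\<forall>i<?n. \<exists>j<M. tuple_of M (lam (u N - int (\<tau> i))) j = p i)"
        using in_Lset_iff[OF that _ pj] by (simp add: M_def t\<tau>)
      also have "\<dots> \<longleftrightarrow> {i \<in> {..<?n}. \<exists>j<M. tuple_of M (lam (u N - int (\<tau> i))) j = p i} = {..<?n}"
        by auto
      also have "\<dots> \<longleftrightarrow> hits M ?n \<tau> p lam = ?n"
        unfolding hits_def using card_subset_eq[of "{..<?n}"] by (metis (no_types, lifting) card_lessThan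
            finite_lessThan mem_Collect_eq subsetI)
      finally show ?thesis .
    qed
    have "{lam \<in> configs N u v. \<forall>a. jp a \<in> Lset (lam (tp a))} = {lam \<in> configs N u v. hits M ?n \<tau> p lam = ?n}"
      using event by blast
    then have "complex_of_real (config_prob N u v q (\<lambda>lam. \<forall>a. jp a \<in> Lset (lam (tp a))))
        = complex_of_real (config_prob N u v q (\<lambda>lam. hits M ?n \<tau> p lam = ?n))"
      unfolding config_prob_def by (simp only:)
    also have "\<dots> = dt ?n (\<lambda>i j. corr_kernel S M (\<tau> i) (p i) (\<tau> j) (p j))"
      by (rule correlation_dt) (use \<tau> pS inj in \<open>auto simp: M_def\<close>)
    also have "\<dots> = dt ?n (\<lambda>i j. Kern N u v q (rho1 (h i) (h j)) (rho2 (h i) (h j)) (tp (h i)) (jp (h i)) (tp (h j)) (jp (h j)))"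
      unfolding \<tau>_def
      by (intro dt_cong Kern_eq_corr_kernel[symmetric] pj) (use trange radii in auto)
    also have "\<dots> = Determinants.det (\<chi> a b. Kern N u v q (rho1 a b) (rho2 a b) (tp a) (jp a) (tp b) (jp b))"
      by (rule det_eq_dt[OF h, symmetric])
    finally show "complex_of_real (config_prob N u v q (\<lambda>lam. \<forall>a. jp a \<in> Lset (lam (tp a))))
              = Determinants.det (\<chi> a b. Kern N u v q (rho1 a b) (rho2 a b) (tp a) (jp a) (tp b) (jp b))" .
  qed
qed

end
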